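(* Let $(\mathcal{C},\mathcal{E})$ be an exact IT-context, which is weakly idempotent complete. Then the following statements hold true. (a) $\Phi_{\mathcal{E}}(M)=0=\Psi_{\mathcal{E}}(M)$ for all $M\in{}^{{}_{\mathcal{E}}\perp}\mathcal{P}(\mathcal{E})$. (b) $\mathrm{pd}_{\mathcal{E}}(M)=\infty$ if $M\in{}^{{}_{\mathcal{E}}\perp}\mathcal{P}(\mathcal{E})$ and $M\notin\mathcal{P}(\mathcal{E})$.
   Context: Exact categories: $(\mathcal{C},\mathcal{E})$ is an exact category in the sense of Quillen: $\mathcal{C}$ is additive and $\mathcal{E}$ is a class of kernel-cokernel pairs (short $\mathcal{E}$-exact sequences) $A'\rightarrowtail A\twoheadrightarrow A''$ satisfying the usual axioms; the second maps are the admissible epics. An object $P$ is $\mathcal{E}$-projective if $\mathrm{Hom}_{\mathcal{C}}(P,-)$ takes short $\mathcal{E}$-exact sequences to short exact sequences of abelian groups; $\mathcal{P}(\mathcal{E})$ is the class of these. Enough $\mathcal{E}$-projectives: every $C$ admits an admissible epic $P\twoheadrightarrow C$ with $P\in\mathcal{P}(\mathcal{E})$. $\mathrm{Ext}^n_{\mathcal{E}}(C,B)$ is the $n$-th cohomology of $\mathrm{Hom}_{\mathcal{C}}(P_\bullet(C),B)$, with $P_\bullet(C)$ an $\mathcal{E}$-projective resolution of $C$ (spliced from short $\mathcal{E}$-exact sequences), and $\mathrm{pd}_{\mathcal{E}}(C)=\min\{n\in\mathbb{N}: \mathrm{Ext}^j_{\mathcal{E}}(C,Z)=0\ \forall j>n,\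 \forall Z\in\mathcal{C}\}$ ($\infty$ if there is no such $n$). For a class $\mathcal{Y}$, $\mathrm{fpd}_{\mathcal{E}}(\mathcal{Y})=\sup\{\mathrm{pd}_{\mathcal{E}}(Y): Y\in\mathcal{Y},\ \mathrm{pd}_{\mathcal{E}}(Y)<\infty\}$, and ${}^{{}_{\mathcal{E}}\perp}\mathcal{Y}$ is the class of all $M\in\mathcal{C}$ with $\mathrm{Ext}^i_{\mathcal{E}}(M,Y)=0$ for all $Y\in\mathcal{Y}$, $i\ge1$. $\mathcal{C}$ is weakly idempotent complete if every split monomorphism in $\mathcal{C}$ has a cokernel. An exact IT-context is a skeletally small exact category $(\mathcal{C},\mathcal{E})$ with enough $\mathcal{E}$-projectives which is Krull-Schmidt (each object is a finite direct sum of objects with local endomorphism ring). Igusa-Todorov functions: the stable category $\underline{\mathcal{C}}$ has the objects of $\mathcal{C}$, and its morphisms are those of $\mathcal{C}$ modulo morphisms factoring through an object of $\mathcal{P}(\mathcal{E})$. An $\mathcal{E}$-syzygy $\Omega_{\mathcal{E}}(M)$ is an object $K$ in a short $\mathcal{E}$-exact sequence $K\rightarrowtail P\twoheadrightarrow M$ with $P\in\mathcal{P}(\mathcal{E})$; it is unique up to isomorphism in $\underline{\mathcal{C}}$ and $\Omega_{\mathcal{E}}$ is an additive endofunctor of $\underline{\mathcal{C}}$ with iterates $\Omega^n_{\mathcal{E}}$. $K_{\mathcal{E}}(\mathcal{C})$ is the free abelian group on isoclasses $[M]$ of objects of $\mathcal{C}$ modulo $[N]-[S]-[T]$ when $N\cong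 S\oplus T$, and $[P]$ for $P\in\mathcal{P}(\mathcal{E})$; $\Omega_{\mathcal{E}}$ induces the endomorphism $[M]\mapsto[\Omega_{\mathcal{E}}(M)]$ of it. $\langle M\rangle$ is the subgroup of $K_{\mathcal{E}}(\mathcal{C})$ generated by the classes of the indecomposable direct summands of $M$ in $\underline{\mathcal{C}}$. Then $\Phi_{\mathcal{E}}(M)=\min\{k\in\mathbb{N}:\ \Omega_{\mathcal{E}}$ restricts to an isomorphism $\Omega^m_{\mathcal{E}}(\langle M\rangle)\to\Omega^{m+1}_{\mathcal{E}}(\langle M\rangle)$ for all $m\ge k\}$, and $\Psi_{\mathcal{E}}(M)=\Phi_{\mathcal{E}}(M)+\mathrm{fpd}_{\mathcal{E}}(\mathrm{add}(\Omega_{\mathcal{E}}^{\Phi_{\mathcal{E}}(M)}(M)))$, where $\mathrm{add}(X)$ is the class of direct summands of finite direct sums of copies of $X$. *)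

theory Defs
  imports "HOL-Algebra.Ring" "HOL-Algebra.Exact_Sequence" "HOL-Algebra.Free_Abelian_Groups" "HOL-Library.Extended_Nat"
begin

section \<open>Preadditive and additive categories\<close>

text \<open>
  \<open>Cmp C g f\<close> is the composite \<open>g \<circ> f\<close>, and \<open>Zer C A B\<close> is the zero morphism from \<open>A\<close> to \<open>B\<close>.
  Arrows carry their domain and codomain, so distinct hom-sets are disjoint; \<open>Cmp\<close> and \<open>Add\<close> are
  meaningful on composable, respectively parallel, arrows only.
\<close>

record ('o, 'm) cat =
  Obj :: "'o set"
  Arr :: "'m set"
  Dom :: "'m \<Rightarrow> 'o"
  Cod :: "'m \<Rightarrow> 'o"
  Cmp :: "'m \<Rightarrow> 'm \<Rightarrow> 'm"
  Idn :: "'o \<Rightarrow> 'm"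
  Add :: "'m \<Rightarrow> 'm \<Rightarrow> 'm"
  Zer :: "'o \<Rightarrow> 'o \<Rightarrow> 'm"

definition mor :: "('o, 'm) cat \<Rightarrow> 'o \<Rightarrow> 'o \<Rightarrow> 'm set" where
  "mor C A B = {f \<in> Arr C. Dom C f = A \<and> Cod C f = B}"

definition Hom :: "('o, 'm) cat \<Rightarrow> 'o \<Rightarrow> 'o \<Rightarrow> 'm monoid" where
  "Hom C A B = \<lparr>carrier = mor C A B, monoid.mult = Add C, one = Zer C A B\<rparr>"

definition End :: "('o, 'm) cat \<Rightarrow> 'o \<Rightarrow> 'm ring" where
  "End C A = \<lparr>carrier = mor C A A, monoid.mult = Cmp C, one = Idn C A,
              ring.zero = Zer C A A, ring.add = Add C\<rparr>"

locale preadditive_category =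
  fixes C :: "('o, 'm) cat"
  assumes Dom_in_Obj: "f \<in> Arr C \<Longrightarrow> Dom C f \<in> Obj C"
    and Cod_in_Obj: "f \<in> Arr C \<Longrightarrow> Cod C f \<in> Obj C"
    and Idn_in_mor: "A \<in> Obj C \<Longrightarrow> Idn C A \<in> mor C A A"
    and Cmp_in_mor: "f \<in> mor C A B \<Longrightarrow> g \<in> mor C B D \<Longrightarrow> Cmp C g f \<in> mor C A D"
    and Cmp_assoc: "f \<in> mor C A B \<Longrightarrow> g \<in> mor C B D \<Longrightarrow> h \<in> mor C D F \<Longrightarrow>
          Cmp C h (Cmp C g f) = Cmp C (Cmp C h g) f"
    and Cmp_Idn_right: "f \<in> mor C A B \<Longrightarrow> Cmp C f (Idn C A) = f"
    and Cmp_Idn_left: "f \<in> mor C A B \<Longrightarrow> Cmp C (Idn C B) f = f"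
    and Hom_comm_group: "A \<in> Obj C \<Longrightarrow> B \<in> Obj C \<Longrightarrow> comm_group (Hom C A B)"
    and Cmp_Add_right: "f \<in> mor C A B \<Longrightarrow> f' \<in> mor C A B \<Longrightarrow> g \<in> mor C B D \<Longrightarrow>
          Cmp C g (Add C f f') = Add C (Cmp C g f) (Cmp C g f')"
    and Cmp_Add_left: "f \<in> mor C A B \<Longrightarrow> g \<in> mor C B D \<Longrightarrow> g' \<in> mor C B D \<Longrightarrow>
          Cmp C (Add C g g') f = Add C (Cmp C g f) (Cmp C g' f)"

definition zero_object :: "('o, 'm) cat \<Rightarrow> 'o \<Rightarrow> bool" where
  "zero_object C Z \<longleftrightarrow> Z \<in> Obj C \<and>
     (\<forall>A \<in> Obj C. (\<exists>!f. f \<in> mor C A Z) \<and> (\<exists>!f. f \<in> mor C Z A))"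

definition isomorphic :: "('o, 'm) cat \<Rightarrow> 'o \<Rightarrow> 'o \<Rightarrow> bool" where
  "isomorphic C A B \<longleftrightarrow> A \<in> Obj C \<and> B \<in> Obj C \<and>
     (\<exists>f \<in> mor C A B. \<exists>g \<in> mor C B A. Cmp C g f = Idn C A \<and> Cmp C f g = Idn C B)"

definition iso_arrow :: "('o, 'm) cat \<Rightarrow> 'm \<Rightarrow> bool" where
  "iso_arrow C f \<longleftrightarrow> f \<in> Arr C \<and>
     (\<exists>g \<in> mor C (Cod C f) (Dom C f). Cmp C g f = Idn C (Dom C f) \<and> Cmp C f g = Idn C (Cod C f))"

text \<open>
  \<open>direct_sum C Xs X\<close>: \<open>X\<close> is a biproduct of the finite family \<open>Xs\<close>, i.e. \<open>X\<close> is isomorphic to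
  the direct sum of the members of \<open>Xs\<close>.
\<close>

definition direct_sum :: "('o, 'm) cat \<Rightarrow> 'o list \<Rightarrow> 'o \<Rightarrow> bool" where
  "direct_sum C Xs X \<longleftrightarrow> set Xs \<subseteq> Obj C \<and> X \<in> Obj C \<and>
     (\<exists>\<iota> \<pi>. (\<forall>k < length Xs. \<iota> k \<in> mor C (Xs ! k) X \<and> \<pi> k \<in> mor C X (Xs ! k)) \<and>
        (\<forall>k < length Xs. \<forall>l < length Xs.
           Cmp C (\<pi> k) (\<iota> l) = (if k = l then Idn C (Xs ! k) else Zer C (Xs ! l) (Xs ! k))) \<and>
        finsum (End C X) (\<lambda>k. Cmp C (\<iota> k) (\<pi> k)) {..<length Xs} = Idn C X)"

definition direct_summand :: "('o, 'm) cat \<Rightarrow> 'o \<Rightarrow> 'o \<Rightarrow> bool" where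
  "direct_summand C A X \<longleftrightarrow> (\<exists>B. direct_sum C [A, B] X)"

definition indecomposable :: "('o, 'm) cat \<Rightarrow> 'o \<Rightarrow> bool" where
  "indecomposable C X \<longleftrightarrow> X \<in> Obj C \<and> \<not> zero_object C X \<and>
     (\<forall>A B. direct_sum C [A, B] X \<longrightarrow> zero_object C A \<or> zero_object C B)"

definition add_class :: "('o, 'm) cat \<Rightarrow> 'o \<Rightarrow> 'o set" where
  "add_class C X = {A. \<exists>n Y. direct_sum C (replicate n X) Y \<and> direct_summand C A Y}"

locale additive_category = preadditive_category +
  assumes ex_zero_object: "\<exists>Z. zero_object C Z"
    and ex_direct_sum: "A \<in> Obj C \<Longrightarrow> B \<in> Obj C \<Longrightarrow> \<exists>X. direct_sum C [A, B] X"

definition is_kernel :: "('o, 'm) cat \<Rightarrow> 'm \<Rightarrow> 'm \<Rightarrow> bool" where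
  "is_kernel C k f \<longleftrightarrow> f \<in> Arr C \<and> k \<in> Arr C \<and> Cod C k = Dom C f \<and>
     Cmp C f k = Zer C (Dom C k) (Cod C f) \<and>
     (\<forall>x \<in> Arr C. Cod C x = Dom C f \<and> Cmp C f x = Zer C (Dom C x) (Cod C f) \<longrightarrow>
        (\<exists>!u. u \<in> mor C (Dom C x) (Dom C k) \<and> Cmp C k u = x))"

definition is_cokernel :: "('o, 'm) cat \<Rightarrow> 'm \<Rightarrow> 'm \<Rightarrow> bool" where
  "is_cokernel C q f \<longleftrightarrow> f \<in> Arr C \<and> q \<in> Arr C \<and> Dom C q = Cod C f \<and>
     Cmp C q f = Zer C (Dom C f) (Cod C q) \<and>
     (\<forall>x \<in> Arr C. Dom C x = Cod C f \<and> Cmp C x f = Zer C (Dom C f) (Cod C x) \<longrightarrow>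
        (\<exists>!u. u \<in> mor C (Cod C q) (Cod C x) \<and> Cmp C u q = x))"

definition weakly_idempotent_complete :: "('o, 'm) cat \<Rightarrow> bool" where
  "weakly_idempotent_complete C \<longleftrightarrow>
     (\<forall>s \<in> Arr C. (\<exists>r \<in> mor C (Cod C s) (Dom C s). Cmp C r s = Idn C (Dom C s)) \<longrightarrow>
        (\<exists>q. is_cokernel C q s))"

text \<open>\<open>is_pushout C f g g' f'\<close>: the square \<open>g' \<circ> f = f' \<circ> g\<close> is a pushout of \<open>f\<close> and \<open>g\<close>.\<close>

definition is_pushout :: "('o, 'm) cat \<Rightarrow> 'm \<Rightarrow> 'm \<Rightarrow> 'm \<Rightarrow> 'm \<Rightarrow> bool" where
  "is_pushout C f g g' f' \<longleftrightarrow>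
     f \<in> Arr C \<and> g \<in> Arr C \<and> g' \<in> Arr C \<and> f' \<in> Arr C \<and>
     Dom C f = Dom C g \<and> Dom C g' = Cod C f \<and> Dom C f' = Cod C g \<and> Cod C g' = Cod C f' \<and>
     Cmp C g' f = Cmp C f' g \<and>
     (\<forall>x \<in> Arr C. \<forall>y \<in> Arr C. Dom C x = Cod C f \<and> Dom C y = Cod C g \<and> Cod C x = Cod C y \<and>
        Cmp C x f = Cmp C y g \<longrightarrow>
        (\<exists>!u. u \<in> mor C (Cod C g') (Cod C x) \<and> Cmp C u g' = x \<and> Cmp C u f' = y))"

text \<open>\<open>is_pullback C f g g' f'\<close>: the square \<open>f \<circ> g' = g \<circ> f'\<close> is a pullback of \<open>f\<close> and \<open>g\<close>.\<close>

definition is_pullback :: "('o, 'm) cat \<Rightarrow> 'm \<Rightarrow> 'm \<Rightarrow> 'm \<Rightarrow> 'm \<Rightarrow> bool" where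
  "is_pullback C f g g' f' \<longleftrightarrow>
     f \<in> Arr C \<and> g \<in> Arr C \<and> g' \<in> Arr C \<and> f' \<in> Arr C \<and>
     Cod C f = Cod C g \<and> Cod C g' = Dom C f \<and> Cod C f' = Dom C g \<and> Dom C g' = Dom C f' \<and>
     Cmp C f g' = Cmp C g f' \<and>
     (\<forall>x \<in> Arr C. \<forall>y \<in> Arr C. Cod C x = Dom C f \<and> Cod C y = Dom C g \<and> Dom C x = Dom C y \<and>
        Cmp C f x = Cmp C g y \<longrightarrow>
        (\<exists>!u. u \<in> mor C (Dom C x) (Dom C g') \<and> Cmp C g' u = x \<and> Cmp C f' u = y))"


section \<open>Exact categories\<close>

definition adm_monic :: "('m \<times> 'm) set \<Rightarrow> 'm \<Rightarrow> bool" where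
  "adm_monic E i \<longleftrightarrow> (\<exists>p. (i, p) \<in> E)"

definition adm_epic :: "('m \<times> 'm) set \<Rightarrow> 'm \<Rightarrow> bool" where
  "adm_epic E p \<longleftrightarrow> (\<exists>i. (i, p) \<in> E)"

text \<open>
  Quillen's axioms in the self-dual form: \<open>E\<close> is an isomorphism-closed class of kernel-cokernel
  pairs; identities are admissible monics and admissible epics; both classes are closed under
  composition; admissible monics (epics) are stable under pushouts (pullbacks), which exist.
\<close>

locale exact_category = additive_category C for C :: "('o, 'm) cat" +
  fixes E :: "('m \<times> 'm) set"
  assumes E_kernel: "(i, p) \<in> E \<Longrightarrow> is_kernel C i p"
    and E_cokernel: "(i, p) \<in> E \<Longrightarrow> is_cokernel C p i"
    and E_iso_closed: "(i, p) \<in> E \<Longrightarrow> iso_arrow C a \<Longrightarrow> iso_arrow C b \<Longrightarrow> iso_arrow C c \<Longrightarrow>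
          Dom C a = Dom C i \<Longrightarrow> Dom C b = Cod C i \<Longrightarrow> Dom C c = Cod C p \<Longrightarrow>
          i' \<in> mor C (Cod C a) (Cod C b) \<Longrightarrow> p' \<in> mor C (Cod C b) (Cod C c) \<Longrightarrow>
          Cmp C i' a = Cmp C b i \<Longrightarrow> Cmp C p' b = Cmp C c p \<Longrightarrow> (i', p') \<in> E"
    and Idn_monic: "A \<in> Obj C \<Longrightarrow> adm_monic E (Idn C A)"
    and Idn_epic: "A \<in> Obj C \<Longrightarrow> adm_epic E (Idn C A)"
    and Cmp_monic: "adm_monic E i \<Longrightarrow> adm_monic E j \<Longrightarrow> Cod C i = Dom C j \<Longrightarrow>
          adm_monic E (Cmp C j i)"
    and Cmp_epic: "adm_epic E p \<Longrightarrow> adm_epic E q \<Longrightarrow> Cod C p = Dom C q \<Longrightarrow>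
          adm_epic E (Cmp C q p)"
    and pushout_monic: "adm_monic E i \<Longrightarrow> f \<in> Arr C \<Longrightarrow> Dom C f = Dom C i \<Longrightarrow>
          \<exists>f' i'. is_pushout C i f f' i' \<and> adm_monic E i'"
    and pullback_epic: "adm_epic E p \<Longrightarrow> f \<in> Arr C \<Longrightarrow> Cod C f = Cod C p \<Longrightarrow>
          \<exists>f' p'. is_pullback C p f f' p' \<and> adm_epic E p'"

text \<open>The library's \<open>short_exact_sequence\<close> lists its groups and maps from right to left.\<close>

definition Proj :: "('o, 'm) cat \<Rightarrow> ('m \<times> 'm) set \<Rightarrow> 'o set" where
  "Proj C E = {P \<in> Obj C. \<forall>(i, p) \<in> E.
     short_exact_sequence (Hom C P (Cod C p)) (Hom C P (Cod C i)) (Hom C P (Dom C i))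
       (Cmp C p) (Cmp C i)}"

definition enough_projectives :: "('o, 'm) cat \<Rightarrow> ('m \<times> 'm) set \<Rightarrow> bool" where
  "enough_projectives C E \<longleftrightarrow>
     (\<forall>X \<in> Obj C. \<exists>P \<in> Proj C E. \<exists>p \<in> mor C P X. adm_epic E p)"


section \<open>Ext groups and projective dimension\<close>

text \<open>
  \<open>\<cdots> \<rightarrow> P 2 \<rightarrow> P 1 \<rightarrow> P 0\<close> with \<open>d n : P (n + 1) \<rightarrow> P n\<close> is spliced from short exact sequences
  \<open>K (n + 1) \<rightarrow> P n \<rightarrow> K n\<close>, where \<open>K 0 = X\<close>.
\<close>

definition proj_resolution ::
    "('o, 'm) cat \<Rightarrow> ('m \<times> 'm) set \<Rightarrow> 'o \<Rightarrow> (nat \<Rightarrow> 'o) \<Rightarrow> (nat \<Rightarrow> 'm) \<Rightarrow> bool" where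
  "proj_resolution C E X P d \<longleftrightarrow>
     (\<exists>K i p. K 0 = X \<and>
        (\<forall>n. P n \<in> Proj C E \<and> (i n, p n) \<in> E \<and>
             i n \<in> mor C (K (Suc n)) (P n) \<and> p n \<in> mor C (P n) (K n) \<and>
             d n = Cmp C (i n) (p (Suc n))))"

definition cocycles :: "('o, 'm) cat \<Rightarrow> (nat \<Rightarrow> 'o) \<Rightarrow> (nat \<Rightarrow> 'm) \<Rightarrow> nat \<Rightarrow> 'o \<Rightarrow> 'm set" where
  "cocycles C P d n B =
     kernel (Hom C (P n) B) (Hom C (P (Suc n)) B) (\<lambda>f. Cmp C f (d n))"

definition coboundaries :: "('o, 'm) cat \<Rightarrow> (nat \<Rightarrow> 'o) \<Rightarrow> (nat \<Rightarrow> 'm) \<Rightarrow> nat \<Rightarrow> 'o \<Rightarrow> 'm set" where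
  "coboundaries C P d n B =
     (case n of 0 \<Rightarrow> {Zer C (P 0) B}
      | Suc m \<Rightarrow> (\<lambda>f. Cmp C f (d m)) ` mor C (P m) B)"

text \<open>Computed from one chosen resolution of \<open>X\<close>, on which it depends only up to isomorphism.\<close>

definition Ext :: "('o, 'm) cat \<Rightarrow> ('m \<times> 'm) set \<Rightarrow> nat \<Rightarrow> 'o \<Rightarrow> 'o \<Rightarrow> 'm set monoid" where
  "Ext C E n X B =
     (let (P, d) = (SOME (P, d). proj_resolution C E X P d)
      in (Hom C (P n) B)\<lparr>carrier := cocycles C P d n B\<rparr> Mod coboundaries C P d n B)"

text \<open>In \<^typ>\<open>enat\<close> the infimum of the empty set is \<open>\<infinity>\<close> and the supremum of the empty set is \<open>0\<close>.\<close>

definition pd :: "('o, 'm) cat \<Rightarrow> ('m \<times> 'm) set \<Rightarrow> 'o \<Rightarrow> enat" where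
  "pd C E X = Inf {enat n | n. \<forall>j > n. \<forall>Z \<in> Obj C. trivial_group (Ext C E j X Z)}"

definition fpd :: "('o, 'm) cat \<Rightarrow> ('m \<times> 'm) set \<Rightarrow> 'o set \<Rightarrow> enat" where
  "fpd C E Y = Sup {pd C E X | X. X \<in> Y \<and> pd C E X < \<infinity>}"

definition left_perp :: "('o, 'm) cat \<Rightarrow> ('m \<times> 'm) set \<Rightarrow> 'o set \<Rightarrow> 'o set" where
  "left_perp C E Y = {M \<in> Obj C. \<forall>B \<in> Y. \<forall>i \<ge> 1. trivial_group (Ext C E i M B)}"


section \<open>Exact IT-contexts\<close>

text \<open>Local, for a ring that need not be commutative: nonzero, and the non-units are closed under addition.\<close>

definition local_ring :: "'a ring \<Rightarrow> bool" where
  "local_ring R \<longleftrightarrow> ring R \<and> \<one>\<^bsub>R\<^esub> \<noteq> \<zero>\<^bsub>R\<^esub> \<and>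
     (\<forall>a \<in> carrier R. \<forall>b \<in> carrier R. a \<notin> Units R \<and> b \<notin> Units R \<longrightarrow> a \<oplus>\<^bsub>R\<^esub> b \<notin> Units R)"

definition krull_schmidt :: "('o, 'm) cat \<Rightarrow> bool" where
  "krull_schmidt C \<longleftrightarrow>
     (\<forall>X \<in> Obj C. \<exists>Xs. (\<forall>A \<in> set Xs. local_ring (End C A)) \<and> direct_sum C Xs X)"

text \<open>
  Skeletal smallness is not a separate assumption: \<open>Obj C\<close> and \<open>Arr C\<close> are sets, so the
  isomorphism classes of objects always form a set.
\<close>

locale exact_IT_context = exact_category +
  assumes enough_projectives: "enough_projectives C E"
    and krull_schmidt: "krull_schmidt C"


section \<open>The stable category and syzygies\<close>

definition proj_ideal :: "('o, 'm) cat \<Rightarrow> ('m \<times> 'm) set \<Rightarrow> 'o \<Rightarrow> 'o \<Rightarrow> 'm set" where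
  "proj_ideal C E A B = {Cmp C g f | f g P. P \<in> Proj C E \<and> f \<in> mor C A P \<and> g \<in> mor C P B}"

definition stable_class :: "('o, 'm) cat \<Rightarrow> ('m \<times> 'm) set \<Rightarrow> 'm \<Rightarrow> 'm set" where
  "stable_class C E f =
     proj_ideal C E (Dom C f) (Cod C f) #>\<^bsub>Hom C (Dom C f) (Cod C f)\<^esub> f"

definition rep :: "'a set \<Rightarrow> 'a" where
  "rep S = (SOME x. x \<in> S)"

text \<open>
  The arrows are the cosets of \<open>proj_ideal\<close>, with structure induced on representatives. Hom-sets
  being disjoint, a coset determines its domain and codomain.
\<close>

definition stable_cat :: "('o, 'm) cat \<Rightarrow> ('m \<times> 'm) set \<Rightarrow> ('o, 'm set) cat" where
  "stable_cat C E =
     \<lparr>Obj = Obj C,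
      Arr = stable_class C E ` Arr C,
      Dom = (\<lambda>S. Dom C (rep S)),
      Cod = (\<lambda>S. Cod C (rep S)),
      Cmp = (\<lambda>S T. stable_class C E (Cmp C (rep S) (rep T))),
      Idn = (\<lambda>A. stable_class C E (Idn C A)),
      Add = (\<lambda>S T. stable_class C E (Add C (rep S) (rep T))),
      Zer = (\<lambda>A B. stable_class C E (Zer C A B))\<rparr>"

definition is_syzygy :: "('o, 'm) cat \<Rightarrow> ('m \<times> 'm) set \<Rightarrow> 'o \<Rightarrow> 'o \<Rightarrow> bool" where
  "is_syzygy C E M K \<longleftrightarrow>
     (\<exists>P \<in> Proj C E. \<exists>i \<in> mor C K P. \<exists>p \<in> mor C P M. (i, p) \<in> E)"

definition Syz :: "('o, 'm) cat \<Rightarrow> ('m \<times> 'm) set \<Rightarrow> 'o \<Rightarrow> 'o" where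
  "Syz C E M = (SOME K. is_syzygy C E M K)"


section \<open>Igusa-Todorov functions\<close>

definition iso_class :: "('o, 'm) cat \<Rightarrow> 'o \<Rightarrow> 'o set" where
  "iso_class C M = {N. isomorphic C N M}"

definition free_on_iso_classes :: "('o, 'm) cat \<Rightarrow> ('o set \<Rightarrow>\<^sub>0 int) monoid" where
  "free_on_iso_classes C = free_Abelian_group (iso_class C ` Obj C)"

definition K_relations :: "('o, 'm) cat \<Rightarrow> ('m \<times> 'm) set \<Rightarrow> ('o set \<Rightarrow>\<^sub>0 int) set" where
  "K_relations C E = generate (free_on_iso_classes C)
     ({frag_of (iso_class C N) - frag_of (iso_class C S) - frag_of (iso_class C T) | N S T.
         direct_sum C [S, T] N} \<union>
      {frag_of (iso_class C P) | P. P \<in> Proj C E})"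

definition K_group :: "('o, 'm) cat \<Rightarrow> ('m \<times> 'm) set \<Rightarrow> ('o set \<Rightarrow>\<^sub>0 int) set monoid" where
  "K_group C E = free_on_iso_classes C Mod K_relations C E"

definition K_class :: "('o, 'm) cat \<Rightarrow> ('m \<times> 'm) set \<Rightarrow> 'o \<Rightarrow> ('o set \<Rightarrow>\<^sub>0 int) set" where
  "K_class C E M = K_relations C E #>\<^bsub>free_on_iso_classes C\<^esub> frag_of (iso_class C M)"

text \<open>
  The induced endomorphism is determined on the carrier of \<open>K_group C E\<close>, since the classes of
  objects generate that group.
\<close>

definition K_syz ::
    "('o, 'm) cat \<Rightarrow> ('m \<times> 'm) set \<Rightarrow> ('o set \<Rightarrow>\<^sub>0 int) set \<Rightarrow> ('o set \<Rightarrow>\<^sub>0 int) set" where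
  "K_syz C E = (SOME L. L \<in> hom (K_group C E) (K_group C E) \<and>
     (\<forall>M \<in> Obj C. L (K_class C E M) = K_class C E (Syz C E M)))"

definition K_span :: "('o, 'm) cat \<Rightarrow> ('m \<times> 'm) set \<Rightarrow> 'o \<Rightarrow> ('o set \<Rightarrow>\<^sub>0 int) set set" where
  "K_span C E M = generate (K_group C E)
     {K_class C E X | X. indecomposable (stable_cat C E) X \<and> direct_summand (stable_cat C E) X M}"

definition Phi :: "('o, 'm) cat \<Rightarrow> ('m \<times> 'm) set \<Rightarrow> 'o \<Rightarrow> nat" where
  "Phi C E M = (LEAST k. \<forall>m \<ge> k.
     K_syz C E \<in> iso ((K_group C E)\<lparr>carrier := (K_syz C E ^^ m) ` K_span C E M\<rparr>)
                     ((K_group C E)\<lparr>carrier := (K_syz C E ^^ Suc m) ` K_span C E M\<rparr>))"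

definition Psi :: "('o, 'm) cat \<Rightarrow> ('m \<times> 'm) set \<Rightarrow> 'o \<Rightarrow> enat" where
  "Psi C E M = enat (Phi C E M) + fpd C E (add_class C ((Syz C E ^^ Phi C E M) M))"

end

theory Submission
  imports Defs
begin

text \<open>
  Let \<open>M\<close> satisfy \<open>Ext\<^sup>i(M, P) = 0\<close> for all \<open>i \<ge> 1\<close> and all projective \<open>P\<close>. In terms of a resolution
  spliced from short exact sequences \<open>K (n + 1) \<rightarrow> P n \<rightarrow> K n\<close> with \<open>K 0 = M\<close>, this says that every map
  from \<open>K (n + 1)\<close> to a projective extends to \<open>P n\<close>. It is a property of the stable class of \<open>M\<close>, inherited
  by stable direct summands (\<open>perp_stable_retract\<close>), finite direct sums and syzygies; \<open>perp\<close> is this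
  property.

  If in addition \<open>pd M\<close> is finite, then \<open>Ext\<^sup>n\<^sup>+\<^sup>1(M, K (n + 1)) = 0\<close> for some \<open>n\<close>, so the identity of
  \<open>K (n + 1)\<close> extends to \<open>P n\<close> and \<open>K (n + 1)\<close> is a summand of a projective. Now the identity of \<open>K (n + 1)\<close>
  is a map to a projective, the sequence \<open>K (n + 1) \<rightarrow> P n \<rightarrow> K n\<close> splits, \<open>K n\<close> is projective, and so
  on down to \<open>M\<close>. Hence \<open>M\<close> is projective (\<open>perp_finite_pd_imp_Proj\<close>), which is the second claim. Applied
  to the objects of \<open>add M\<close> it also shows \<open>fpd (add M) = 0\<close>.

  For \<open>\<Phi> M = 0\<close> it suffices that the syzygy endomorphism \<open>L\<close> of the Grothendieck group is injective
  on some subgroup that contains \<open>\<langle>M\<rangle>\<close> and is mapped into itself. This holds for the subgroup of all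
  \<open>[A] - [B]\<close> with \<open>A\<close> and \<open>B\<close> in the perpendicular class: if \<open>[\<Omega> A] = [\<Omega> B]\<close>, then \<open>[A] = [B]\<close>
  (\<open>perp_kc_Syz_inj\<close>). Indeed \<open>[\<Omega> A] = [\<Omega> B]\<close> means that \<open>\<Omega> A\<close> and \<open>\<Omega> B\<close> become isomorphic after adding
  projectives and a common object, and the common object cancels because its indecomposable summands have
  local endomorphism rings (\<open>cancel_local\<close>). Modulo projectives \<open>A\<close> and \<open>B\<close> then are cokernels of one
  object embedded into two projectives. By the vanishing of Ext each embedding extends along the other,
  so the two cokernels agree up to projective summands (\<open>dual_schanuel\<close>). Schanuel's lemma itself shows that
  \<open>L\<close> exists.
\<close>

section \<open>Equational reasoning with arrows\<close>

text \<open>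
  The laws of a preadditive category are restated with conditions on \<open>Arr\<close>, \<open>Dom\<close> and \<open>Cod\<close> in place of
  membership in \<open>mor C A B\<close>: such conditions contain no objects that do not occur in the term being
  rewritten, so conditional rewriting can discharge them. The resulting rule set \<open>hom_simps\<close> normalises sums of
  composites of arrows.
\<close>

context preadditive_category
begin

abbreviation Comp (infixr "\<cdot>" 70) where "g \<cdot> f \<equiv> Cmp C g f"
abbreviation Plus (infixl "\<^bold>+" 65) where "f \<^bold>+ g \<equiv> Add C f g"

definition Neg ("\<^bold>- _" [81] 80) where "Neg f = inv\<^bsub>Hom C (Dom C f) (Cod C f)\<^esub> f"

lemma mor_iff: "f \<in> mor C A B \<longleftrightarrow> f \<in> Arr C \<and> Dom C f = A \<and> Cod C f = B"
  by (auto simp: mor_def)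

lemma mor_objs: "f \<in> mor C A B \<Longrightarrow> A \<in> Obj C" "f \<in> mor C A B \<Longrightarrow> B \<in> Obj C"
  using Dom_in_Obj Cod_in_Obj by (auto simp: mor_iff)

lemma Hom_group: "A \<in> Obj C \<Longrightarrow> B \<in> Obj C \<Longrightarrow> group (Hom C A B)"
  using Hom_comm_group by (auto simp: comm_group_def)

lemma Hom_simps [simp]:
  "carrier (Hom C A B) = mor C A B" "f \<otimes>\<^bsub>Hom C A B\<^esub> g = f \<^bold>+ g" "\<one>\<^bsub>Hom C A B\<^esub> = Zer C A B"
  by (simp_all add: Hom_def)

lemma Idn_arr: assumes "A \<in> Obj C"
  shows "Idn C A \<in> Arr C" "Dom C (Idn C A) = A" "Cod C (Idn C A) = A"
  using Idn_in_mor[OF assms] by (auto simp: mor_iff)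

lemma Zer_arr: assumes "A \<in> Obj C" "B \<in> Obj C"
  shows "Zer C A B \<in> Arr C" "Dom C (Zer C A B) = A" "Cod C (Zer C A B) = B"
proof -
  interpret G: group "Hom C A B" using assms by (rule Hom_group)
  show "Zer C A B \<in> Arr C" "Dom C (Zer C A B) = A" "Cod C (Zer C A B) = B"
    using G.one_closed by (auto simp: mor_iff)
qed

lemma Cmp_arr: assumes "f \<in> Arr C" "g \<in> Arr C" "Cod C f = Dom C g"
  shows "g \<cdot> f \<in> Arr C" "Dom C (g \<cdot> f) = Dom C f" "Cod C (g \<cdot> f) = Cod C g"
  using Cmp_in_mor[of f "Dom C f" "Cod C f" g "Cod C g"] assms by (auto simp: mor_iff)

lemma Add_arr: assumes "f \<in> Arr C" "g \<in> Arr C" "Dom C f = Dom C g" "Cod C f = Cod C g"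
  shows "f \<^bold>+ g \<in> Arr C" "Dom C (f \<^bold>+ g) = Dom C g" "Cod C (f \<^bold>+ g) = Cod C g"
proof -
  interpret G: group "Hom C (Dom C g) (Cod C g)" using assms Dom_in_Obj Cod_in_Obj Hom_group by auto
  show "f \<^bold>+ g \<in> Arr C" "Dom C (f \<^bold>+ g) = Dom C g" "Cod C (f \<^bold>+ g) = Cod C g"
    using G.m_closed[of f g] assms by (auto simp: mor_iff)
qed

lemma Neg_arr: assumes "f \<in> Arr C"
  shows "\<^bold>- f \<in> Arr C" "Dom C (\<^bold>- f) = Dom C f" "Cod C (\<^bold>- f) = Cod C f"
proof -
  interpret G: group "Hom C (Dom C f) (Cod C f)" using assms Dom_in_Obj Cod_in_Obj Hom_group by auto
  show "\<^bold>- f \<in> Arr C" "Dom C (\<^bold>- f) = Dom C f" "Cod C (\<^bold>- f) = Cod C f"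
    using G.inv_closed[of f] assms by (auto simp: mor_iff Neg_def)
qed

lemmas arr_simps = mor_iff Idn_arr Zer_arr Cmp_arr Add_arr Neg_arr Dom_in_Obj Cod_in_Obj

lemma Cmp_assoc': "\<lbrakk>f \<in> Arr C; g \<in> Arr C; h \<in> Arr C; Cod C f = Dom C g; Cod C g = Dom C h\<rbrakk> \<Longrightarrow>
    (h \<cdot> g) \<cdot> f = h \<cdot> g \<cdot> f"
  using Cmp_assoc[of f "Dom C f" "Cod C f" g "Cod C g" h "Cod C h"] by (simp add: mor_iff)

lemma Cmp_Idn: "f \<in> Arr C \<Longrightarrow> Dom C f = A \<Longrightarrow> f \<cdot> Idn C A = f"
    "f \<in> Arr C \<Longrightarrow> Cod C f = A \<Longrightarrow> Idn C A \<cdot> f = f"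
  using Cmp_Idn_right[of f A "Cod C f"] Cmp_Idn_left[of f "Dom C f" A] by (auto simp: mor_iff)

lemma Cmp_Add: 
  "\<lbrakk>f \<in> Arr C; f' \<in> Arr C; g \<in> Arr C; Dom C f = Dom C f'; Cod C f = Cod C f'; Cod C f' = Dom C g\<rbrakk>
     \<Longrightarrow> g \<cdot> (f \<^bold>+ f') = g \<cdot> f \<^bold>+ g \<cdot> f'"
  "\<lbrakk>f \<in> Arr C; g \<in> Arr C; g' \<in> Arr C; Dom C g = Dom C g'; Cod C g = Cod C g'; Cod C f = Dom C g'\<rbrakk>
     \<Longrightarrow> (g \<^bold>+ g') \<cdot> f = g \<cdot> f \<^bold>+ g' \<cdot> f"
  using Cmp_Add_right[of f "Dom C f" "Cod C f" f' g "Cod C g"]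
    Cmp_Add_left[of f "Dom C f" "Cod C f" g "Cod C g" g'] by (simp_all add: mor_iff)

lemma Add_ac: assumes "f \<in> Arr C" "g \<in> Arr C" "h \<in> Arr C" 
    "Dom C f = Dom C g" "Cod C f = Cod C g" "Dom C g = Dom C h" "Cod C g = Cod C h"
  shows "f \<^bold>+ g \<^bold>+ h = f \<^bold>+ (g \<^bold>+ h)" "f \<^bold>+ (g \<^bold>+ h) = g \<^bold>+ (f \<^bold>+ h)"
proof -
  interpret G: comm_group "Hom C (Dom C g) (Cod C g)"
    using assms Dom_in_Obj Cod_in_Obj Hom_comm_group by auto
  show "f \<^bold>+ g \<^bold>+ h = f \<^bold>+ (g \<^bold>+ h)" "f \<^bold>+ (g \<^bold>+ h) = g \<^bold>+ (f \<^bold>+ h)"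
    using assms G.m_assoc[of f g h] G.m_lcomm[of f g h] by (auto simp: mor_iff)
qed

lemma Add_comm: assumes "f \<in> Arr C" "g \<in> Arr C" "Dom C f = Dom C g" "Cod C f = Cod C g"
  shows "f \<^bold>+ g = g \<^bold>+ f"
proof -
  interpret G: comm_group "Hom C (Dom C g) (Cod C g)"
    using assms Dom_in_Obj Cod_in_Obj Hom_comm_group by auto
  show ?thesis using assms G.m_comm[of f g] by (auto simp: mor_iff)
qed

lemma Add_Zer: assumes "f \<in> Arr C" "Dom C f = A" "Cod C f = B"
  shows "f \<^bold>+ Zer C A B = f" "Zer C A B \<^bold>+ f = f"
proof -
  interpret G: comm_group "Hom C A B"
    using assms Dom_in_Obj Cod_in_Obj Hom_comm_group by auto
  show "f \<^bold>+ Zer C A B = f" "Zer C A B \<^bold>+ f = f" 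
    using assms G.r_one[of f] G.l_one[of f] by (auto simp: mor_iff)
qed

lemma Add_Neg: assumes "f \<in> Arr C" 
  shows "f \<^bold>+ \<^bold>- f = Zer C (Dom C f) (Cod C f)" "\<^bold>- f \<^bold>+ f = Zer C (Dom C f) (Cod C f)" 
proof -
  interpret G: comm_group "Hom C (Dom C f) (Cod C f)"
    using assms Dom_in_Obj Cod_in_Obj Hom_comm_group by auto
  show "f \<^bold>+ \<^bold>- f = Zer C (Dom C f) (Cod C f)" "\<^bold>- f \<^bold>+ f = Zer C (Dom C f) (Cod C f)" 
    using assms G.r_inv[of f] G.l_inv[of f] by (auto simp: mor_iff Neg_def)
qed

lemma Add_Neg_left: assumes "f \<in> Arr C" "g \<in> Arr C" "Dom C f = Dom C g" "Cod C f = Cod C g"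
  shows "f \<^bold>+ (\<^bold>- f \<^bold>+ g) = g" "\<^bold>- f \<^bold>+ (f \<^bold>+ g) = g" 
proof -
  have "f \<^bold>+ (\<^bold>- f \<^bold>+ g) = (f \<^bold>+ \<^bold>- f) \<^bold>+ g" "\<^bold>- f \<^bold>+ (f \<^bold>+ g) = (\<^bold>- f \<^bold>+ f) \<^bold>+ g"
    using assms by (simp_all add: Add_ac(1) arr_simps)
  then show "f \<^bold>+ (\<^bold>- f \<^bold>+ g) = g" "\<^bold>- f \<^bold>+ (f \<^bold>+ g) = g" 
    using assms by (simp_all add: Add_Neg Add_Zer)
qed

lemma Neg_eqI: assumes "f \<in> Arr C" "g \<in> Arr C" "Dom C f = Dom C g" "Cod C f = Cod C g"
   "f \<^bold>+ g = Zer C (Dom C g) (Cod C g)" shows "\<^bold>- f = g"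
proof -
  have "g = \<^bold>- f \<^bold>+ (f \<^bold>+ g)" using assms(1-4) by (simp add: Add_Neg_left)
  also have "\<dots> = \<^bold>- f" unfolding assms(5) using assms(1-4) by (simp add: Add_Zer Neg_arr)
  finally show ?thesis ..
qed

lemma Add_cancel: assumes "f \<in> Arr C" "g \<in> Arr C" "h \<in> Arr C" 
    "Dom C f = Dom C h" "Cod C f = Cod C h" "Dom C g = Dom C h" "Cod C g = Cod C h"
  shows "h \<^bold>+ f = h \<^bold>+ g \<longleftrightarrow> f = g"
  using Add_Neg_left(2)[of h f] Add_Neg_left(2)[of h g] assms by metis

lemma Cmp_Zer: assumes "f \<in> Arr C" "A \<in> Obj C" "B \<in> Obj C" 
  shows "Dom C f = B \<Longrightarrow> f \<cdot> Zer C A B = Zer C A (Cod C f)"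
    "Cod C f = A \<Longrightarrow> Zer C A B \<cdot> f = Zer C (Dom C f) B"
proof -
  have *: "z = Zer C A' B'" if "z \<in> Arr C" "Dom C z = A'" "Cod C z = B'" "z \<^bold>+ z = z" for z A' B'
  proof -
    have "A' \<in> Obj C" "B' \<in> Obj C" using that Dom_in_Obj Cod_in_Obj by auto
    then have "Zer C A' B' \<in> Arr C" "Dom C (Zer C A' B') = A'" "Cod C (Zer C A' B') = B'"
      by (rule Zer_arr)+
    moreover have "z \<^bold>+ z = z \<^bold>+ Zer C A' B'" using that(4) Add_Zer(1)[OF that(1-3)] by simp
    ultimately show ?thesis using Add_cancel[of z "Zer C A' B'" z] that(1-3) by blast
  qed
  { assume "Dom C f = B" 
    have "f \<cdot> Zer C A B = f \<cdot> (Zer C A B \<^bold>+ Zer C A B)" using assms by (simp add: Add_Zer Zer_arr)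
    also have "\<dots> = f \<cdot> Zer C A B \<^bold>+ f \<cdot> Zer C A B" using assms \<open>Dom C f = B\<close> by (simp add: Cmp_Add arr_simps)
    finally show "f \<cdot> Zer C A B = Zer C A (Cod C f)"
      using *[of "f \<cdot> Zer C A B" A "Cod C f"] assms \<open>Dom C f = B\<close> by (simp add: arr_simps) }
  { assume "Cod C f = A" 
    have "Zer C A B \<cdot> f = (Zer C A B \<^bold>+ Zer C A B) \<cdot> f" using assms by (simp add: Add_Zer Zer_arr)
    also have "\<dots> = Zer C A B \<cdot> f \<^bold>+ Zer C A B \<cdot> f" using assms \<open>Cod C f = A\<close> by (simp add: Cmp_Add arr_simps)
    finally show "Zer C A B \<cdot> f = Zer C (Dom C f) B"
      using *[of "Zer C A B \<cdot> f" "Dom C f" B] assms \<open>Cod C f = A\<close> by (simp add: arr_simps) }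
qed

lemma Cmp_Neg: assumes "f \<in> Arr C" "g \<in> Arr C" "Cod C f = Dom C g"
  shows "(\<^bold>- g) \<cdot> f = \<^bold>- (g \<cdot> f)" "g \<cdot> (\<^bold>- f) = \<^bold>- (g \<cdot> f)"
proof -
  have "g \<cdot> f \<^bold>+ (\<^bold>- g) \<cdot> f = Zer C (Dom C f) (Cod C g)"
    using assms Cmp_Add(2)[of f g "\<^bold>- g"] by (simp add: arr_simps Add_Neg Cmp_Zer)
  then show "(\<^bold>- g) \<cdot> f = \<^bold>- (g \<cdot> f)" using assms by (intro Neg_eqI[symmetric]) (simp_all add: arr_simps)
  have "g \<cdot> f \<^bold>+ g \<cdot> (\<^bold>- f) = Zer C (Dom C f) (Cod C g)"
    using assms Cmp_Add(1)[of f "\<^bold>- f" g] by (simp add: arr_simps Add_Neg Cmp_Zer)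
  then show "g \<cdot> (\<^bold>- f) = \<^bold>- (g \<cdot> f)" using assms by (intro Neg_eqI[symmetric]) (simp_all add: arr_simps)
qed

lemma Neg_Neg: "f \<in> Arr C \<Longrightarrow> \<^bold>- (\<^bold>- f) = f"
  using Neg_eqI[of "\<^bold>- f" f] by (simp add: arr_simps Add_Neg)

lemma Neg_Zer: "A \<in> Obj C \<Longrightarrow> B \<in> Obj C \<Longrightarrow> \<^bold>- Zer C A B = Zer C A B"
  using Neg_eqI[of "Zer C A B" "Zer C A B"] by (simp add: arr_simps Add_Zer)

lemma Neg_Add: assumes "f \<in> Arr C" "g \<in> Arr C" "Dom C f = Dom C g" "Cod C f = Cod C g"
  shows "\<^bold>- (f \<^bold>+ g) = \<^bold>- f \<^bold>+ \<^bold>- g"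
proof -
  have "f \<^bold>+ g \<^bold>+ (\<^bold>- f \<^bold>+ \<^bold>- g) = f \<^bold>+ (\<^bold>- f \<^bold>+ (g \<^bold>+ \<^bold>- g))"
    using assms by (simp add: arr_simps Add_ac)
  also have "\<dots> = Zer C (Dom C g) (Cod C g)" using assms by (simp add: arr_simps Add_Neg_left Add_Neg)
  finally show ?thesis using assms Neg_eqI[of "f \<^bold>+ g" "\<^bold>- f \<^bold>+ \<^bold>- g"] by (simp add: arr_simps)
qed

lemmas hom_simps = arr_simps Cmp_assoc' Cmp_Idn Cmp_Add Cmp_Zer Cmp_Neg Add_Zer Add_Neg Add_Neg_left
  Neg_Neg Neg_Zer Neg_Add

text \<open>Composites are normalised to associate to the right; this makes an equation between composites apply there.\<close>

lemma Cmp_reassoc: "\<lbrakk>g \<cdot> f = h; x \<in> Arr C; f \<in> Arr C; g \<in> Arr C; Cod C x = Dom C f; Cod C f = Dom C g\<rbrakk> \<Longrightarrow>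
    g \<cdot> f \<cdot> x = h \<cdot> x"
  by (simp flip: Cmp_assoc')

end

section \<open>Biproducts and isomorphisms\<close>

context preadditive_category
begin

lemma isomorphic_refl: "A \<in> Obj C \<Longrightarrow> isomorphic C A A"
  unfolding isomorphic_def by (auto simp: hom_simps intro!: bexI[of _ "Idn C A"])

lemma isomorphic_sym: "isomorphic C A B \<Longrightarrow> isomorphic C B A"
  unfolding isomorphic_def by blast

lemma isomorphic_trans: assumes "isomorphic C A B" "isomorphic C B D" shows "isomorphic C A D"
proof -
  obtain f g where fg: "f \<in> mor C A B" "g \<in> mor C B A" "g \<cdot> f = Idn C A" "f \<cdot> g = Idn C B"
    and A: "A \<in> Obj C" using assms by (auto simp: isomorphic_def)
  obtain h k where hk: "h \<in> mor C B D" "k \<in> mor C D B" "k \<cdot> h = Idn C B" "h \<cdot> k = Idn C D"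
    and D: "D \<in> Obj C" using assms by (auto simp: isomorphic_def)
  have "h \<cdot> f \<in> mor C A D" "g \<cdot> k \<in> mor C D A" using fg hk by (auto simp: hom_simps)
  moreover have "(g \<cdot> k) \<cdot> h \<cdot> f = Idn C A" "(h \<cdot> f) \<cdot> g \<cdot> k = Idn C D"
    using fg hk by (simp_all add: hom_simps Cmp_reassoc[OF hk(3)] Cmp_reassoc[OF fg(4)])
  ultimately show ?thesis using A D unfolding isomorphic_def by blast
qed

lemma iso_class_eq_iff: "A \<in> Obj C \<Longrightarrow> B \<in> Obj C \<Longrightarrow> iso_class C A = iso_class C B \<longleftrightarrow> isomorphic C A B"
  unfolding iso_class_def using isomorphic_refl isomorphic_sym isomorphic_trans by blast

definition biprod_maps where
  "biprod_maps A B X i1 i2 p1 p2 \<longleftrightarrow>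
     i1 \<in> mor C A X \<and> i2 \<in> mor C B X \<and> p1 \<in> mor C X A \<and> p2 \<in> mor C X B \<and>
     p1 \<cdot> i1 = Idn C A \<and> p2 \<cdot> i2 = Idn C B \<and> p1 \<cdot> i2 = Zer C B A \<and> p2 \<cdot> i1 = Zer C A B \<and>
     i1 \<cdot> p1 \<^bold>+ i2 \<cdot> p2 = Idn C X"

lemma biprod_mapsD: assumes "biprod_maps A B X i1 i2 p1 p2"
  shows "A \<in> Obj C" "B \<in> Obj C" "X \<in> Obj C"
    "i1 \<in> mor C A X" "i2 \<in> mor C B X" "p1 \<in> mor C X A" "p2 \<in> mor C X B"
    "p1 \<cdot> i1 = Idn C A" "p2 \<cdot> i2 = Idn C B" "p1 \<cdot> i2 = Zer C B A" "p2 \<cdot> i1 = Zer C A B"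
    "i1 \<cdot> p1 \<^bold>+ i2 \<cdot> p2 = Idn C X"
  using assms mor_objs unfolding biprod_maps_def by auto

lemma biprod_maps_simps: assumes "biprod_maps A B X i1 i2 p1 p2"
  shows "i1 \<in> Arr C" "Dom C i1 = A" "Cod C i1 = X" "i2 \<in> Arr C" "Dom C i2 = B" "Cod C i2 = X"
    "p1 \<in> Arr C" "Dom C p1 = X" "Cod C p1 = A" "p2 \<in> Arr C" "Dom C p2 = X" "Cod C p2 = B"
    "A \<in> Obj C" "B \<in> Obj C" "X \<in> Obj C"
    "p1 \<cdot> i1 = Idn C A" "p2 \<cdot> i2 = Idn C B" "p1 \<cdot> i2 = Zer C B A" "p2 \<cdot> i1 = Zer C A B"
    "x \<in> Arr C \<Longrightarrow> Cod C x = A \<Longrightarrow> p1 \<cdot> i1 \<cdot> x = x"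
    "x \<in> Arr C \<Longrightarrow> Cod C x = B \<Longrightarrow> p2 \<cdot> i2 \<cdot> x = x"
    "x \<in> Arr C \<Longrightarrow> Cod C x = B \<Longrightarrow> p1 \<cdot> i2 \<cdot> x = Zer C (Dom C x) A"
    "x \<in> Arr C \<Longrightarrow> Cod C x = A \<Longrightarrow> p2 \<cdot> i1 \<cdot> x = Zer C (Dom C x) B"
proof -
  note b = biprod_mapsD[OF assms]
  show a: "i1 \<in> Arr C" "Dom C i1 = A" "Cod C i1 = X" "i2 \<in> Arr C" "Dom C i2 = B" "Cod C i2 = X"
    "p1 \<in> Arr C" "Dom C p1 = X" "Cod C p1 = A" "p2 \<in> Arr C" "Dom C p2 = X" "Cod C p2 = B"
    "A \<in> Obj C" "B \<in> Obj C" "X \<in> Obj C" using b by (auto simp: mor_iff)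
  show "p1 \<cdot> i1 = Idn C A" "p2 \<cdot> i2 = Idn C B" "p1 \<cdot> i2 = Zer C B A" "p2 \<cdot> i1 = Zer C A B"
    using b by auto
  show  "x \<in> Arr C \<Longrightarrow> Cod C x = A \<Longrightarrow> p1 \<cdot> i1 \<cdot> x = x"
    "x \<in> Arr C \<Longrightarrow> Cod C x = B \<Longrightarrow> p2 \<cdot> i2 \<cdot> x = x"
    "x \<in> Arr C \<Longrightarrow> Cod C x = B \<Longrightarrow> p1 \<cdot> i2 \<cdot> x = Zer C (Dom C x) A"
    "x \<in> Arr C \<Longrightarrow> Cod C x = A \<Longrightarrow> p2 \<cdot> i1 \<cdot> x = Zer C (Dom C x) B"
    using a Cmp_reassoc[OF b(8)] Cmp_reassoc[OF b(9)] Cmp_reassoc[OF b(10)] Cmp_reassoc[OF b(11)]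
    by (simp_all add: hom_simps)
qed

lemma finsum_End: "finsum (End C X) = finprod (Hom C X X)"
  by (simp add: finsum_def End_def Hom_def)

lemma direct_sum_pair_iff:
  "direct_sum C [A, B] X \<longleftrightarrow> (\<exists>i1 i2 p1 p2. biprod_maps A B X i1 i2 p1 p2)" (is "?l \<longleftrightarrow> ?r")
proof
  have sum2: "finsum (End C X) (\<lambda>k. Cmp C (i k) (p k)) {..<length [A, B]} = i 0 \<cdot> p 0 \<^bold>+ i 1 \<cdot> p 1"
    if "X \<in> Obj C" "i 0 \<cdot> p 0 \<in> mor C X X" "i 1 \<cdot> p 1 \<in> mor C X X" for i p :: "nat \<Rightarrow> 'm"
  proof -
    interpret G: comm_group "Hom C X X" using that Hom_comm_group by auto
    have "i 1 \<cdot> p 1 \<^bold>+ i 0 \<cdot> p 0 = i 0 \<cdot> p 0 \<^bold>+ i 1 \<cdot> p 1" using G.m_comm[of "i 1 \<cdot> p 1" "i 0 \<cdot> p 0"] that by simp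
    then show ?thesis using that
      by (simp add: finsum_End lessThan_Suc G.finprod_insert Add_Zer mor_iff)
  qed
  {
    assume ?l
    then obtain i p where X: "X \<in> Obj C" 
      and m: "\<And>k. k < length [A, B] \<Longrightarrow> i k \<in> mor C ([A,B] ! k) X \<and> p k \<in> mor C X ([A,B] ! k)"
      and d: "\<And>k l. k < length [A, B] \<Longrightarrow> l < length [A, B] \<Longrightarrow> 
           Cmp C (p k) (i l) = (if k = l then Idn C ([A,B] ! k) else Zer C ([A,B] ! l) ([A,B] ! k))"
      and s: "finsum (End C X) (\<lambda>k. Cmp C (i k) (p k)) {..<length [A, B]} = Idn C X"
      unfolding direct_sum_def by blast
    have m': "i 0 \<in> mor C A X" "i 1 \<in> mor C B X" "p 0 \<in> mor C X A" "p 1 \<in> mor C X B"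
      using m[of 0] m[of 1] by auto
    then have "i 0 \<cdot> p 0 \<^bold>+ i 1 \<cdot> p 1 = Idn C X" 
      using s sum2[of i p] X by (auto simp: mor_iff Cmp_arr)
    then have "biprod_maps A B X (i 0) (i 1) (p 0) (p 1)"
      using m' d[of 0 0] d[of 1 1] d[of 0 1] d[of 1 0] unfolding biprod_maps_def by simp
    then show ?r by blast
  }
  assume ?r
  then obtain i1 i2 p1 p2 where b: "biprod_maps A B X i1 i2 p1 p2" by blast
  note b = biprod_mapsD[OF this]
  let ?i = "\<lambda>k::nat. if k = 0 then i1 else i2" and ?p = "\<lambda>k::nat. if k = 0 then p1 else p2"
  have "finsum (End C X) (\<lambda>k. Cmp C (?i k) (?p k)) {..<length [A, B]} = Idn C X"
    using sum2[of ?i ?p] b by (simp add: mor_iff Cmp_arr)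
  then have "\<exists>\<iota> \<pi>. (\<forall>k < length [A, B]. \<iota> k \<in> mor C ([A, B] ! k) X \<and> \<pi> k \<in> mor C X ([A, B] ! k)) \<and>
        (\<forall>k < length [A, B]. \<forall>l < length [A, B]. Cmp C (\<pi> k) (\<iota> l) =
           (if k = l then Idn C ([A, B] ! k) else Zer C ([A, B] ! l) ([A, B] ! k))) \<and>
        finsum (End C X) (\<lambda>k. Cmp C (\<iota> k) (\<pi> k)) {..<length [A, B]} = Idn C X"
    by - (rule exI[where x = ?i], rule exI[where x = ?p], use b in \<open>auto simp: less_Suc_eq\<close>)
  then show ?l using b unfolding direct_sum_def by simp
qed

lemma biprod_objs: assumes "direct_sum C [A, B] X"
  shows "A \<in> Obj C" "B \<in> Obj C" "X \<in> Obj C"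
  using assms unfolding direct_sum_def by auto

lemma biprod_eqI:
  assumes "biprod_maps A B X i1 i2 p1 p2" "f \<in> Arr C" "g \<in> Arr C" "Dom C f = X" "Dom C g = X" 
    "Cod C g = Cod C f" "f \<cdot> i1 = g \<cdot> i1" "f \<cdot> i2 = g \<cdot> i2"
  shows "f = g"
proof -
  note b = biprod_maps_simps[OF assms(1)]
  have "f = f \<cdot> (i1 \<cdot> p1 \<^bold>+ i2 \<cdot> p2)" using assms b biprod_mapsD(12)[OF assms(1)] by (simp add: hom_simps)
  also have "\<dots> = (f \<cdot> i1) \<cdot> p1 \<^bold>+ (f \<cdot> i2) \<cdot> p2" using assms(2-6) b by (simp add: hom_simps)
  also have "\<dots> = (g \<cdot> i1) \<cdot> p1 \<^bold>+ (g \<cdot> i2) \<cdot> p2" using assms by simp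
  also have "\<dots> = g \<cdot> (i1 \<cdot> p1 \<^bold>+ i2 \<cdot> p2)" using assms(2-6) b by (simp add: hom_simps)
  also have "\<dots> = g" using assms b biprod_mapsD(12)[OF assms(1)] by (simp add: hom_simps)
  finally show ?thesis .
qed

lemma biprod_eqI':
  assumes "biprod_maps A B X i1 i2 p1 p2" "f \<in> Arr C" "g \<in> Arr C" "Cod C f = X" "Cod C g = X" 
    "Dom C g = Dom C f" "p1 \<cdot> f = p1 \<cdot> g" "p2 \<cdot> f = p2 \<cdot> g"
  shows "f = g"
proof -
  note b = biprod_maps_simps[OF assms(1)]
  have "f = (i1 \<cdot> p1 \<^bold>+ i2 \<cdot> p2) \<cdot> f" using assms b biprod_mapsD(12)[OF assms(1)] by (simp add: hom_simps)
  also have "\<dots> = i1 \<cdot> (p1 \<cdot> f) \<^bold>+ i2 \<cdot> (p2 \<cdot> f)" using assms(2-6) b by (simp add: hom_simps)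
  also have "\<dots> = i1 \<cdot> (p1 \<cdot> g) \<^bold>+ i2 \<cdot> (p2 \<cdot> g)" using assms by simp
  also have "\<dots> = (i1 \<cdot> p1 \<^bold>+ i2 \<cdot> p2) \<cdot> g" using assms(2-6) b by (simp add: hom_simps)
  also have "\<dots> = g" using assms b biprod_mapsD(12)[OF assms(1)] by (simp add: hom_simps)
  finally show ?thesis .
qed

text \<open>
  All isomorphisms between direct sums below are produced by this lemma, so that only equations between the
  entries of two-by-two matrices have to be checked.
\<close>

lemma matrix_isomorphic:
  assumes X: "biprod_maps A B X i1 i2 p1 p2" and Y: "biprod_maps A' B' Y j1 j2 q1 q2"
    and m: "a \<in> mor C A A'" "b \<in> mor C B A'" "c \<in> mor C A B'" "d \<in> mor C B B'"
      "a' \<in> mor C A' A" "b' \<in> mor C B' A" "c' \<in> mor C A' B" "d' \<in> mor C B' B"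
    and l: "a' \<cdot> a \<^bold>+ b' \<cdot> c = Idn C A" "a' \<cdot> b \<^bold>+ b' \<cdot> d = Zer C B A"
      "c' \<cdot> a \<^bold>+ d' \<cdot> c = Zer C A B" "c' \<cdot> b \<^bold>+ d' \<cdot> d = Idn C B"
    and r: "a \<cdot> a' \<^bold>+ b \<cdot> c' = Idn C A'" "a \<cdot> b' \<^bold>+ b \<cdot> d' = Zer C B' A'"
      "c \<cdot> a' \<^bold>+ d \<cdot> c' = Zer C A' B'" "c \<cdot> b' \<^bold>+ d \<cdot> d' = Idn C B'"
  shows "isomorphic C X Y"
proof -
  have key: "\<psi> \<cdot> \<phi> = Idn C X"
    if X: "biprod_maps A B X i1 i2 p1 p2" and Y: "biprod_maps A' B' Y j1 j2 q1 q2"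
    and m: "a \<in> mor C A A'" "b \<in> mor C B A'" "c \<in> mor C A B'" "d \<in> mor C B B'"
      "a' \<in> mor C A' A" "b' \<in> mor C B' A" "c' \<in> mor C A' B" "d' \<in> mor C B' B"
    and l: "a' \<cdot> a \<^bold>+ b' \<cdot> c = Idn C A" "a' \<cdot> b \<^bold>+ b' \<cdot> d = Zer C B A"
      "c' \<cdot> a \<^bold>+ d' \<cdot> c = Zer C A B" "c' \<cdot> b \<^bold>+ d' \<cdot> d = Idn C B"
    and \<phi>: "\<phi> = (j1 \<cdot> a \<^bold>+ j2 \<cdot> c) \<cdot> p1 \<^bold>+ (j1 \<cdot> b \<^bold>+ j2 \<cdot> d) \<cdot> p2"
    and \<psi>: "\<psi> = (i1 \<cdot> a' \<^bold>+ i2 \<cdot> c') \<cdot> q1 \<^bold>+ (i1 \<cdot> b' \<^bold>+ i2 \<cdot> d') \<cdot> q2"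
  for A B A' B' X Y i1 i2 p1 p2 j1 j2 q1 q2 a b c d a' b' c' d' \<phi> \<psi>
  proof -
    note bX = biprod_maps_simps[OF X] and bY = biprod_maps_simps[OF Y]
    have \<psi>m: "\<psi> \<in> Arr C" "Dom C \<psi> = Y" "Cod C \<psi> = X" and \<phi>m: "\<phi> \<in> Arr C" "Dom C \<phi> = X" "Cod C \<phi> = Y"
      unfolding \<psi> \<phi> using m bX bY by (auto simp: arr_simps)
    have "p1 \<cdot> \<psi> \<cdot> \<phi> \<cdot> i1 = a' \<cdot> a \<^bold>+ b' \<cdot> c" "p1 \<cdot> \<psi> \<cdot> \<phi> \<cdot> i2 = a' \<cdot> b \<^bold>+ b' \<cdot> d"
      "p2 \<cdot> \<psi> \<cdot> \<phi> \<cdot> i1 = c' \<cdot> a \<^bold>+ d' \<cdot> c" "p2 \<cdot> \<psi> \<cdot> \<phi> \<cdot> i2 = c' \<cdot> b \<^bold>+ d' \<cdot> d"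
      unfolding \<psi> \<phi> using m bX bY by (simp_all add: hom_simps)
    with l have *: "p1 \<cdot> (\<psi> \<cdot> \<phi>) \<cdot> i1 = p1 \<cdot> i1" "p1 \<cdot> (\<psi> \<cdot> \<phi>) \<cdot> i2 = p1 \<cdot> i2" 
      "p2 \<cdot> (\<psi> \<cdot> \<phi>) \<cdot> i1 = p2 \<cdot> i1" "p2 \<cdot> (\<psi> \<cdot> \<phi>) \<cdot> i2 = p2 \<cdot> i2"
      using \<psi>m \<phi>m bX by (simp_all add: hom_simps)
    have "(\<psi> \<cdot> \<phi>) \<cdot> i1 = i1" "(\<psi> \<cdot> \<phi>) \<cdot> i2 = i2" 
      by (rule biprod_eqI'[OF X]; use \<psi>m \<phi>m bX * in \<open>simp add: hom_simps\<close>)+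
    then show "\<psi> \<cdot> \<phi> = Idn C X"
      by - (rule biprod_eqI[OF X]; use \<psi>m \<phi>m bX in \<open>simp add: hom_simps\<close>)
  qed
  let ?\<phi> = "(j1 \<cdot> a \<^bold>+ j2 \<cdot> c) \<cdot> p1 \<^bold>+ (j1 \<cdot> b \<^bold>+ j2 \<cdot> d) \<cdot> p2"
  let ?\<psi> = "(i1 \<cdot> a' \<^bold>+ i2 \<cdot> c') \<cdot> q1 \<^bold>+ (i1 \<cdot> b' \<^bold>+ i2 \<cdot> d') \<cdot> q2"
  have "?\<psi> \<cdot> ?\<phi> = Idn C X" by (rule key[OF X Y m l refl refl])
  moreover have "?\<phi> \<cdot> ?\<psi> = Idn C Y"
    by (rule key[OF Y X m(5-8) m(1-4) r refl refl])
  moreover have "?\<phi> \<in> mor C X Y" "?\<psi> \<in> mor C Y X" 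
    using m biprod_maps_simps[OF X] biprod_maps_simps[OF Y] by (auto simp: arr_simps)
  ultimately show ?thesis unfolding isomorphic_def using mor_objs by blast
qed

lemma biprod_unique:
  assumes "direct_sum C [A, B] X" "direct_sum C [A', B'] Y" "isomorphic C A A'" "isomorphic C B B'"
  shows "isomorphic C X Y"
proof -
  obtain i1 i2 p1 p2 j1 j2 q1 q2 where X: "biprod_maps A B X i1 i2 p1 p2"
    and Y: "biprod_maps A' B' Y j1 j2 q1 q2" using assms direct_sum_pair_iff by meson
  obtain f f' where f: "f \<in> mor C A A'" "f' \<in> mor C A' A" "f' \<cdot> f = Idn C A" "f \<cdot> f' = Idn C A'"
    using assms by (auto simp: isomorphic_def)
  obtain g g' where g: "g \<in> mor C B B'" "g' \<in> mor C B' B" "g' \<cdot> g = Idn C B" "g \<cdot> g' = Idn C B'"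
    using assms by (auto simp: isomorphic_def)
  have o: "A \<in> Obj C" "A' \<in> Obj C" "B \<in> Obj C" "B' \<in> Obj C"
    using biprod_mapsD[OF X] biprod_mapsD[OF Y] by auto
  show ?thesis
    by (rule matrix_isomorphic[OF X Y f(1) _ _ g(1) f(2) _ _ g(2), of "Zer C B A'" "Zer C A B'" "Zer C B' A" "Zer C A' B"];
        use f g o in \<open>simp add: hom_simps\<close>)
qed

lemma biprod_iso:
  assumes "direct_sum C [A, B] X" "isomorphic C A A'" "isomorphic C B B'" "isomorphic C X X'"
  shows "direct_sum C [A', B'] X'"
proof -
  obtain i1 i2 p1 p2 where X: "biprod_maps A B X i1 i2 p1 p2" using assms direct_sum_pair_iff by meson
  obtain f f' where f: "f \<in> mor C A A'" "f' \<in> mor C A' A" "f' \<cdot> f = Idn C A" "f \<cdot> f' = Idn C A'"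
    using assms by (auto simp: isomorphic_def)
  obtain g g' where g: "g \<in> mor C B B'" "g' \<in> mor C B' B" "g' \<cdot> g = Idn C B" "g \<cdot> g' = Idn C B'"
    using assms by (auto simp: isomorphic_def)
  obtain h h' where h: "h \<in> mor C X X'" "h' \<in> mor C X' X" "h' \<cdot> h = Idn C X" "h \<cdot> h' = Idn C X'"
    using assms by (auto simp: isomorphic_def)
  note b = biprod_maps_simps[OF X] biprod_mapsD(12)[OF X]
  have o: "A' \<in> Obj C" "B' \<in> Obj C" "X' \<in> Obj C" using f g h mor_objs by auto
  have "h \<cdot> i1 \<cdot> (f' \<cdot> f) \<cdot> p1 \<cdot> h' \<^bold>+ h \<cdot> i2 \<cdot> (g' \<cdot> g) \<cdot> p2 \<cdot> h' = h \<cdot> (i1 \<cdot> p1 \<^bold>+ i2 \<cdot> p2) \<cdot> h'"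
    unfolding f g using f g h b(1-23) o by (simp add: hom_simps)
  then have s: "h \<cdot> i1 \<cdot> (f' \<cdot> f) \<cdot> p1 \<cdot> h' \<^bold>+ h \<cdot> i2 \<cdot> (g' \<cdot> g) \<cdot> p2 \<cdot> h' = Idn C X'"
    unfolding b(24) using h b(1-23) by (simp add: hom_simps)
  have "biprod_maps A' B' X' (h \<cdot> i1 \<cdot> f') (h \<cdot> i2 \<cdot> g') (f \<cdot> p1 \<cdot> h') (g \<cdot> p2 \<cdot> h')"
    unfolding biprod_maps_def using f g h b(1-23) o s[unfolded f g]
    by (simp add: hom_simps Cmp_reassoc[OF h(3)] Cmp_reassoc[OF f(3)] Cmp_reassoc[OF g(3)])
  then show ?thesis using direct_sum_pair_iff by blast
qed

lemma biprod_comm: assumes "direct_sum C [A, B] X" shows "direct_sum C [B, A] X"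
proof -
  obtain i1 i2 p1 p2 where X: "biprod_maps A B X i1 i2 p1 p2" using assms direct_sum_pair_iff by meson
  have "i2 \<cdot> p2 \<^bold>+ i1 \<cdot> p1 = i1 \<cdot> p1 \<^bold>+ i2 \<cdot> p2"
    using biprod_maps_simps[OF X] by (intro Add_comm) (simp_all add: arr_simps)
  then have "biprod_maps B A X i2 i1 p2 p1"
    using biprod_mapsD[OF X] unfolding biprod_maps_def by simp
  then show ?thesis using direct_sum_pair_iff by blast
qed

lemma biprod_assoc:
  assumes "direct_sum C [A, B] X" "direct_sum C [X, D] Y" "direct_sum C [B, D] W"
  shows "direct_sum C [A, W] Y"
proof -
  obtain i1 i2 p1 p2 where X: "biprod_maps A B X i1 i2 p1 p2" using assms direct_sum_pair_iff by meson
  obtain j1 j2 q1 q2 where Y: "biprod_maps X D Y j1 j2 q1 q2" using assms direct_sum_pair_iff by meson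
  obtain k1 k2 r1 r2 where W: "biprod_maps B D W k1 k2 r1 r2" using assms direct_sum_pair_iff by meson
  note b = biprod_maps_simps[OF X] biprod_maps_simps[OF Y] biprod_maps_simps[OF W]
  have s: "j1 \<cdot> i1 \<cdot> p1 \<cdot> q1 \<^bold>+ (j1 \<cdot> i2 \<cdot> p2 \<cdot> q1 \<^bold>+ j2 \<cdot> q2) = Idn C Y"
  proof -
    have "j1 \<cdot> i1 \<cdot> p1 \<cdot> q1 \<^bold>+ (j1 \<cdot> i2 \<cdot> p2 \<cdot> q1 \<^bold>+ j2 \<cdot> q2) = j1 \<cdot> (i1 \<cdot> p1 \<^bold>+ i2 \<cdot> p2) \<cdot> q1 \<^bold>+ j2 \<cdot> q2"
      using b by (simp add: hom_simps Add_ac)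
    also have "\<dots> = Idn C Y" using b(1-46) biprod_mapsD(12)[OF X] biprod_mapsD(12)[OF Y] by (simp add: hom_simps)
    finally show ?thesis .
  qed
  have c: "k1 \<cdot> r1 \<^bold>+ k2 \<cdot> r2 = Idn C W" by (rule biprod_mapsD[OF W])
  have "biprod_maps A W Y (j1 \<cdot> i1) (j1 \<cdot> i2 \<cdot> r1 \<^bold>+ j2 \<cdot> r2) (p1 \<cdot> q1) (k1 \<cdot> p2 \<cdot> q1 \<^bold>+ k2 \<cdot> q2)"
    unfolding biprod_maps_def using b s c by (simp add: hom_simps)
  then show ?thesis using direct_sum_pair_iff by blast
qed

lemma zero_object_iff: "zero_object C Z \<longleftrightarrow> Z \<in> Obj C \<and> Idn C Z = Zer C Z Z"
proof
  assume z: "zero_object C Z"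
  then have o: "Z \<in> Obj C" by (simp add: zero_object_def)
  with z have "\<exists>!f. f \<in> mor C Z Z" by (auto simp: zero_object_def)
  moreover have "Idn C Z \<in> mor C Z Z" "Zer C Z Z \<in> mor C Z Z" using o by (auto simp: arr_simps)
  ultimately show "Z \<in> Obj C \<and> Idn C Z = Zer C Z Z" using o by blast
next
  assume z: "Z \<in> Obj C \<and> Idn C Z = Zer C Z Z"
  have "f = Zer C A Z" if "f \<in> mor C A Z" for A f
  proof -
    have "f = Idn C Z \<cdot> f" using that by (simp add: mor_iff Cmp_Idn)
    also have "\<dots> = Zer C A Z" using that z mor_objs by (auto simp: mor_iff Cmp_Zer)
    finally show ?thesis .
  qed
  moreover have "f = Zer C Z A" if "f \<in> mor C Z A" for A f
  proof -
    have "f = f \<cdot> Idn C Z" using that by (simp add: mor_iff Cmp_Idn)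
    also have "\<dots> = Zer C Z A" using that z mor_objs by (auto simp: mor_iff Cmp_Zer)
    finally show ?thesis .
  qed
  moreover have "Zer C A Z \<in> mor C A Z" "Zer C Z A \<in> mor C Z A" if "A \<in> Obj C" for A
    using that z by (auto simp: arr_simps)
  ultimately show "zero_object C Z" using z unfolding zero_object_def by metis
qed

lemma biprod_zero: assumes "zero_object C Z" "A \<in> Obj C" shows "direct_sum C [A, Z] A"
proof -
  have "biprod_maps A Z A (Idn C A) (Zer C Z A) (Idn C A) (Zer C A Z)"
    using assms unfolding biprod_maps_def zero_object_iff by (simp add: hom_simps)
  then show ?thesis using direct_sum_pair_iff by blast
qed

end

section \<open>Cancellation of objects with local endomorphism ring\<close>

text \<open>
  A one-sided inverse \<open>y\<close> of \<open>x\<close> makes \<open>x \<otimes> y\<close> an idempotent, and a local ring has no idempotents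
  besides \<open>\<zero>\<close> and \<open>\<one>\<close>.
\<close>

lemma local_ring_left_invertible:
  fixes R (structure)
  assumes "local_ring R" and xy: "x \<in> carrier R" "y \<in> carrier R" "y \<otimes> x = \<one>"
  shows "x \<in> Units R"
proof -
  interpret ring R using assms by (simp add: local_ring_def)
  have nz: "\<one> \<noteq> \<zero>" and loc: "\<And>a b. \<lbrakk>a \<in> carrier R; b \<in> carrier R; a \<notin> Units R; b \<notin> Units R\<rbrakk> \<Longrightarrow> a \<oplus> b \<notin> Units R"
    using assms(1) by (auto simp: local_ring_def)
  define e where "e = x \<otimes> y"
  have e: "e \<in> carrier R" "e \<otimes> e = e"
    using xy by (simp_all add: e_def m_assoc) (simp flip: m_assoc)
  have idem: "u = \<one>" if "u \<in> Units R" "u \<otimes> u = u" for u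
  proof -
    have "\<one> = inv u \<otimes> (u \<otimes> u)" using that by simp
    also have "\<dots> = (inv u \<otimes> u) \<otimes> u" using that(1) by (intro m_assoc[symmetric]) auto
    also have "\<dots> = u" using that(1) by (simp add: Units_closed)
    finally show ?thesis ..
  qed
  have "(\<one> \<ominus> e) \<oplus> e = \<one>" using e by algebra
  then have "e \<in> Units R \<or> (\<one> \<ominus> e) \<in> Units R"
    using loc[of "\<one> \<ominus> e" e] e Units_one_closed by fastforce
  moreover have "(\<one> \<ominus> e) \<otimes> (\<one> \<ominus> e) = \<one> \<ominus> e" 
  proof -
    have "e \<otimes> (\<one> \<ominus> e) = e \<ominus> e \<otimes> e" using e(1) by (simp add: a_minus_def r_distr r_minus)
    then have "e \<otimes> (\<one> \<ominus> e) = \<zero>" using e by (simp add: a_minus_def r_neg)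
    moreover have "(\<one> \<ominus> e) \<otimes> (\<one> \<ominus> e) = (\<one> \<ominus> e) \<ominus> e \<otimes> (\<one> \<ominus> e)"
      using e(1) minus_closed[OF one_closed e(1)] by (simp add: a_minus_def l_distr l_minus)
    ultimately show ?thesis using e(1) by (simp add: a_minus_def)
  qed
  ultimately have "e = \<one> \<or> \<one> \<ominus> e = \<one>" using idem e by blast
  then show ?thesis
  proof
    assume "e = \<one>"
    then show ?thesis using xy unfolding Units_def e_def by blast
  next
    assume "\<one> \<ominus> e = \<one>"
    moreover have "e = \<one> \<ominus> (\<one> \<ominus> e)" using e(1) by algebra
    moreover have "\<one> \<ominus> \<one> = \<zero>" by (simp add: a_minus_def r_neg)
    ultimately have "e = \<zero>" by metis
    have "\<one> = (y \<otimes> x) \<otimes> (y \<otimes> x)" using xy by simp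
    also have "\<dots> = y \<otimes> e \<otimes> x" using xy by (simp add: e_def m_assoc)
    also have "\<dots> = \<zero>" using xy \<open>e = \<zero>\<close> by simp
    finally show ?thesis using nz by simp
  qed
qed

text \<open>
  One of the summands of \<open>u \<oplus> x \<otimes> d = \<one>\<close> is a unit. If \<open>x \<otimes> d\<close> is one, then \<open>d\<close> has a left inverse. If \<open>u\<close> is a
  unit and \<open>d\<close> is not, then \<open>d \<oplus> u\<close> is a unit, since otherwise \<open>u\<close> would be the sum of the non-units
  \<open>d \<oplus> u\<close> and \<open>\<ominus> d\<close>.
\<close>

lemma local_ring_stable_range:
  fixes R (structure)
  assumes "local_ring R" and c: "x \<in> carrier R" "d \<in> carrier R" "u \<in> carrier R" 
    and one: "u \<oplus> x \<otimes> d = \<one>"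
  shows "d \<in> Units R \<or> d \<oplus> u \<in> Units R"
proof (rule ccontr)
  assume n: "\<not> ?thesis"
  interpret ring R using assms by (simp add: local_ring_def)
  have loc: "\<And>a b. \<lbrakk>a \<in> carrier R; b \<in> carrier R; a \<notin> Units R; b \<notin> Units R\<rbrakk> \<Longrightarrow> a \<oplus> b \<notin> Units R"
    using assms(1) by (auto simp: local_ring_def)
  have "x \<otimes> d \<notin> Units R"
  proof
    assume u: "x \<otimes> d \<in> Units R"
    then have "(inv (x \<otimes> d) \<otimes> x) \<otimes> d = \<one>" using c by (simp add: m_assoc)
    with u c n show False using local_ring_left_invertible[OF assms(1), of d "inv (x \<otimes> d) \<otimes> x"] by simp
  qed
  then have u: "u \<in> Units R" using one loc[of u "x \<otimes> d"] c Units_one_closed by fastforce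
  have "\<ominus> d \<notin> Units R"
  proof
    assume m: "\<ominus> d \<in> Units R"
    have "(\<ominus> (inv (\<ominus> d))) \<otimes> d = inv (\<ominus> d) \<otimes> (\<ominus> d)" using m c by (simp add: l_minus r_minus)
    then show False using m c n local_ring_left_invertible[OF assms(1), of d "\<ominus> (inv (\<ominus> d))"] by simp
  qed
  then have "(d \<oplus> u) \<oplus> \<ominus> d \<notin> Units R" using n c loc[of "d \<oplus> u" "\<ominus> d"] by blast
  moreover have "(d \<oplus> u) \<oplus> \<ominus> d = u" using c by algebra
  ultimately show False using u by simp
qed

context preadditive_category
begin

text \<open>Sorting a sum can leave up to two terms between a summand and its negative.\<close>

lemma Add_Neg_deep:
  assumes "f \<in> Arr C" "g \<in> Arr C" "Dom C f = Dom C g" "Cod C f = Cod C g"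
  shows "f \<^bold>+ (g \<^bold>+ \<^bold>- f) = g" 
    "h \<in> Arr C \<Longrightarrow> Dom C g = Dom C h \<Longrightarrow> Cod C g = Cod C h \<Longrightarrow> f \<^bold>+ (g \<^bold>+ (\<^bold>- f \<^bold>+ h)) = g \<^bold>+ h"
    "h \<in> Arr C \<Longrightarrow> Dom C g = Dom C h \<Longrightarrow> Cod C g = Cod C h \<Longrightarrow> f \<^bold>+ (g \<^bold>+ (h \<^bold>+ \<^bold>- f)) = g \<^bold>+ h"
    "h \<in> Arr C \<Longrightarrow> Dom C g = Dom C h \<Longrightarrow> Cod C g = Cod C h \<Longrightarrow> 
      k \<in> Arr C \<Longrightarrow> Dom C h = Dom C k \<Longrightarrow> Cod C h = Cod C k \<Longrightarrow> f \<^bold>+ (g \<^bold>+ (h \<^bold>+ (\<^bold>- f \<^bold>+ k))) = g \<^bold>+ (h \<^bold>+ k)"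
proof -
  show "f \<^bold>+ (g \<^bold>+ \<^bold>- f) = g" 
    using assms by (subst Add_ac(2)) (simp_all add: hom_simps)
  show a: "h \<in> Arr C \<Longrightarrow> Dom C g = Dom C h \<Longrightarrow> Cod C g = Cod C h \<Longrightarrow> f \<^bold>+ (g \<^bold>+ (\<^bold>- f \<^bold>+ h)) = g \<^bold>+ h" for h
    using assms by (subst Add_ac(2)) (simp_all add: hom_simps)
  show "h \<in> Arr C \<Longrightarrow> Dom C g = Dom C h \<Longrightarrow> Cod C g = Cod C h \<Longrightarrow> f \<^bold>+ (g \<^bold>+ (h \<^bold>+ \<^bold>- f)) = g \<^bold>+ h"
    using assms a[of h] by (subst Add_comm[of h]) (simp_all add: hom_simps)
  show "h \<in> Arr C \<Longrightarrow> Dom C g = Dom C h \<Longrightarrow> Cod C g = Cod C h \<Longrightarrow> 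
      k \<in> Arr C \<Longrightarrow> Dom C h = Dom C k \<Longrightarrow> Cod C h = Cod C k \<Longrightarrow> f \<^bold>+ (g \<^bold>+ (h \<^bold>+ (\<^bold>- f \<^bold>+ k))) = g \<^bold>+ (h \<^bold>+ k)"
    using assms a[of "h \<^bold>+ k"] by (subst Add_ac(2)[of h]) (simp_all add: hom_simps)
qed

lemmas hom_ac = Add_ac Add_comm Add_Neg_deep

lemma Add_eq_imp: assumes "f \<in> mor C A B" "g \<in> mor C A B" "f \<^bold>+ g = h"
  shows "f = h \<^bold>+ \<^bold>- g" "g = h \<^bold>+ \<^bold>- f"
  using assms(1,2) unfolding assms(3)[symmetric] mor_iff by (auto simp: hom_simps hom_ac)

text \<open>
  The isomorphism is the Schur complement \<open>a - b d\<inverse> c\<close> of the invertible corner \<open>d\<close>; its inverse is the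
  corner \<open>a'\<close> of the inverse matrix.
\<close>

lemma invertible_corner_isomorphic:
  assumes m: "a \<in> mor C A B" "b \<in> mor C Z B" "c \<in> mor C A Z" "d \<in> mor C Z Z"
      "a' \<in> mor C B A" "b' \<in> mor C Z A" "c' \<in> mor C B Z" "e \<in> mor C Z Z"
    and l: "a' \<cdot> a \<^bold>+ b' \<cdot> c = Idn C A" "a' \<cdot> b \<^bold>+ b' \<cdot> d = Zer C Z A"
    and r: "a \<cdot> a' \<^bold>+ b \<cdot> c' = Idn C B" "c \<cdot> a' \<^bold>+ d \<cdot> c' = Zer C B Z" 
    and e: "e \<cdot> d = Idn C Z" "d \<cdot> e = Idn C Z"
  shows "isomorphic C A B"
proof -
  note o = mor_objs[OF m(1)] mor_objs[OF m(2)]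
  have ca: "c \<cdot> a' = \<^bold>- (d \<cdot> c')" and ab: "a' \<cdot> b = \<^bold>- (b' \<cdot> d)"
    using Add_eq_imp(1)[OF _ _ r(2)] Add_eq_imp(1)[OF _ _ l(2)] m o by (auto simp: hom_simps)
  let ?s = "a \<^bold>+ \<^bold>- (b \<cdot> e \<cdot> c)"
  have "?s \<cdot> a' = a \<cdot> a' \<^bold>+ \<^bold>- (b \<cdot> e \<cdot> c \<cdot> a')" using m o by (simp add: hom_simps)
  also have "\<dots> = a \<cdot> a' \<^bold>+ b \<cdot> c'" unfolding ca using m o by (simp add: hom_simps Cmp_reassoc[OF e(1)])
  finally have 1: "?s \<cdot> a' = Idn C B" using r by simp
  have "a' \<cdot> ?s = a' \<cdot> a \<^bold>+ \<^bold>- ((a' \<cdot> b) \<cdot> e \<cdot> c)" using m o by (simp add: hom_simps)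
  also have "\<dots> = a' \<cdot> a \<^bold>+ b' \<cdot> c" unfolding ab using m o by (simp add: hom_simps Cmp_reassoc[OF e(2)])
  finally have 2: "a' \<cdot> ?s = Idn C A" using l by simp
  have "?s \<in> mor C A B" using m o by (simp add: hom_simps)
  with 1 2 m(5) o show ?thesis unfolding isomorphic_def by blast
qed

text \<open>
  The matrix of an isomorphism \<open>A \<oplus> Z \<cong> B \<oplus> Z\<close> has a corner \<open>d\<close> in \<open>End Z\<close>. As \<open>End Z\<close> has
  stable range one, a row operation makes that corner invertible, and then the Schur complement of
  the corner is an isomorphism \<open>A \<cong> B\<close>.
\<close>

lemma cancel_local:
  assumes "local_ring (End C Z)" "direct_sum C [A, Z] X" "direct_sum C [B, Z] Y" "isomorphic C X Y"
  shows "isomorphic C A B"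
proof -
  obtain i1 i2 p1 p2 where X: "biprod_maps A Z X i1 i2 p1 p2" using assms direct_sum_pair_iff by meson
  obtain j1 j2 q1 q2 where Y: "biprod_maps B Z Y j1 j2 q1 q2" using assms direct_sum_pair_iff by meson
  obtain \<phi> \<psi> where f: "\<phi> \<in> mor C X Y" "\<psi> \<in> mor C Y X" "\<psi> \<cdot> \<phi> = Idn C X" "\<phi> \<cdot> \<psi> = Idn C Y"
    using assms by (auto simp: isomorphic_def)
  note b = biprod_maps_simps[OF X] biprod_maps_simps[OF Y]
  define a b c d a' b' c' d' where defs: "a = q1 \<cdot> \<phi> \<cdot> i1" "b = q1 \<cdot> \<phi> \<cdot> i2" "c = q2 \<cdot> \<phi> \<cdot> i1" "d = q2 \<cdot> \<phi> \<cdot> i2"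
    "a' = p1 \<cdot> \<psi> \<cdot> j1" "b' = p1 \<cdot> \<psi> \<cdot> j2" "c' = p2 \<cdot> \<psi> \<cdot> j1" "d' = p2 \<cdot> \<psi> \<cdot> j2"
  have m: "a \<in> mor C A B" "b \<in> mor C Z B" "c \<in> mor C A Z" "d \<in> mor C Z Z"
      "a' \<in> mor C B A" "b' \<in> mor C Z A" "c' \<in> mor C B Z" "d' \<in> mor C Z Z"
    unfolding defs using f b by (simp_all add: arr_simps)
  have o: "A \<in> Obj C" "B \<in> Obj C" "Z \<in> Obj C" using b by auto
  have l: "x \<cdot> (\<psi> \<cdot> j1) \<cdot> (q1 \<cdot> \<phi>) \<cdot> y \<^bold>+ x \<cdot> (\<psi> \<cdot> j2) \<cdot> (q2 \<cdot> \<phi>) \<cdot> y = x \<cdot> y"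
    if "x \<in> Arr C" "Dom C x = X" "y \<in> Arr C" "Cod C y = X" for x y
  proof -
    have "x \<cdot> (\<psi> \<cdot> j1) \<cdot> (q1 \<cdot> \<phi>) \<cdot> y \<^bold>+ x \<cdot> (\<psi> \<cdot> j2) \<cdot> (q2 \<cdot> \<phi>) \<cdot> y = x \<cdot> (\<psi> \<cdot> (j1 \<cdot> q1 \<^bold>+ j2 \<cdot> q2) \<cdot> \<phi>) \<cdot> y"
      using that b f(1,2) by (simp add: hom_simps)
    also have "\<dots> = x \<cdot> y" using that b f biprod_mapsD(12)[OF Y] by (simp add: hom_simps)
    finally show ?thesis .
  qed
  have r: "x \<cdot> (\<phi> \<cdot> i1) \<cdot> (p1 \<cdot> \<psi>) \<cdot> y \<^bold>+ x \<cdot> (\<phi> \<cdot> i2) \<cdot> (p2 \<cdot> \<psi>) \<cdot> y = x \<cdot> y"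
    if "x \<in> Arr C" "Dom C x = Y" "y \<in> Arr C" "Cod C y = Y" for x y
  proof -
    have "x \<cdot> (\<phi> \<cdot> i1) \<cdot> (p1 \<cdot> \<psi>) \<cdot> y \<^bold>+ x \<cdot> (\<phi> \<cdot> i2) \<cdot> (p2 \<cdot> \<psi>) \<cdot> y = x \<cdot> (\<phi> \<cdot> (i1 \<cdot> p1 \<^bold>+ i2 \<cdot> p2) \<cdot> \<psi>) \<cdot> y"
      using that b f(1,2) by (simp add: hom_simps)
    also have "\<dots> = x \<cdot> y" using that b f biprod_mapsD(12)[OF X] by (simp add: hom_simps)
    finally show ?thesis .
  qed
  have L: "a' \<cdot> a \<^bold>+ b' \<cdot> c = Idn C A" "a' \<cdot> b \<^bold>+ b' \<cdot> d = Zer C Z A"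
      "c' \<cdot> a \<^bold>+ d' \<cdot> c = Zer C A Z" "c' \<cdot> b \<^bold>+ d' \<cdot> d = Idn C Z"
    using l[of p1 i1] l[of p1 i2] l[of p2 i1] l[of p2 i2] b f unfolding defs by (simp_all add: hom_simps)
  have R: "a \<cdot> a' \<^bold>+ b \<cdot> c' = Idn C B" "a \<cdot> b' \<^bold>+ b \<cdot> d' = Zer C Z B"
      "c \<cdot> a' \<^bold>+ d \<cdot> c' = Zer C B Z" "c \<cdot> b' \<^bold>+ d \<cdot> d' = Idn C Z"
    using r[of q1 j1] r[of q1 j2] r[of q2 j1] r[of q2 j2] b f unfolding defs by (simp_all add: hom_simps)
  have End: "carrier (End C Z) = mor C Z Z" "\<And>x y. x \<otimes>\<^bsub>End C Z\<^esub> y = x \<cdot> y" "\<And>x y. x \<oplus>\<^bsub>End C Z\<^esub> y = x \<^bold>+ y"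
     "\<one>\<^bsub>End C Z\<^esub> = Idn C Z"
    by (simp_all add: End_def)
  have "d \<in> Units (End C Z) \<or> d \<^bold>+ c' \<cdot> b \<in> Units (End C Z)"
    using local_ring_stable_range[OF assms(1), of d' d "c' \<cdot> b"] L(4) m by (auto simp: End arr_simps)
  then show ?thesis
  proof
    assume "d \<in> Units (End C Z)"
    then obtain e where "e \<in> mor C Z Z" "e \<cdot> d = Idn C Z" "d \<cdot> e = Idn C Z" by (auto simp: Units_def End)
    then show ?thesis using invertible_corner_isomorphic[OF m(1-7) _ L(1,2) R(1,3)] by blast
  next
    assume "d \<^bold>+ c' \<cdot> b \<in> Units (End C Z)"
    then obtain e where e: "e \<in> mor C Z Z" "e \<cdot> (d \<^bold>+ c' \<cdot> b) = Idn C Z" "(d \<^bold>+ c' \<cdot> b) \<cdot> e = Idn C Z" 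
      by (auto simp: Units_def End)
    \<comment> \<open>Adding \<open>c'\<close> times the first row to the second turns the corner into \<open>d + c' b\<close>.\<close>
    note M = m[unfolded mor_iff]
    have eqL: "a' \<cdot> a = Idn C A \<^bold>+ \<^bold>- (b' \<cdot> c)" "a' \<cdot> b = \<^bold>- (b' \<cdot> d)" "c' \<cdot> a = \<^bold>- (d' \<cdot> c)" "c' \<cdot> b = Idn C Z \<^bold>+ \<^bold>- (d' \<cdot> d)"
      using Add_eq_imp(1)[OF _ _ L(1)] Add_eq_imp(1)[OF _ _ L(2)] Add_eq_imp(1)[OF _ _ L(3)] Add_eq_imp(1)[OF _ _ L(4)] M o 
      by (auto simp: hom_simps)
    have eqR: "a \<cdot> a' = Idn C B \<^bold>+ \<^bold>- (b \<cdot> c')" "a \<cdot> b' = \<^bold>- (b \<cdot> d')" "c \<cdot> a' = \<^bold>- (d \<cdot> c')" "c \<cdot> b' = Idn C Z \<^bold>+ \<^bold>- (d \<cdot> d')"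
      using Add_eq_imp(1)[OF _ _ R(1)] Add_eq_imp(1)[OF _ _ R(2)] Add_eq_imp(1)[OF _ _ R(3)] Add_eq_imp(1)[OF _ _ R(4)] M o 
      by (auto simp: hom_simps)
    let ?a' = "a' \<^bold>+ \<^bold>- (b' \<cdot> c')" and ?c = "c \<^bold>+ c' \<cdot> a" and ?d = "d \<^bold>+ c' \<cdot> b" and ?c' = "c' \<^bold>+ \<^bold>- (d' \<cdot> c')"
    have "?a' \<cdot> a \<^bold>+ b' \<cdot> ?c = Idn C A" 
      using M o eqL by (simp add: hom_simps hom_ac)
    moreover have "?a' \<cdot> b \<^bold>+ b' \<cdot> ?d = Zer C Z A"
      using M o eqL by (simp add: hom_simps hom_ac)
    moreover have "a \<cdot> ?a' \<^bold>+ b \<cdot> ?c' = Idn C B"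
      using M o eqR eqR(2)[THEN Cmp_reassoc] by (simp add: hom_simps hom_ac)
    moreover have "?c \<cdot> ?a' \<^bold>+ ?d \<cdot> ?c' = Zer C B Z" 
      using M o eqR eqR[THEN Cmp_reassoc] by (simp add: hom_simps hom_ac)
    moreover have "?a' \<in> mor C B A" "?c \<in> mor C A Z" "?d \<in> mor C Z Z" "?c' \<in> mor C B Z"
      using M o by (simp_all add: arr_simps)
    ultimately show ?thesis using invertible_corner_isomorphic[OF m(1,2) _ _ _ m(6) _ e(1), of ?c ?d ?a' ?c'] e by blast
  qed
qed

end

section \<open>Finite direct sums and the monoid of isomorphism classes\<close>

context preadditive_category
begin

text \<open>
  The sum in the group of arrows from \<open>A\<close> to \<open>B\<close>, in recursive form, for which distributivity of composition
  is a plain induction.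
\<close>

primrec hsum :: "'o \<Rightarrow> 'o \<Rightarrow> (nat \<Rightarrow> 'm) \<Rightarrow> nat \<Rightarrow> 'm" where
  "hsum A B f 0 = Zer C A B"
| "hsum A B f (Suc n) = f n \<^bold>+ hsum A B f n"

lemma hsum_arr: assumes "A \<in> Obj C" "B \<in> Obj C" "\<And>k. k < n \<Longrightarrow> f k \<in> mor C A B"
  shows "hsum A B f n \<in> mor C A B"
  using assms(3) by (induction n) (auto simp: assms(1,2) arr_simps)

lemma hsum_cong: "(\<And>k. k < n \<Longrightarrow> f k = g k) \<Longrightarrow> hsum A B f n = hsum A B g n"
  by (induction n) auto

lemma finprod_eq_hsum: assumes "A \<in> Obj C" "B \<in> Obj C" "\<And>k. k < n \<Longrightarrow> f k \<in> mor C A B"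
  shows "finprod (Hom C A B) f {..<n} = hsum A B f n"
proof -
  interpret G: comm_group "Hom C A B" using assms Hom_comm_group by auto
  show ?thesis using assms(3)
  proof (induction n)
    case (Suc n)
    then have "f \<in> {..<n} \<rightarrow> mor C A B" "f n \<in> mor C A B" by auto
    then show ?case using Suc by (simp add: lessThan_Suc)
  qed (use G.finprod_empty in simp)
qed

lemma Cmp_hsum: assumes "A \<in> Obj C" "B \<in> Obj C" "\<And>k. k < n \<Longrightarrow> f k \<in> mor C A B"
  shows "g \<in> mor C B D \<Longrightarrow> g \<cdot> hsum A B f n = hsum A D (\<lambda>k. g \<cdot> f k) n"
    "h \<in> mor C D A \<Longrightarrow> hsum A B f n \<cdot> h = hsum D B (\<lambda>k. f k \<cdot> h) n"
proof -
  show "g \<cdot> hsum A B f n = hsum A D (\<lambda>k. g \<cdot> f k) n" if g: "g \<in> mor C B D"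
    using assms(3)
  proof (induction n)
    case 0 then show ?case using assms(1,2) g by (simp add: mor_iff Cmp_Zer)
  next
    case (Suc n)
    moreover have "hsum A B f n \<in> mor C A B" using Suc assms(1,2) by (intro hsum_arr) auto
    ultimately show ?case using Suc.prems[of n] g by (simp add: mor_iff Cmp_Add)
  qed
  show "hsum A B f n \<cdot> h = hsum D B (\<lambda>k. f k \<cdot> h) n" if h: "h \<in> mor C D A"
    using assms(3)
  proof (induction n)
    case 0 then show ?case using assms(1,2) h by (simp add: mor_iff Cmp_Zer)
  next
    case (Suc n)
    moreover have "hsum A B f n \<in> mor C A B" using Suc assms(1,2) by (intro hsum_arr) auto
    ultimately show ?case using Suc.prems[of n] h by (simp add: mor_iff Cmp_Add)
  qed
qed

lemma hsum_Suc_shift: assumes "A \<in> Obj C" "B \<in> Obj C" "\<And>k. k < Suc n \<Longrightarrow> f k \<in> mor C A B"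
  shows "hsum A B f (Suc n) = f 0 \<^bold>+ hsum A B (\<lambda>k. f (Suc k)) n"
  using assms(3)
proof (induction n)
  case (Suc n)
  have m: "f (Suc n) \<in> mor C A B" "f 0 \<in> mor C A B" "hsum A B (\<lambda>k. f (Suc k)) n \<in> mor C A B"
    using Suc.prems assms(1,2) by (auto intro!: hsum_arr)
  have "hsum A B f (Suc (Suc n)) = f (Suc n) \<^bold>+ (f 0 \<^bold>+ hsum A B (\<lambda>k. f (Suc k)) n)"
    using Suc by simp
  also have "\<dots> = f 0 \<^bold>+ (f (Suc n) \<^bold>+ hsum A B (\<lambda>k. f (Suc k)) n)"
    using m by (intro Add_ac(2)) (auto simp: mor_iff)
  finally show ?case by simp
qed simp

lemma hsum_zero: assumes "A \<in> Obj C" "B \<in> Obj C" "\<And>l. l < n \<Longrightarrow> f l = Zer C A B"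
  shows "hsum A B f n = Zer C A B"
  using assms(3) by (induction n) (simp_all add: assms(1,2) hom_simps)

lemma hsum_single: assumes "A \<in> Obj C" "B \<in> Obj C" "k < n" "f k \<in> mor C A B"
    "\<And>l. l < n \<Longrightarrow> l \<noteq> k \<Longrightarrow> f l = Zer C A B"
  shows "hsum A B f n = f k"
  using assms(3,5)
proof (induction n)
  case (Suc n)
  show ?case
  proof (cases "k = n")
    case True
    then have "hsum A B f n = Zer C A B" using Suc.prems assms(1,2) by (intro hsum_zero) auto
    then show ?thesis using True assms(4) by (simp add: mor_iff Add_Zer)
  next
    case False
    then have "hsum A B f n = f k" "f n = Zer C A B" using Suc by auto
    then show ?thesis using assms by (simp add: mor_iff Add_Zer)
  qed
qed simp

definition sum_maps where
  "sum_maps Xs X i p \<longleftrightarrow> set Xs \<subseteq> Obj C \<and> X \<in> Obj C \<and>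
     (\<forall>k < length Xs. i k \<in> mor C (Xs ! k) X \<and> p k \<in> mor C X (Xs ! k)) \<and>
     (\<forall>k < length Xs. \<forall>l < length Xs.
           p k \<cdot> i l = (if k = l then Idn C (Xs ! k) else Zer C (Xs ! l) (Xs ! k))) \<and>
     hsum X X (\<lambda>k. i k \<cdot> p k) (length Xs) = Idn C X"

lemma direct_sum_iff: "direct_sum C Xs X \<longleftrightarrow> (\<exists>i p. sum_maps Xs X i p)"
proof -
  have "finsum (End C X) (\<lambda>k. i k \<cdot> p k) {..<length Xs} = hsum X X (\<lambda>k. i k \<cdot> p k) (length Xs)"
    if "X \<in> Obj C" "\<forall>k < length Xs. i k \<in> mor C (Xs ! k) X \<and> p k \<in> mor C X (Xs ! k)" for i p
    unfolding finsum_End using that by (intro finprod_eq_hsum) (auto simp: arr_simps)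
  then show ?thesis unfolding direct_sum_def sum_maps_def by (simp cong: conj_cong)
qed

lemma direct_sum_Nil: "direct_sum C [] X \<Longrightarrow> zero_object C X"
  unfolding direct_sum_iff sum_maps_def zero_object_iff by auto

lemma zero_object_direct_sum_Nil: "zero_object C X \<Longrightarrow> direct_sum C [] X"
  unfolding direct_sum_iff sum_maps_def zero_object_iff by auto

lemma direct_sum_Cons:
  assumes "direct_sum C Xs B" "direct_sum C [A, B] X"
  shows "direct_sum C (A # Xs) X"
proof -
  obtain k r where B: "sum_maps Xs B k r" using assms direct_sum_iff by blast
  obtain j1 j2 q1 q2 where X: "biprod_maps A B X j1 j2 q1 q2" using assms direct_sum_pair_iff by meson
  note b = biprod_maps_simps[OF X]
  define i p where "i = (\<lambda>n. case n of 0 \<Rightarrow> j1 | Suc n \<Rightarrow> j2 \<cdot> k n)" 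
    and "p = (\<lambda>n. case n of 0 \<Rightarrow> q1 | Suc n \<Rightarrow> r n \<cdot> q2)"
  have kr: "k n \<in> mor C (Xs ! n) B" "r n \<in> mor C B (Xs ! n)" "Xs ! n \<in> Obj C" if "n < length Xs" for n
    using B that by (auto simp: sum_maps_def)
  have rk: "r n \<cdot> k l = (if n = l then Idn C (Xs ! n) else Zer C (Xs ! l) (Xs ! n))" 
    if "n < length Xs" "l < length Xs" for n l
    using B that by (auto simp: sum_maps_def)
  have s: "hsum B B (\<lambda>n. k n \<cdot> r n) (length Xs) = Idn C B" "set Xs \<subseteq> Obj C"
    using B by (auto simp: sum_maps_def)
  have m: "i n \<in> mor C ((A # Xs) ! n) X" "p n \<in> mor C X ((A # Xs) ! n)" if "n < length (A # Xs)" for n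
    using that b kr by (auto simp: i_def p_def arr_simps split: nat.split)
  have "p n \<cdot> i l = (if n = l then Idn C ((A # Xs) ! n) else Zer C ((A # Xs) ! l) ((A # Xs) ! n))" 
    if "n < length (A # Xs)" "l < length (A # Xs)" for n l
  proof (cases n; cases l)
    fix n' l' assume "n = Suc n'" "l = Suc l'"
    then show ?thesis using that b kr[of n'] kr[of l'] rk[of n' l'] by (simp add: i_def p_def hom_simps)
  qed (use that b kr in \<open>auto simp: i_def p_def hom_simps\<close>)
  moreover have "hsum X X (\<lambda>n. i n \<cdot> p n) (length (A # Xs)) = Idn C X"
  proof -
    have "hsum X X (\<lambda>n. i n \<cdot> p n) (length (A # Xs)) 
       = i 0 \<cdot> p 0 \<^bold>+ hsum X X (\<lambda>n. i (Suc n) \<cdot> p (Suc n)) (length Xs)"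
      using m b by (simp only: length_Cons, intro hsum_Suc_shift) (auto simp: arr_simps)
    also have "hsum X X (\<lambda>n. i (Suc n) \<cdot> p (Suc n)) (length Xs) = hsum X X (\<lambda>n. j2 \<cdot> (k n \<cdot> r n) \<cdot> q2) (length Xs)"
      using b kr by (intro hsum_cong) (simp add: i_def p_def hom_simps)
    also have "\<dots> = j2 \<cdot> hsum X B (\<lambda>n. (k n \<cdot> r n) \<cdot> q2) (length Xs)"
      using b kr by (intro Cmp_hsum(1)[symmetric]) (auto simp: arr_simps)
    also have "hsum X B (\<lambda>n. (k n \<cdot> r n) \<cdot> q2) (length Xs) = hsum B B (\<lambda>n. k n \<cdot> r n) (length Xs) \<cdot> q2"
      using b kr by (intro Cmp_hsum(2)[symmetric]) (auto simp: arr_simps)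
    also have "\<dots> = q2" using b by (simp add: s Cmp_Idn)
    also have "i 0 \<cdot> p 0 \<^bold>+ j2 \<cdot> q2 = Idn C X" using biprod_mapsD(12)[OF X] by (simp add: i_def p_def)
    finally show ?thesis .
  qed
  ultimately have "sum_maps (A # Xs) X i p" unfolding sum_maps_def using m s b by auto
  then show ?thesis using direct_sum_iff by blast
qed

text \<open>
  The inclusion of \<open>B\<close> is assembled from its projections to the summands \<open>Xs\<close> and their inclusions into \<open>X\<close>;
  dually for the projection to \<open>B\<close>.
\<close>

lemma direct_sum_ConsD:
  assumes "direct_sum C (A # Xs) X" "direct_sum C Xs B"
  shows "direct_sum C [A, B] X"
proof -
  obtain k r where B: "sum_maps Xs B k r" using assms direct_sum_iff by blast
  obtain i p where X: "sum_maps (A # Xs) X i p" using assms direct_sum_iff by blast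
  let ?n = "length Xs"
  have kr: "k n \<in> mor C (Xs ! n) B" "r n \<in> mor C B (Xs ! n)" "Xs ! n \<in> Obj C" if "n < ?n" for n
    using B that by (auto simp: sum_maps_def)
  have rk: "r n \<cdot> k l = (if n = l then Idn C (Xs ! n) else Zer C (Xs ! l) (Xs ! n))" 
    if "n < ?n" "l < ?n" for n l
    using B that by (auto simp: sum_maps_def)
  have s: "hsum B B (\<lambda>n. k n \<cdot> r n) ?n = Idn C B" "hsum X X (\<lambda>n. i n \<cdot> p n) (Suc ?n) = Idn C X"
    and o: "A \<in> Obj C" "B \<in> Obj C" "X \<in> Obj C"
    using B X by (auto simp: sum_maps_def)
  have ip: "i n \<in> mor C ((A # Xs) ! n) X" "p n \<in> mor C X ((A # Xs) ! n)" if "n < Suc ?n" for n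
    using X that by (auto simp: sum_maps_def)
  have pi: "p n \<cdot> i l = (if n = l then Idn C ((A # Xs) ! n) else Zer C ((A # Xs) ! l) ((A # Xs) ! n))" 
    if "n < Suc ?n" "l < Suc ?n" for n l
    using X that by (auto simp: sum_maps_def)
  have ip0: "i 0 \<in> mor C A X" "p 0 \<in> mor C X A" using ip[of 0] by auto
  have ipS: "i (Suc n) \<in> mor C (Xs ! n) X" "p (Suc n) \<in> mor C X (Xs ! n)" if "n < ?n" for n
    using ip[of "Suc n"] that by auto
  define i2 p2 where "i2 = hsum B X (\<lambda>n. i (Suc n) \<cdot> r n) ?n" and "p2 = hsum X B (\<lambda>n. k n \<cdot> p (Suc n)) ?n"
  have m2: "i2 \<in> mor C B X" "p2 \<in> mor C X B"
    unfolding i2_def p2_def by (rule hsum_arr; use o kr ipS in \<open>simp add: arr_simps\<close>)+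
  have pi2: "p (Suc n) \<cdot> i2 = r n" if n: "n < ?n" for n
  proof -
    have "p (Suc n) \<cdot> i2 = hsum B (Xs ! n) (\<lambda>l. p (Suc n) \<cdot> i (Suc l) \<cdot> r l) ?n"
      unfolding i2_def using o kr ipS n by (intro Cmp_hsum(1)) (auto simp: arr_simps)
    also have "\<dots> = hsum B (Xs ! n) (\<lambda>l. if n = l then r n else Zer C B (Xs ! n)) ?n"
    proof (rule hsum_cong)
      fix l assume l: "l < ?n"
      have "p (Suc n) \<cdot> i (Suc l) \<cdot> r l = (if n = l then Idn C (Xs ! n) else Zer C (Xs ! l) (Xs ! n)) \<cdot> r l"
        using pi[of "Suc n" "Suc l"] n l kr[OF l] ipS[OF l] ipS[OF n] 
        by (subst Cmp_reassoc[where h = "if n = l then Idn C (Xs ! n) else Zer C (Xs ! l) (Xs ! n)"]) (auto simp: mor_iff)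
      then show "p (Suc n) \<cdot> i (Suc l) \<cdot> r l = (if n = l then r n else Zer C B (Xs ! n))"
        using kr[OF n] kr[OF l] by (auto simp: hom_simps)
    qed
    also have "\<dots> = r n" using o kr n by (subst hsum_single[of _ _ n]) auto
    finally show ?thesis .
  qed
  have i2k: "i2 \<cdot> k n = i (Suc n)" if n: "n < ?n" for n
  proof -
    have "i2 \<cdot> k n = hsum (Xs ! n) X (\<lambda>l. (i (Suc l) \<cdot> r l) \<cdot> k n) ?n"
      unfolding i2_def using o kr ipS n by (intro Cmp_hsum(2)) (auto simp: arr_simps)
    also have "\<dots> = hsum (Xs ! n) X (\<lambda>l. if n = l then i (Suc n) else Zer C (Xs ! n) X) ?n"
    proof (rule hsum_cong)
      fix l assume l: "l < ?n"
      then show "(i (Suc l) \<cdot> r l) \<cdot> k n = (if n = l then i (Suc n) else Zer C (Xs ! n) X)"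
        using rk[of l n] n kr[OF n] kr[OF l] ipS[OF l] o by (auto simp: hom_simps)
    qed
    also have "\<dots> = i (Suc n)" using o kr n ipS by (subst hsum_single[of _ _ n]) auto
    finally show ?thesis .
  qed
  have "p2 \<cdot> i2 = hsum B B (\<lambda>n. (k n \<cdot> p (Suc n)) \<cdot> i2) ?n"
    unfolding p2_def using o kr ipS m2 by (intro Cmp_hsum(2)) (auto simp: arr_simps)
  also have "\<dots> = hsum B B (\<lambda>n. k n \<cdot> r n) ?n"
  proof (rule hsum_cong)
    fix n assume "n < ?n"
    then show "(k n \<cdot> p (Suc n)) \<cdot> i2 = k n \<cdot> r n" using pi2[of n] kr[of n] ipS[of n] m2 by (simp add: hom_simps)
  qed
  finally have a: "p2 \<cdot> i2 = Idn C B" using s by simp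
  have "i2 \<cdot> p2 = hsum X X (\<lambda>n. i2 \<cdot> k n \<cdot> p (Suc n)) ?n"
    unfolding p2_def using o kr ipS m2 by (intro Cmp_hsum(1)) (auto simp: arr_simps)
  also have "\<dots> = hsum X X (\<lambda>n. i (Suc n) \<cdot> p (Suc n)) ?n"
  proof (rule hsum_cong)
    fix n assume "n < ?n"
    then show "i2 \<cdot> k n \<cdot> p (Suc n) = i (Suc n) \<cdot> p (Suc n)" 
      using i2k[of n] kr[of n] ipS[of n] m2 Cmp_reassoc[OF i2k[of n]] by (simp add: mor_iff)
  qed
  finally have "i 0 \<cdot> p 0 \<^bold>+ i2 \<cdot> p2 = hsum X X (\<lambda>n. i n \<cdot> p n) (Suc ?n)"
    using o ip by (subst hsum_Suc_shift) (auto simp: arr_simps)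
  then have b: "i 0 \<cdot> p 0 \<^bold>+ i2 \<cdot> p2 = Idn C X" using s by simp
  have "p 0 \<cdot> i2 = hsum B A (\<lambda>n. p 0 \<cdot> i (Suc n) \<cdot> r n) ?n"
    unfolding i2_def using o kr ipS ip0 by (intro Cmp_hsum(1)) (auto simp: arr_simps)
  also have "\<dots> = Zer C B A" 
  proof (rule hsum_zero[OF o(2,1)])
    fix n assume n: "n < ?n"
    show "p 0 \<cdot> i (Suc n) \<cdot> r n = Zer C B A"
      using n pi[of 0 "Suc n"] kr[of n] ipS[of n] ip0 o by (subst Cmp_reassoc[of "p 0" "i (Suc n)" "Zer C (Xs ! n) A"]) (auto simp: hom_simps)
  qed
  finally have c: "p 0 \<cdot> i2 = Zer C B A" .
  have "p2 \<cdot> i 0 = hsum A B (\<lambda>n. (k n \<cdot> p (Suc n)) \<cdot> i 0) ?n"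
    unfolding p2_def using o kr ipS ip0 by (intro Cmp_hsum(2)) (auto simp: arr_simps)
  also have "\<dots> = Zer C A B" 
  proof (rule hsum_zero[OF o(1,2)])
    fix n assume n: "n < ?n"
    show "(k n \<cdot> p (Suc n)) \<cdot> i 0 = Zer C A B"
      using n pi[of "Suc n" 0] kr[of n] ipS[of n] ip0 o by (auto simp: hom_simps)
  qed
  finally have d: "p2 \<cdot> i 0 = Zer C A B" .
  have "biprod_maps A B X (i 0) i2 (p 0) p2"
    unfolding biprod_maps_def using ip0 m2 a b c d pi[of 0 0] by simp
  then show ?thesis using direct_sum_pair_iff by blast
qed

end

context additive_category
begin

lemma direct_sum_exists: "set Xs \<subseteq> Obj C \<Longrightarrow> \<exists>X. direct_sum C Xs X"
proof (induction Xs)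
  case Nil
  then show ?case using ex_zero_object zero_object_direct_sum_Nil by blast
next
  case (Cons A Xs)
  then obtain B where B: "direct_sum C Xs B" by auto
  then have "B \<in> Obj C" by (simp add: direct_sum_def)
  then obtain X where "direct_sum C [A, B] X" using Cons.prems ex_direct_sum[of A B] by auto
  then show ?case using B direct_sum_Cons by blast
qed

lemma direct_sum_induct [consumes 1, case_names zero add]:
  assumes "direct_sum C Xs X" 
    and "\<And>Z. zero_object C Z \<Longrightarrow> P Z"
    and "\<And>A B X. A \<in> set Xs \<Longrightarrow> P B \<Longrightarrow> direct_sum C [A, B] X \<Longrightarrow> P X"
  shows "P X"
  using assms(1,3)
proof (induction Xs arbitrary: X)
  case Nil
  then show ?case using direct_sum_Nil assms(2) by blast
next
  case (Cons A Xs)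
  have "set Xs \<subseteq> Obj C" using Cons.prems(1) by (simp add: direct_sum_def)
  then obtain B where B: "direct_sum C Xs B" using direct_sum_exists by blast
  then have "P B" using Cons.IH Cons.prems(2) by (meson list.set_intros(2))
  then show ?case using Cons.prems B direct_sum_ConsD by (meson list.set_intros(1))
qed

text \<open>
  The monoid of isomorphism classes under direct sum. The product is computed on an arbitrary choice of
  representatives and of their biproduct.
\<close>

definition iso_monoid where
  "iso_monoid = \<lparr>carrier = iso_class C ` Obj C,
     monoid.mult = \<lambda>c d. iso_class C (SOME X. \<exists>A \<in> c. \<exists>B \<in> d. direct_sum C [A, B] X),
     one = iso_class C (SOME Z. zero_object C Z)\<rparr>"

lemma iso_monoid_carrier: "carrier iso_monoid = iso_class C ` Obj C"
  by (simp add: iso_monoid_def)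

lemma iso_class_carrier: "A \<in> Obj C \<Longrightarrow> iso_class C A \<in> carrier iso_monoid"
  by (simp add: iso_monoid_carrier)

lemma iso_class_biprod: assumes "direct_sum C [A, B] X"
  shows "iso_class C A \<otimes>\<^bsub>iso_monoid\<^esub> iso_class C B = iso_class C X"
proof -
  note o = biprod_objs[OF assms]
  let ?P = "\<lambda>X. \<exists>A' \<in> iso_class C A. \<exists>B' \<in> iso_class C B. direct_sum C [A', B'] X"
  have "?P X" using assms isomorphic_refl o by (auto simp: iso_class_def)
  then have "?P (SOME X. ?P X)" by (rule someI)
  then obtain A' B' where "isomorphic C A' A" "isomorphic C B' B" "direct_sum C [A', B'] (SOME X. ?P X)"
    by (auto simp: iso_class_def)
  then have "isomorphic C (SOME X. ?P X) X" using biprod_unique assms by blast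
  then show ?thesis using o by (auto simp: iso_monoid_def iso_class_eq_iff isomorphic_def)
qed

lemma iso_class_zero: assumes "zero_object C Z" shows "iso_class C Z = \<one>\<^bsub>iso_monoid\<^esub>"
proof -
  let ?Z = "SOME Z. zero_object C Z"
  have z: "zero_object C ?Z" using assms by (rule someI)
  have o: "Z \<in> Obj C" "?Z \<in> Obj C" using assms z by (auto simp: zero_object_def)
  have "isomorphic C Z ?Z"
    using biprod_unique[OF biprod_zero[OF z o(1)] biprod_comm[OF biprod_zero[OF assms o(2)]]] isomorphic_refl o by blast
  then show ?thesis using o by (simp add: iso_monoid_def iso_class_eq_iff)
qed

lemma iso_monoid_comm_monoid: "comm_monoid iso_monoid"
proof (rule comm_monoidI)
  fix x y assume "x \<in> carrier iso_monoid" "y \<in> carrier iso_monoid"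
  then obtain A B where A: "A \<in> Obj C" "x = iso_class C A" and B: "B \<in> Obj C" "y = iso_class C B"
    by (auto simp: iso_monoid_carrier)
  obtain X where X: "direct_sum C [A, B] X" using A B ex_direct_sum by blast
  then show "x \<otimes>\<^bsub>iso_monoid\<^esub> y \<in> carrier iso_monoid" 
    using A B iso_class_biprod iso_class_carrier biprod_objs(3) by auto
  show "x \<otimes>\<^bsub>iso_monoid\<^esub> y = y \<otimes>\<^bsub>iso_monoid\<^esub> x" 
    using A B iso_class_biprod[OF X] iso_class_biprod[OF biprod_comm[OF X]] by simp
  fix z assume "z \<in> carrier iso_monoid"
  then obtain D where D: "D \<in> Obj C" "z = iso_class C D" by (auto simp: iso_monoid_carrier)
  obtain Y where Y: "direct_sum C [X, D] Y" using X D ex_direct_sum biprod_objs(3) by blast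
  obtain W where W: "direct_sum C [B, D] W" using B D ex_direct_sum by blast
  show "x \<otimes>\<^bsub>iso_monoid\<^esub> y \<otimes>\<^bsub>iso_monoid\<^esub> z = x \<otimes>\<^bsub>iso_monoid\<^esub> (y \<otimes>\<^bsub>iso_monoid\<^esub> z)"
    using A B D iso_class_biprod[OF X] iso_class_biprod[OF Y] iso_class_biprod[OF W] 
      iso_class_biprod[OF biprod_assoc[OF X Y W]] by simp
next
  obtain Z where Z: "zero_object C Z" using ex_zero_object by blast
  then show "\<one>\<^bsub>iso_monoid\<^esub> \<in> carrier iso_monoid" 
    using iso_class_zero[OF Z] by (auto simp: iso_monoid_carrier zero_object_def)
  fix x assume "x \<in> carrier iso_monoid"
  then obtain A where A: "A \<in> Obj C" "x = iso_class C A" by (auto simp: iso_monoid_carrier)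
  show "\<one>\<^bsub>iso_monoid\<^esub> \<otimes>\<^bsub>iso_monoid\<^esub> x = x"
    using iso_class_biprod[OF biprod_comm[OF biprod_zero[OF Z A(1)]]] A iso_class_zero[OF Z] by simp
qed

text \<open>By the Krull-Schmidt property \<open>z\<close> is a product of classes with local endomorphism rings, which cancel one by one.\<close>

lemma iso_monoid_cancel:
  assumes ks: "krull_schmidt C" 
    and xyz: "x \<in> carrier iso_monoid" "y \<in> carrier iso_monoid" "z \<in> carrier iso_monoid"
    and eq: "x \<otimes>\<^bsub>iso_monoid\<^esub> z = y \<otimes>\<^bsub>iso_monoid\<^esub> z"
  shows "x = y"
proof -
  interpret M: comm_monoid iso_monoid by (rule iso_monoid_comm_monoid)
  obtain Z where Z: "Z \<in> Obj C" "z = iso_class C Z" using xyz by (auto simp: iso_monoid_carrier)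
  obtain Xs where Xs: "\<forall>A \<in> set Xs. local_ring (End C A)" "direct_sum C Xs Z"
    using ks Z by (auto simp: krull_schmidt_def)
  have "Z \<in> Obj C \<and> (\<forall>x \<in> carrier iso_monoid. \<forall>y \<in> carrier iso_monoid.
     x \<otimes>\<^bsub>iso_monoid\<^esub> iso_class C Z = y \<otimes>\<^bsub>iso_monoid\<^esub> iso_class C Z \<longrightarrow> x = y)"
    using Xs(2)
  proof (induction rule: direct_sum_induct)
    case (zero Z)
    then show ?case using iso_class_zero[OF zero] by (auto simp: zero_object_def)
  next
    case (add L Z X)
    have loc: "local_ring (End C L)" using add.hyps(1) Xs by blast
    note o = biprod_objs[OF add.hyps(2)]
    have "x = y" if x: "x \<in> carrier iso_monoid" and y: "y \<in> carrier iso_monoid"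
      and e: "x \<otimes>\<^bsub>iso_monoid\<^esub> iso_class C X = y \<otimes>\<^bsub>iso_monoid\<^esub> iso_class C X" for x y
    proof -
      obtain A B where A: "A \<in> Obj C" "x = iso_class C A" and B: "B \<in> Obj C" "y = iso_class C B"
        using x y by (auto simp: iso_monoid_carrier)
      obtain A' B' where A': "direct_sum C [A, L] A'" and B': "direct_sum C [B, L] B'"
        using A B o ex_direct_sum by meson
      have "(x \<otimes>\<^bsub>iso_monoid\<^esub> iso_class C L) \<otimes>\<^bsub>iso_monoid\<^esub> iso_class C Z 
          = (y \<otimes>\<^bsub>iso_monoid\<^esub> iso_class C L) \<otimes>\<^bsub>iso_monoid\<^esub> iso_class C Z"
        using e x y o iso_class_carrier by (simp add: M.m_assoc flip: iso_class_biprod[OF add.hyps(2)])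
      then have "x \<otimes>\<^bsub>iso_monoid\<^esub> iso_class C L = y \<otimes>\<^bsub>iso_monoid\<^esub> iso_class C L"
        using add.IH x y o iso_class_carrier M.m_closed by blast
      then have "isomorphic C A' B'" 
        using A B iso_class_biprod[OF A'] iso_class_biprod[OF B'] biprod_objs[OF A'] biprod_objs[OF B']
        by (simp add: iso_class_eq_iff)
      then have "isomorphic C A B" by (rule cancel_local[OF loc A' B'])
      then show "x = y" using A B by (simp add: iso_class_eq_iff)
    qed
    then show ?case using o by blast
  qed
  then show ?thesis using xyz eq Z by blast
qed

end

section \<open>Projective presentations and Schanuel's lemma\<close>

context preadditive_category
begin

lemma kernel_arr: assumes "is_kernel C k f"
  shows "k \<in> Arr C" "f \<in> Arr C" "Cod C k = Dom C f" "f \<cdot> k = Zer C (Dom C k) (Cod C f)"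
  using assms by (auto simp: is_kernel_def)

lemma kernel_factor: assumes "is_kernel C k f" "x \<in> Arr C" "Cod C x = Dom C f" "f \<cdot> x = Zer C (Dom C x) (Cod C f)"
  obtains u where "u \<in> mor C (Dom C x) (Dom C k)" "k \<cdot> u = x"
  using assms unfolding is_kernel_def by blast

lemma kernel_mono: assumes "is_kernel C k f" "u \<in> Arr C" "v \<in> Arr C" "Cod C u = Dom C k" "Cod C v = Dom C k"
    "Dom C u = Dom C v" "k \<cdot> u = k \<cdot> v"
  shows "u = v"
proof -
  note k = kernel_arr[OF assms(1)]
  have "f \<cdot> k \<cdot> v = Zer C (Dom C (k \<cdot> v)) (Cod C f)" "k \<cdot> v \<in> Arr C" "Cod C (k \<cdot> v) = Dom C f"
    using k assms(3,5) by (simp_all add: Cmp_reassoc[OF k(4)] hom_simps)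
  then have "\<exists>!w. w \<in> mor C (Dom C (k \<cdot> v)) (Dom C k) \<and> k \<cdot> w = k \<cdot> v"
    using assms(1) unfolding is_kernel_def by blast
  then show ?thesis using assms k by (auto simp: arr_simps)
qed

lemma cokernel_arr: assumes "is_cokernel C q f"
  shows "q \<in> Arr C" "f \<in> Arr C" "Dom C q = Cod C f" "q \<cdot> f = Zer C (Dom C f) (Cod C q)"
  using assms by (auto simp: is_cokernel_def)

lemma cokernel_factor: assumes "is_cokernel C q f" "x \<in> Arr C" "Dom C x = Cod C f" "x \<cdot> f = Zer C (Dom C f) (Cod C x)"
  obtains u where "u \<in> mor C (Cod C q) (Cod C x)" "u \<cdot> q = x"
  using assms unfolding is_cokernel_def by blast

lemma cokernel_epi: assumes "is_cokernel C q f" "u \<in> Arr C" "v \<in> Arr C" "Dom C u = Cod C q" "Dom C v = Cod C q"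
    "Cod C u = Cod C v" "u \<cdot> q = v \<cdot> q"
  shows "u = v"
proof -
  note k = cokernel_arr[OF assms(1)]
  have "(v \<cdot> q) \<cdot> f = Zer C (Dom C f) (Cod C (v \<cdot> q))" "v \<cdot> q \<in> Arr C" "Dom C (v \<cdot> q) = Cod C f"
    using k assms(3,5) by (simp_all add: hom_simps)
  then have "\<exists>!w. w \<in> mor C (Cod C q) (Cod C (v \<cdot> q)) \<and> w \<cdot> q = v \<cdot> q"
    using assms(1) unfolding is_cokernel_def by blast
  then show ?thesis using assms k by (auto simp: arr_simps)
qed

lemma is_kernelI:
  assumes "k \<in> mor C K P" "f \<in> mor C P M" "f \<cdot> k = Zer C K M"
    and "\<And>D x. \<lbrakk>x \<in> mor C D P; f \<cdot> x = Zer C D M\<rbrakk> \<Longrightarrow> \<exists>u \<in> mor C D K. k \<cdot> u = x"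
    and "\<And>D u v. \<lbrakk>u \<in> mor C D K; v \<in> mor C D K; k \<cdot> u = k \<cdot> v\<rbrakk> \<Longrightarrow> u = v"
  shows "is_kernel C k f"
proof -
  have "\<exists>!u. u \<in> mor C (Dom C x) K \<and> k \<cdot> u = x" 
    if "x \<in> Arr C" "Cod C x = P" "f \<cdot> x = Zer C (Dom C x) M" for x
    using assms(4)[of x "Dom C x"] assms(5) that by (auto simp: mor_iff)
  then show ?thesis using assms(1-3) unfolding is_kernel_def mor_iff by auto
qed

lemma is_cokernelI:
  assumes "f \<in> mor C K P" "q \<in> mor C P M" "q \<cdot> f = Zer C K M"
    and "\<And>D x. \<lbrakk>x \<in> mor C P D; x \<cdot> f = Zer C K D\<rbrakk> \<Longrightarrow> \<exists>u \<in> mor C M D. u \<cdot> q = x"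
    and "\<And>D u v. \<lbrakk>u \<in> mor C M D; v \<in> mor C M D; u \<cdot> q = v \<cdot> q\<rbrakk> \<Longrightarrow> u = v"
  shows "is_cokernel C q f"
proof -
  have "\<exists>!u. u \<in> mor C M (Cod C x) \<and> u \<cdot> q = x" 
    if "x \<in> Arr C" "Dom C x = P" "x \<cdot> f = Zer C K (Cod C x)" for x
    using assms(4)[of x "Cod C x"] assms(5) that by (auto simp: mor_iff)
  then show ?thesis using assms(1-3) unfolding is_cokernel_def mor_iff by auto
qed

end

context exact_category
begin

lemma Proj_Obj: "P \<in> Proj C E \<Longrightarrow> P \<in> Obj C"
  by (simp add: Proj_def)

lemma E_arr: assumes "(i, p) \<in> E"
  shows "i \<in> Arr C" "p \<in> Arr C" "Dom C p = Cod C i" "p \<cdot> i = Zer C (Dom C i) (Cod C p)"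
  using E_kernel[OF assms] by (auto simp: is_kernel_def)

lemma Proj_lift:
  assumes "P \<in> Proj C E" "(i, p) \<in> E" "f \<in> mor C P (Cod C p)"
  shows "\<exists>g \<in> mor C P (Dom C p). p \<cdot> g = f"
proof -
  have "(\<lambda>g. p \<cdot> g) \<in> epi (Hom C P (Cod C i)) (Hom C P (Cod C p))"
    using assms(1,2) unfolding Proj_def short_exact_sequence_iff by auto
  then have "(\<lambda>g. p \<cdot> g) ` mor C P (Cod C i) = mor C P (Cod C p)"
    by (simp add: epi_def)
  then show ?thesis using assms(3) E_arr[OF assms(2)] by (metis imageE)
qed

lemma ProjI:
  assumes "P \<in> Obj C" and lift: "\<And>i p f. (i, p) \<in> E \<Longrightarrow> f \<in> mor C P (Cod C p) \<Longrightarrow> \<exists>g \<in> mor C P (Dom C p). p \<cdot> g = f"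
  shows "P \<in> Proj C E"
proof -
  have "short_exact_sequence (Hom C P (Cod C p)) (Hom C P (Cod C i)) (Hom C P (Dom C i)) (Cmp C p) (Cmp C i)"
    if ip: "(i, p) \<in> E" for i p
  proof -
    note e = E_arr[OF ip] and k = E_kernel[OF ip]
    have o: "Dom C i \<in> Obj C" "Cod C i \<in> Obj C" "Cod C p \<in> Obj C" using e by (auto simp: arr_simps)
    interpret G1: group "Hom C P (Dom C i)" by (rule Hom_group) (use assms o in auto)
    interpret G2: group "Hom C P (Cod C i)" by (rule Hom_group) (use assms o in auto)
    interpret G3: group "Hom C P (Cod C p)" by (rule Hom_group) (use assms o in auto)
    have h: "Cmp C i \<in> hom (Hom C P (Dom C i)) (Hom C P (Cod C i))"
      "Cmp C p \<in> hom (Hom C P (Cod C i)) (Hom C P (Cod C p))"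
      using e by (auto simp: hom_def hom_simps)
    have epi: "Cmp C p ` mor C P (Cod C i) = mor C P (Cod C p)"
    proof
      show "mor C P (Cod C p) \<subseteq> Cmp C p ` mor C P (Cod C i)" using lift[OF ip] e by force
    qed (use e in \<open>auto simp: arr_simps\<close>)
    have inj: "inj_on (Cmp C i) (mor C P (Dom C i))"
      by (rule inj_onI, rule kernel_mono[OF k]) (auto simp: mor_iff)
    have ex: "kernel (Hom C P (Cod C i)) (Hom C P (Cod C p)) (Cmp C p) = Cmp C i ` mor C P (Dom C i)"
    proof
      show "kernel (Hom C P (Cod C i)) (Hom C P (Cod C p)) (Cmp C p) \<subseteq> Cmp C i ` mor C P (Dom C i)"
      proof
        fix x assume "x \<in> kernel (Hom C P (Cod C i)) (Hom C P (Cod C p)) (Cmp C p)"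
        then have x: "x \<in> mor C P (Cod C i)" "p \<cdot> x = Zer C P (Cod C p)" by (auto simp: kernel_def)
        then obtain u where "u \<in> mor C P (Dom C i)" "i \<cdot> u = x" 
          using kernel_factor[OF k, of x] e by (auto simp: mor_iff)
        then show "x \<in> Cmp C i ` mor C P (Dom C i)" by blast
      qed
      show "Cmp C i ` mor C P (Dom C i) \<subseteq> kernel (Hom C P (Cod C i)) (Hom C P (Cod C p)) (Cmp C p)"
        using e o by (auto simp: kernel_def arr_simps Cmp_reassoc[OF e(4)] Cmp_Zer)
    qed
    show ?thesis
      unfolding short_exact_sequence_iff using h epi inj ex
      by (simp add: epi_def mon_def group_hom_def group_hom_axioms_def G1.is_group G2.is_group G3.is_group)
  qed
  then show ?thesis using assms(1) by (auto simp: Proj_def)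
qed

lemma Proj_retract:
  assumes P: "P \<in> Proj C E" and s: "s \<in> mor C A P" "r \<in> mor C P A" "r \<cdot> s = Idn C A"
  shows "A \<in> Proj C E"
proof (rule ProjI)
  show "A \<in> Obj C" using s mor_objs by blast
  fix i p f assume ip: "(i, p) \<in> E" and f: "f \<in> mor C A (Cod C p)"
  note e = E_arr[OF ip]
  obtain g where g: "g \<in> mor C P (Dom C p)" "p \<cdot> g = f \<cdot> r"
    using Proj_lift[OF P ip, of "f \<cdot> r"] f s by (auto simp: arr_simps)
  have "p \<cdot> g \<cdot> s = f" using g f s e by (simp add: Cmp_reassoc[OF g(2)] mor_iff Cmp_assoc' Cmp_Idn)
  then show "\<exists>g \<in> mor C A (Dom C p). p \<cdot> g = f" using g s by (intro bexI[of _ "g \<cdot> s"]) (auto simp: arr_simps)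
qed

lemma Proj_biprod: assumes "A \<in> Proj C E" "B \<in> Proj C E" "direct_sum C [A, B] X" shows "X \<in> Proj C E"
proof (rule ProjI)
  show "X \<in> Obj C" using assms(3) biprod_objs by blast
  obtain i1 i2 p1 p2 where X: "biprod_maps A B X i1 i2 p1 p2" using assms(3) direct_sum_pair_iff by meson
  note b = biprod_maps_simps[OF X]
  fix i p f assume ip: "(i, p) \<in> E" and f: "f \<in> mor C X (Cod C p)"
  note e = E_arr[OF ip]
  obtain g where g: "g \<in> mor C A (Dom C p)" "p \<cdot> g = f \<cdot> i1"
    using Proj_lift[OF assms(1) ip, of "f \<cdot> i1"] f b by (auto simp: arr_simps)
  obtain h where h: "h \<in> mor C B (Dom C p)" "p \<cdot> h = f \<cdot> i2"
    using Proj_lift[OF assms(2) ip, of "f \<cdot> i2"] f b by (auto simp: arr_simps)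
  have "p \<cdot> (g \<cdot> p1 \<^bold>+ h \<cdot> p2) = f"
    by (rule biprod_eqI[OF X]; use g h f b e in \<open>simp add: hom_simps\<close>)
  then show "\<exists>g \<in> mor C X (Dom C p). p \<cdot> g = f"
    using g h b by (intro bexI[of _ "g \<cdot> p1 \<^bold>+ h \<cdot> p2"]) (auto simp: arr_simps)
qed

lemma Proj_zero: assumes "zero_object C Z" shows "Z \<in> Proj C E"
proof (rule ProjI)
  show z: "Z \<in> Obj C" using assms by (simp add: zero_object_def)
  fix i p f assume ip: "(i, p) \<in> E" and f: "f \<in> mor C Z (Cod C p)"
  note e = E_arr[OF ip]
  have "f = Zer C Z (Cod C p)" using assms f z e unfolding zero_object_def 
    by (metis Zer_arr(1-3) Cod_in_Obj mor_iff)
  then show "\<exists>g \<in> mor C Z (Dom C p). p \<cdot> g = f"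
    using e z by (intro bexI[of _ "Zer C Z (Dom C p)"]) (auto simp: hom_simps)
qed

text \<open>
  For the arguments below a short exact sequence with projective middle term enters only through
  the following properties. Unlike membership in \<open>E\<close>, they visibly pass to biproducts.
\<close>

definition presentation where
  "presentation K i P p M \<longleftrightarrow> P \<in> Proj C E \<and> i \<in> mor C K P \<and> p \<in> mor C P M \<and>
     is_kernel C i p \<and> is_cokernel C p i \<and> (\<forall>Q \<in> Proj C E. \<forall>f \<in> mor C Q M. \<exists>g \<in> mor C Q P. p \<cdot> g = f)"

lemma presentationD: assumes "presentation K i P p M"
  shows "P \<in> Proj C E" "is_kernel C i p" "is_cokernel C p i"
    "i \<in> Arr C" "Dom C i = K" "Cod C i = P" "p \<in> Arr C" "Dom C p = P" "Cod C p = M"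
    "K \<in> Obj C" "P \<in> Obj C" "M \<in> Obj C" "p \<cdot> i = Zer C K M"
    "x \<in> Arr C \<Longrightarrow> Cod C x = K \<Longrightarrow> p \<cdot> i \<cdot> x = Zer C (Dom C x) M"
proof -
  show a: "P \<in> Proj C E" "is_kernel C i p" "is_cokernel C p i"
    "i \<in> Arr C" "Dom C i = K" "Cod C i = P" "p \<in> Arr C" "Dom C p = P" "Cod C p = M"
    "K \<in> Obj C" "P \<in> Obj C" "M \<in> Obj C"
    using assms mor_objs unfolding presentation_def by (auto simp: mor_iff)
  show b: "p \<cdot> i = Zer C K M" using kernel_arr(4)[OF a(2)] a by simp
  show "x \<in> Arr C \<Longrightarrow> Cod C x = K \<Longrightarrow> p \<cdot> i \<cdot> x = Zer C (Dom C x) M"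
    using a by (simp add: Cmp_reassoc[OF b] Cmp_Zer)
qed

lemma presentation_lift: assumes "presentation K i P p M" "Q \<in> Proj C E" "f \<in> mor C Q M"
  obtains g where "g \<in> mor C Q P" "p \<cdot> g = f"
  using assms unfolding presentation_def by blast

lemma E_presentation: assumes "(i, p) \<in> E" "P \<in> Proj C E" "i \<in> mor C K P" "p \<in> mor C P M"
  shows "presentation K i P p M"
  using assms E_kernel E_cokernel Proj_lift[OF _ assms(1)] unfolding presentation_def by (auto simp: mor_iff)

text \<open>
  Both sides are the pullback of \<open>p\<close> and \<open>q\<close>: lifting \<open>p\<close> through \<open>q\<close> and \<open>q\<close> through \<open>p\<close> splits its
  projections to \<open>P\<close> and \<open>Q\<close>, whose kernels are \<open>K'\<close> and \<open>K\<close>. The matrix below is the resulting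
  isomorphism.
\<close>

theorem schanuel:
  assumes 1: "presentation K i P p M" and 2: "presentation K' j Q q M"
    and X: "direct_sum C [K, Q] X" and Y: "direct_sum C [K', P] Y"
  shows "isomorphic C X Y"
proof -
  note I = presentationD[OF 1] and J = presentationD[OF 2]
  obtain f where f: "f \<in> mor C P Q" "q \<cdot> f = p" using presentation_lift[OF 2 I(1), of p] I by (auto simp: mor_iff)
  obtain g where g: "g \<in> mor C Q P" "p \<cdot> g = q" using presentation_lift[OF 1 J(1), of q] J by (auto simp: mor_iff)
  have F: "f \<in> Arr C" "Dom C f = P" "Cod C f = Q" "g \<in> Arr C" "Dom C g = Q" "Cod C g = P"
    using f g by (auto simp: mor_iff)
  note fg = Cmp_reassoc[OF f(2)] Cmp_reassoc[OF g(2)] f(2) g(2)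
  obtain a where a: "a \<in> mor C K K'" "j \<cdot> a = \<^bold>- (f \<cdot> i)"
    using kernel_factor[OF J(2), of "\<^bold>- (f \<cdot> i)"] F I(4-) J(4-) fg by (auto simp: hom_simps)
  obtain b where b: "b \<in> mor C Q K'" "j \<cdot> b = Idn C Q \<^bold>+ \<^bold>- (f \<cdot> g)"
    using kernel_factor[OF J(2), of "Idn C Q \<^bold>+ \<^bold>- (f \<cdot> g)"] F I(4-) J(4-) fg by (auto simp: hom_simps)
  obtain a' where a': "a' \<in> mor C K' K" "i \<cdot> a' = \<^bold>- (g \<cdot> j)"
    using kernel_factor[OF I(2), of "\<^bold>- (g \<cdot> j)"] F I(4-) J(4-) fg by (auto simp: hom_simps)
  obtain b' where b': "b' \<in> mor C P K" "i \<cdot> b' = Idn C P \<^bold>+ \<^bold>- (g \<cdot> f)"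
    using kernel_factor[OF I(2), of "Idn C P \<^bold>+ \<^bold>- (g \<cdot> f)"] F I(4-) J(4-) fg by (auto simp: hom_simps)
  have m: "a \<in> Arr C" "Dom C a = K" "Cod C a = K'" "b \<in> Arr C" "Dom C b = Q" "Cod C b = K'"
      "a' \<in> Arr C" "Dom C a' = K'" "Cod C a' = K" "b' \<in> Arr C" "Dom C b' = P" "Cod C b' = K"
    using a b a' b' by (auto simp: mor_iff)
  note eqs = a(2) b(2) a'(2) b'(2) a(2)[THEN Cmp_reassoc] b(2)[THEN Cmp_reassoc] a'(2)[THEN Cmp_reassoc] b'(2)[THEN Cmp_reassoc]
  note all = m F I(4-13) J(4-13) eqs hom_simps hom_ac
  have l: "a' \<cdot> a \<^bold>+ b' \<cdot> i = Idn C K" "a' \<cdot> b \<^bold>+ b' \<cdot> g = Zer C Q K"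
    "a \<cdot> a' \<^bold>+ b \<cdot> j = Idn C K'" "a \<cdot> b' \<^bold>+ b \<cdot> f = Zer C P K'"
    by (rule kernel_mono[OF I(2)] kernel_mono[OF J(2)]; simp add: all)+
  have r: "j \<cdot> a \<^bold>+ f \<cdot> i = Zer C K Q" "j \<cdot> b \<^bold>+ f \<cdot> g = Idn C Q" 
    "i \<cdot> a' \<^bold>+ g \<cdot> j = Zer C K' P" "i \<cdot> b' \<^bold>+ g \<cdot> f = Idn C P"
    by (simp_all add: all)
  obtain i1 i2 p1 p2 j1 j2 q1 q2 where "biprod_maps K Q X i1 i2 p1 p2" "biprod_maps K' P Y j1 j2 q1 q2"
    using X Y direct_sum_pair_iff by meson
  then show ?thesis
    by (rule matrix_isomorphic[where a = a and b = b and c = i and d = g and a' = a' and b' = b' and c' = j and d' = f])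
      (use l r m F I(4-12) J(4-12) in \<open>simp_all add: mor_iff\<close>)
qed

text \<open>The dual statement: both sides are the pushout of \<open>i\<close> and \<open>j\<close>.\<close>

theorem dual_schanuel:
  assumes 1: "presentation K i P p A" and 2: "presentation K j Q q B"
    and f: "f \<in> mor C P Q" "f \<cdot> i = j" and g: "g \<in> mor C Q P" "g \<cdot> j = i"
    and X: "direct_sum C [A, Q] X" and Y: "direct_sum C [B, P] Y"
  shows "isomorphic C X Y"
proof -
  note I = presentationD[OF 1] and J = presentationD[OF 2]
  have F: "f \<in> Arr C" "Dom C f = P" "Cod C f = Q" "g \<in> Arr C" "Dom C g = Q" "Cod C g = P"
    using f g by (auto simp: mor_iff)
  obtain a where a: "a \<in> mor C A B" "a \<cdot> p = \<^bold>- (q \<cdot> f)"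
    using cokernel_factor[OF I(3), of "\<^bold>- (q \<cdot> f)"] F I(4-) J(4-) f(2) g(2) by (auto simp: hom_simps)
  obtain c where c: "c \<in> mor C A P" "c \<cdot> p = Idn C P \<^bold>+ \<^bold>- (g \<cdot> f)"
    using cokernel_factor[OF I(3), of "Idn C P \<^bold>+ \<^bold>- (g \<cdot> f)"] F I(4-) J(4-) f(2) g(2) by (auto simp: hom_simps)
  obtain a' where a': "a' \<in> mor C B A" "a' \<cdot> q = \<^bold>- (p \<cdot> g)"
    using cokernel_factor[OF J(3), of "\<^bold>- (p \<cdot> g)"] F I(4-) J(4-) f(2) g(2) by (auto simp: hom_simps)
  obtain c' where c': "c' \<in> mor C B Q" "c' \<cdot> q = Idn C Q \<^bold>+ \<^bold>- (f \<cdot> g)"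
    using cokernel_factor[OF J(3), of "Idn C Q \<^bold>+ \<^bold>- (f \<cdot> g)"] F I(4-) J(4-) f(2) g(2) by (auto simp: hom_simps)
  have m: "a \<in> Arr C" "Dom C a = A" "Cod C a = B" "c \<in> Arr C" "Dom C c = A" "Cod C c = P"
      "a' \<in> Arr C" "Dom C a' = B" "Cod C a' = A" "c' \<in> Arr C" "Dom C c' = B" "Cod C c' = Q"
    using a c a' c' by (auto simp: mor_iff)
  note eqs = a(2) c(2) a'(2) c'(2) a(2)[THEN Cmp_reassoc] c(2)[THEN Cmp_reassoc] a'(2)[THEN Cmp_reassoc] c'(2)[THEN Cmp_reassoc]
  note all = m F I(4-13) J(4-13) eqs hom_simps hom_ac
  have l: "a' \<cdot> a \<^bold>+ p \<cdot> c = Idn C A" "c' \<cdot> a \<^bold>+ f \<cdot> c = Zer C A Q"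
    "a \<cdot> a' \<^bold>+ q \<cdot> c' = Idn C B" "c \<cdot> a' \<^bold>+ g \<cdot> c' = Zer C B P"
    by (rule cokernel_epi[OF I(3)] cokernel_epi[OF J(3)]; simp add: all)+
  have r: "a' \<cdot> q \<^bold>+ p \<cdot> g = Zer C Q A" "c' \<cdot> q \<^bold>+ f \<cdot> g = Idn C Q" 
    "a \<cdot> p \<^bold>+ q \<cdot> f = Zer C P B" "c \<cdot> p \<^bold>+ g \<cdot> f = Idn C P"
    by (simp_all add: all)
  obtain i1 i2 p1 p2 j1 j2 q1 q2 where "biprod_maps A Q X i1 i2 p1 p2" "biprod_maps B P Y j1 j2 q1 q2"
    using X Y direct_sum_pair_iff by meson
  then show ?thesis
    by (rule matrix_isomorphic[where a = a and b = q and c = c and d = g and a' = a' and b' = p and c' = c' and d' = f])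
      (use l r m F I(4-12) J(4-12) in \<open>simp_all add: mor_iff\<close>)
qed

end

section \<open>Biproducts and retracts of presentations\<close>

context exact_category
begin

definition extends_to_Proj where
  "extends_to_Proj i \<longleftrightarrow> (\<forall>Q \<in> Proj C E. \<forall>h \<in> mor C (Dom C i) Q. \<exists>h' \<in> mor C (Cod C i) Q. h' \<cdot> i = h)"

lemma presentation_biprod:
  assumes 1: "presentation K i P p M" and 2: "presentation K' i' P' p' M'"
    and K: "direct_sum C [K, K'] K''" and P: "direct_sum C [P, P'] P''" and M: "direct_sum C [M, M'] M''"
  obtains i'' p'' where "presentation K'' i'' P'' p'' M''"
    "extends_to_Proj i \<Longrightarrow> extends_to_Proj i' \<Longrightarrow> extends_to_Proj i''"
proof -
  obtain k1 k2 l1 l2 where bK: "biprod_maps K K' K'' k1 k2 l1 l2" using K direct_sum_pair_iff by meson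
  obtain a1 a2 b1 b2 where bP: "biprod_maps P P' P'' a1 a2 b1 b2" using P direct_sum_pair_iff by meson
  obtain m1 m2 n1 n2 where bM: "biprod_maps M M' M'' m1 m2 n1 n2" using M direct_sum_pair_iff by meson
  note I = presentationD[OF 1] and J = presentationD[OF 2]
  note b = biprod_maps_simps[OF bK] biprod_maps_simps[OF bP] biprod_maps_simps[OF bM]
  note r = I(4-14) J(4-14) b hom_simps
  let ?i = "a1 \<cdot> i \<cdot> l1 \<^bold>+ a2 \<cdot> i' \<cdot> l2" and ?p = "m1 \<cdot> p \<cdot> b1 \<^bold>+ m2 \<cdot> p' \<cdot> b2"
  have m: "?i \<in> mor C K'' P''" "?p \<in> mor C P'' M''" and z: "?p \<cdot> ?i = Zer C K'' M''"
    by (simp_all add: r)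
  have "is_kernel C ?i ?p"
  proof (rule is_kernelI[OF m z])
    fix D x assume x: "x \<in> mor C D P''" "?p \<cdot> x = Zer C D M''"
    then have D: "D \<in> Obj C" using mor_objs by blast
    have "n1 \<cdot> ?p \<cdot> x = p \<cdot> b1 \<cdot> x" "n2 \<cdot> ?p \<cdot> x = p' \<cdot> b2 \<cdot> x"
      using x(1) D by (simp_all add: r)
    then have 0: "p \<cdot> b1 \<cdot> x = Zer C D M" "p' \<cdot> b2 \<cdot> x = Zer C D M'"
      unfolding x(2) using D by (simp_all add: r)
    obtain u where u: "u \<in> mor C D K" "i \<cdot> u = b1 \<cdot> x"
      using kernel_factor[OF I(2), of "b1 \<cdot> x"] 0 x(1) D by (auto simp: r)
    obtain v where v: "v \<in> mor C D K'" "i' \<cdot> v = b2 \<cdot> x"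
      using kernel_factor[OF J(2), of "b2 \<cdot> x"] 0 x(1) D by (auto simp: r)
    have "?i \<cdot> (k1 \<cdot> u \<^bold>+ k2 \<cdot> v) = x"
      by (rule biprod_eqI'[OF bP]; use u v x(1) D in \<open>simp add: r\<close>)
    then show "\<exists>u\<in>mor C D K''. ?i \<cdot> u = x"
      using u v by (intro bexI[of _ "k1 \<cdot> u \<^bold>+ k2 \<cdot> v"]) (auto simp: r)
  next
    fix D u v assume u: "u \<in> mor C D K''" and v: "v \<in> mor C D K''" and e: "?i \<cdot> u = ?i \<cdot> v"
    then have D: "D \<in> Obj C" using mor_objs by blast
    have "b1 \<cdot> ?i \<cdot> w = i \<cdot> l1 \<cdot> w" "b2 \<cdot> ?i \<cdot> w = i' \<cdot> l2 \<cdot> w" if "w \<in> mor C D K''" for w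
      using that D by (simp_all add: r)
    then have "i \<cdot> l1 \<cdot> u = i \<cdot> l1 \<cdot> v" "i' \<cdot> l2 \<cdot> u = i' \<cdot> l2 \<cdot> v" using u v e by metis+
    then have "l1 \<cdot> u = l1 \<cdot> v" "l2 \<cdot> u = l2 \<cdot> v"
      using kernel_mono[OF I(2), of "l1 \<cdot> u" "l1 \<cdot> v"] kernel_mono[OF J(2), of "l2 \<cdot> u" "l2 \<cdot> v"] u v D
      by (auto simp: r)
    then show "u = v" by - (rule biprod_eqI'[OF bK]; use u v in \<open>simp add: mor_iff\<close>)
  qed
  moreover have "is_cokernel C ?p ?i"
  proof (rule is_cokernelI[OF m z])
    fix D x assume x: "x \<in> mor C P'' D" "x \<cdot> ?i = Zer C K'' D"
    then have D: "D \<in> Obj C" using mor_objs by blast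
    have "(x \<cdot> ?i) \<cdot> k1 = x \<cdot> a1 \<cdot> i" "(x \<cdot> ?i) \<cdot> k2 = x \<cdot> a2 \<cdot> i'"
      using x(1) D by (simp_all add: r)
    then have 0: "(x \<cdot> a1) \<cdot> i = Zer C K D" "(x \<cdot> a2) \<cdot> i' = Zer C K' D"
      unfolding x(2) using D x(1) by (simp_all add: r)
    obtain u where u: "u \<in> mor C M D" "u \<cdot> p = x \<cdot> a1"
      using cokernel_factor[OF I(3), of "x \<cdot> a1"] 0 x(1) D by (auto simp: r)
    obtain v where v: "v \<in> mor C M' D" "v \<cdot> p' = x \<cdot> a2"
      using cokernel_factor[OF J(3), of "x \<cdot> a2"] 0 x(1) D by (auto simp: r)
    have "(u \<cdot> n1 \<^bold>+ v \<cdot> n2) \<cdot> ?p = x"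
      by (rule biprod_eqI[OF bP]; use u v x(1) D in \<open>simp add: r\<close>)
    then show "\<exists>u\<in>mor C M'' D. u \<cdot> ?p = x"
      using u v by (intro bexI[of _ "u \<cdot> n1 \<^bold>+ v \<cdot> n2"]) (auto simp: r)
  next
    fix D u v assume u: "u \<in> mor C M'' D" and v: "v \<in> mor C M'' D" and e: "u \<cdot> ?p = v \<cdot> ?p"
    then have D: "D \<in> Obj C" using mor_objs by blast
    have "(w \<cdot> ?p) \<cdot> a1 = (w \<cdot> m1) \<cdot> p" "(w \<cdot> ?p) \<cdot> a2 = (w \<cdot> m2) \<cdot> p'" if "w \<in> mor C M'' D" for w
      using that D by (simp_all add: r)
    then have "(u \<cdot> m1) \<cdot> p = (v \<cdot> m1) \<cdot> p" "(u \<cdot> m2) \<cdot> p' = (v \<cdot> m2) \<cdot> p'" using u v e by metis+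
    then have "u \<cdot> m1 = v \<cdot> m1" "u \<cdot> m2 = v \<cdot> m2"
      using cokernel_epi[OF I(3), of "u \<cdot> m1" "v \<cdot> m1"] cokernel_epi[OF J(3), of "u \<cdot> m2" "v \<cdot> m2"] u v D
      by (auto simp: r)
    then show "u = v" by - (rule biprod_eqI[OF bM]; use u v in \<open>simp add: mor_iff\<close>)
  qed
  moreover have "\<exists>g \<in> mor C Q P''. ?p \<cdot> g = f" if QP: "Q \<in> Proj C E" and fm: "f \<in> mor C Q M''" for Q f
  proof -
    have Q: "Q \<in> Obj C" using QP Proj_Obj by auto
    obtain g where g: "g \<in> mor C Q P" "p \<cdot> g = n1 \<cdot> f"
      using presentation_lift[OF 1 QP, of "n1 \<cdot> f"] fm by (auto simp: r)
    obtain h where h: "h \<in> mor C Q P'" "p' \<cdot> h = n2 \<cdot> f"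
      using presentation_lift[OF 2 QP, of "n2 \<cdot> f"] fm by (auto simp: r)
    have "?p \<cdot> (a1 \<cdot> g \<^bold>+ a2 \<cdot> h) = f"
      by (rule biprod_eqI'[OF bM]; use g h fm Q in \<open>simp add: r\<close>)
    then show ?thesis using g h by (intro bexI[of _ "a1 \<cdot> g \<^bold>+ a2 \<cdot> h"]) (auto simp: r)
  qed
  ultimately have "presentation K'' ?i P'' ?p M''"
    using m Proj_biprod[OF I(1) J(1) P] unfolding presentation_def by blast
  moreover have "extends_to_Proj ?i" if ex: "extends_to_Proj i" "extends_to_Proj i'"
    unfolding extends_to_Proj_def
  proof (intro ballI)
    fix S h assume S: "S \<in> Proj C E" and "h \<in> mor C (Dom C ?i) S"
    then have h: "h \<in> mor C K'' S" using m(1) by (simp add: mor_iff)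
    have hk: "h \<cdot> k1 \<in> mor C (Dom C i) S" "h \<cdot> k2 \<in> mor C (Dom C i') S" using h by (simp_all add: r)
    obtain u where u: "u \<in> mor C (Cod C i) S" "u \<cdot> i = h \<cdot> k1"
      using ex(1) S hk(1) unfolding extends_to_Proj_def by blast
    obtain v where v: "v \<in> mor C (Cod C i') S" "v \<cdot> i' = h \<cdot> k2"
      using ex(2) S hk(2) unfolding extends_to_Proj_def by blast
    have So: "S \<in> Obj C" using S Proj_Obj by auto
    have "(u \<cdot> b1 \<^bold>+ v \<cdot> b2) \<cdot> ?i = h"
      by (rule biprod_eqI[OF bK]; use u v h So in \<open>simp add: r\<close>)
    moreover have "u \<cdot> b1 \<^bold>+ v \<cdot> b2 \<in> mor C (Cod C ?i) S" using u(1) v(1) by (simp add: r)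
    ultimately show "\<exists>h' \<in> mor C (Cod C ?i) S. h' \<cdot> ?i = h" by blast
  qed
  ultimately show ?thesis by (rule that)
qed

lemma presentation_trivial:
  assumes "P \<in> Proj C E" "zero_object C Z"
  shows "presentation P (Idn C P) P (Zer C P Z) Z"
proof -
  have o: "P \<in> Obj C" "Z \<in> Obj C" using assms Proj_Obj by (auto simp: zero_object_def)
  have z: "f = g" if "f \<in> mor C A Z" "g \<in> mor C A Z" for f g A
    using that assms(2) mor_objs unfolding zero_object_def by metis
  have z': "f = g" if "f \<in> mor C Z A" "g \<in> mor C Z A" for f g A
    using that assms(2) mor_objs unfolding zero_object_def by metis
  have "is_kernel C (Idn C P) (Zer C P Z)"
    by (rule is_kernelI[where K = P and P = P and M = Z]) (use o in \<open>auto simp: hom_simps\<close>)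
  moreover have "is_cokernel C (Zer C P Z) (Idn C P)"
  proof (rule is_cokernelI[where K = P and P = P and M = Z])
    show "\<exists>u\<in>mor C Z D. u \<cdot> Zer C P Z = x" if "x \<in> mor C P D" "x \<cdot> Idn C P = Zer C P D" for D x
      using that o mor_objs[OF that(1)] by (intro bexI[of _ "Zer C Z D"]) (auto simp: hom_simps)
  qed (use o z' in \<open>auto simp: hom_simps\<close>)
  moreover have "\<exists>g \<in> mor C Q P. Zer C P Z \<cdot> g = f" if "Q \<in> Proj C E" "f \<in> mor C Q Z" for Q f
    using o that(2) Proj_Obj[OF that(1)] z[of f Q "Zer C Q Z"] by (intro bexI[of _ "Zer C Q P"]) (auto simp: hom_simps)
  ultimately show ?thesis using assms(1) o unfolding presentation_def by (auto simp: arr_simps)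
qed

text \<open>The inclusion is composed with the isomorphism \<open>K' \<cong> K\<close>; the projection and its cokernel property stay.\<close>

lemma presentation_cong_kernel:
  assumes "presentation K i P p M" "isomorphic C K' K"
  obtains i' where "presentation K' i' P p M"
proof -
  note I = presentationD[OF assms(1)]
  obtain f g where f: "f \<in> mor C K' K" "g \<in> mor C K K'" "g \<cdot> f = Idn C K'" "f \<cdot> g = Idn C K"
    using assms(2) unfolding isomorphic_def by blast
  note r = I(4-14) hom_simps f(3,4) f(3,4)[THEN Cmp_reassoc]
  have o: "K' \<in> Obj C" using f mor_objs by blast
  have m: "i \<cdot> f \<in> mor C K' P" "p \<in> mor C P M" "p \<cdot> i \<cdot> f = Zer C K' M" using f(1) by (simp_all add: r)
  have "is_kernel C (i \<cdot> f) p"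
  proof (rule is_kernelI[OF m])
    fix D x assume x: "x \<in> mor C D P" "p \<cdot> x = Zer C D M"
    then obtain u where u: "u \<in> mor C D K" "i \<cdot> u = x"
      using kernel_factor[OF I(2), of x] by (auto simp: r)
    then have "g \<cdot> u \<in> mor C D K'" "(i \<cdot> f) \<cdot> g \<cdot> u = x" using f(1,2) by (auto simp: r)
    then show "\<exists>u\<in>mor C D K'. (i \<cdot> f) \<cdot> u = x" by blast
  next
    fix D u v assume u: "u \<in> mor C D K'" and v: "v \<in> mor C D K'" and e: "(i \<cdot> f) \<cdot> u = (i \<cdot> f) \<cdot> v"
    have "f \<cdot> u = f \<cdot> v" by (rule kernel_mono[OF I(2)]) (use u v e f(1) in \<open>auto simp: r\<close>)
    then have "g \<cdot> f \<cdot> u = g \<cdot> f \<cdot> v" by simp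
    then show "u = v" using u v f(1,2) by (simp add: r)
  qed
  moreover have "is_cokernel C p (i \<cdot> f)"
  proof (rule is_cokernelI[OF m])
    fix D x assume x: "x \<in> mor C P D" "x \<cdot> i \<cdot> f = Zer C K' D"
    then have D: "D \<in> Obj C" using mor_objs by blast
    have "x \<cdot> i = (x \<cdot> i \<cdot> f) \<cdot> g" using x(1) f(1,2) by (simp add: r)
    also have "\<dots> = Zer C K D" unfolding x(2) using f(2) D o by (simp add: r)
    finally obtain u where "u \<in> mor C M D" "u \<cdot> p = x"
      using cokernel_factor[OF I(3), of x] x(1) by (auto simp: r)
    then show "\<exists>u\<in>mor C M D. u \<cdot> p = x" by blast
  next
    fix D u v assume u: "u \<in> mor C M D" and v: "v \<in> mor C M D" and e: "u \<cdot> p = v \<cdot> p"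
    show "u = v" by (rule cokernel_epi[OF I(3)]) (use u v e in \<open>auto simp: r\<close>)
  qed
  ultimately have "presentation K' (i \<cdot> f) P p M"
    using assms(1) m(1) unfolding presentation_def by blast
  then show ?thesis by (rule that)
qed

text \<open>
  The identity of \<open>X\<close> factors through \<open>M\<close> up to a map that factors through a projective \<open>R\<close>: modulo
  projectives, \<open>X\<close> is a retract of \<open>M\<close>.
\<close>

definition stable_retract where
  "stable_retract X M \<longleftrightarrow> (\<exists>f \<in> mor C X M. \<exists>g \<in> mor C M X. \<exists>R \<in> Proj C E. \<exists>a \<in> mor C X R. \<exists>b \<in> mor C R X.
     g \<cdot> f \<^bold>+ b \<cdot> a = Idn C X)"

lemma retract_stable_retract:
  assumes "f \<in> mor C X M" "g \<in> mor C M X" "g \<cdot> f = Idn C X"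
  shows "stable_retract X M"
proof -
  obtain Z where Z: "Z \<in> Proj C E" "Z \<in> Obj C" using ex_zero_object Proj_zero Proj_Obj by blast
  have o: "X \<in> Obj C" using assms mor_objs by blast
  have "g \<cdot> f \<^bold>+ Zer C Z X \<cdot> Zer C X Z = Idn C X" using assms o Z by (simp add: hom_simps)
  moreover have "Zer C X Z \<in> mor C X Z" "Zer C Z X \<in> mor C Z X" using o Z by (simp_all add: arr_simps)
  ultimately show ?thesis unfolding stable_retract_def using assms(1,2) Z(1) by blast
qed

text \<open>
  Lift \<open>f : X \<rightarrow> M\<close> and \<open>g : M \<rightarrow> X\<close> to the projective middle terms. As \<open>1 - g f\<close> factors through a
  projective, it lifts to a map that differs from \<open>1 - g\<^sub>1 f\<^sub>1\<close> by some \<open>j w\<close>; restricting to the kernels gives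
  \<open>1 - g\<^sub>2 f\<^sub>2 = w j\<close>, which factors through \<open>Q\<close>.
\<close>

lemma stable_retract_syzygy:
  assumes 1: "presentation K i P p M" and 2: "presentation L j Q q X" and s: "stable_retract X M"
  shows "stable_retract L K" "extends_to_Proj i \<Longrightarrow> extends_to_Proj j"
proof -
  note I = presentationD[OF 1] and J = presentationD[OF 2]
  obtain f g R a b where fg: "f \<in> mor C X M" "g \<in> mor C M X" and R: "R \<in> Proj C E"
    and ab: "a \<in> mor C X R" "b \<in> mor C R X" and e: "g \<cdot> f \<^bold>+ b \<cdot> a = Idn C X"
    using s unfolding stable_retract_def by blast
  have Ro: "R \<in> Obj C" using R Proj_Obj by auto
  note r = I(4-14) J(4-14) Ro hom_simps
  obtain f1 where f1: "f1 \<in> mor C Q P" "p \<cdot> f1 = f \<cdot> q" 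
    using presentation_lift[OF 1 J(1), of "f \<cdot> q"] fg by (auto simp: r)
  obtain g1 where g1: "g1 \<in> mor C P Q" "q \<cdot> g1 = g \<cdot> p" 
    using presentation_lift[OF 2 I(1), of "g \<cdot> p"] fg by (auto simp: r)
  obtain b1 where b1: "b1 \<in> mor C R Q" "q \<cdot> b1 = b" 
    using presentation_lift[OF 2 R ab(2)] by blast
  note re = f1(2) g1(2) b1(2) f1(2)[THEN Cmp_reassoc] g1(2)[THEN Cmp_reassoc] b1(2)[THEN Cmp_reassoc]
  obtain f2 where f2: "f2 \<in> mor C L K" "i \<cdot> f2 = f1 \<cdot> j"
    using kernel_factor[OF I(2), of "f1 \<cdot> j"] f1(1) fg by (auto simp: r re)
  obtain g2 where g2: "g2 \<in> mor C K L" "j \<cdot> g2 = g1 \<cdot> i"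
    using kernel_factor[OF J(2), of "g1 \<cdot> i"] g1(1) fg by (auto simp: r re)
  have ba: "b \<cdot> a = Idn C X \<^bold>+ \<^bold>- (g \<cdot> f)"
    using Add_eq_imp(2)[OF _ _ e] fg ab by (auto simp: r)
  obtain w where w: "w \<in> mor C Q L" "j \<cdot> w = Idn C Q \<^bold>+ \<^bold>- (g1 \<cdot> f1) \<^bold>+ \<^bold>- (b1 \<cdot> a \<cdot> q)"
    using kernel_factor[OF J(2), of "Idn C Q \<^bold>+ \<^bold>- (g1 \<cdot> f1) \<^bold>+ \<^bold>- (b1 \<cdot> a \<cdot> q)"] f1(1) g1(1) b1(1) ab fg
    by (auto simp: r re Cmp_reassoc[OF ba] hom_ac)
  have l: "g2 \<cdot> f2 \<^bold>+ w \<cdot> j = Idn C L"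
    by (rule kernel_mono[OF J(2)])
      (use f2(1) g2(1) w(1) f1(1) g1(1) b1(1) ab fg in \<open>simp_all add: r hom_ac f2(2) g2(2) w(2)
        f2(2)[THEN Cmp_reassoc] g2(2)[THEN Cmp_reassoc] w(2)[THEN Cmp_reassoc]\<close>)
  then show "stable_retract L K"
    unfolding stable_retract_def using f2(1) g2(1) w(1) J by (blast intro: mor_iff[THEN iffD2])
  assume ex: "extends_to_Proj i"
  show "extends_to_Proj j"
    unfolding extends_to_Proj_def
  proof (intro ballI)
    fix S h assume S: "S \<in> Proj C E" and h: "h \<in> mor C (Dom C j) S"
    have hm: "h \<in> Arr C" "Dom C h = L" "Cod C h = S" using h by (auto simp: r)
    have "h \<cdot> g2 \<in> mor C (Dom C i) S" using g2(1) hm I(5) by (simp add: arr_simps)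
    then obtain h' where h': "h' \<in> mor C P S" "h' \<cdot> i = h \<cdot> g2"
      using ex S I(6) unfolding extends_to_Proj_def by blast
    have "(h' \<cdot> f1 \<^bold>+ h \<cdot> w) \<cdot> j = h' \<cdot> i \<cdot> f2 \<^bold>+ h \<cdot> w \<cdot> j"
      using h'(1) f1(1) hm w(1) f2 by (simp add: r)
    also have "\<dots> = h \<cdot> (g2 \<cdot> f2 \<^bold>+ w \<cdot> j)"
      using h' f1(1) hm w(1) f2(1) g2(1) by (simp add: r Cmp_reassoc[OF h'(2)])
    also have "\<dots> = h" unfolding l using hm by (simp add: r)
    finally show "\<exists>h'\<in>mor C (Cod C j) S. h' \<cdot> j = h"
      using h'(1) f1(1) hm w(1) by (intro bexI[of _ "h' \<cdot> f1 \<^bold>+ h \<cdot> w"]) (auto simp: r)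
  qed
qed

end

section \<open>Vanishing of Ext against projectives\<close>

context exact_category
begin

text \<open>
  By dimension shifting, \<open>perp_upto n M\<close> says that \<open>Ext\<^sup>i(M, Q) = 0\<close> for \<open>1 \<le> i \<le> n\<close> and projective \<open>Q\<close>. It asks
  for one suitable presentation in each step; if it holds for all \<open>n\<close>, every presentation is suitable
  (\<open>perp_presentation\<close>).
\<close>

primrec perp_upto :: "nat \<Rightarrow> 'o \<Rightarrow> bool" where
  "perp_upto 0 M \<longleftrightarrow> M \<in> Obj C"
| "perp_upto (Suc n) M \<longleftrightarrow>
     (\<exists>K i P p. presentation K i P p M \<and> extends_to_Proj i \<and> perp_upto n K)"

definition perp :: "'o \<Rightarrow> bool" where "perp M \<longleftrightarrow> (\<forall>n. perp_upto n M)"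

lemma perp_Obj: "perp M \<Longrightarrow> M \<in> Obj C"
  unfolding perp_def by (metis perp_upto.simps(1))

lemma split_presentation_Proj:
  assumes "presentation K i P p M" "r \<in> mor C P K" "r \<cdot> i = Idn C K"
  shows "K \<in> Proj C E" "M \<in> Proj C E"
proof -
  note I = presentationD[OF assms(1)]
  note r = I(4-14) hom_simps
  show "K \<in> Proj C E" using Proj_retract[OF I(1) _ assms(2,3)] I by (auto simp: mor_iff)
  obtain s where s: "s \<in> mor C M P" "s \<cdot> p = Idn C P \<^bold>+ \<^bold>- (i \<cdot> r)"
    using cokernel_factor[OF I(3), of "Idn C P \<^bold>+ \<^bold>- (i \<cdot> r)"] assms(2,3) by (auto simp: r)
  have "p \<cdot> s = Idn C M"
    by (rule cokernel_epi[OF I(3)]) (use s assms(2) in \<open>auto simp: r\<close>)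
  then show "M \<in> Proj C E" using Proj_retract[OF I(1) s(1)] I by (auto simp: mor_iff)
qed

lemma presentation_of_Proj_splits:
  assumes "presentation K i P p M" "M \<in> Proj C E"
  obtains r where "r \<in> mor C P K" "r \<cdot> i = Idn C K"
proof -
  note I = presentationD[OF assms(1)]
  note r = I(4-14) hom_simps
  obtain s where s: "s \<in> mor C M P" "p \<cdot> s = Idn C M"
    using presentation_lift[OF assms, of "Idn C M"] I by (auto simp: r)
  obtain t where t: "t \<in> mor C P K" "i \<cdot> t = Idn C P \<^bold>+ \<^bold>- (s \<cdot> p)"
    using kernel_factor[OF I(2), of "Idn C P \<^bold>+ \<^bold>- (s \<cdot> p)"] s by (auto simp: r Cmp_reassoc[OF s(2)])
  have "t \<cdot> i = Idn C K"
    by (rule kernel_mono[OF I(2)]) (use t s(1) in \<open>auto simp: r Cmp_reassoc[OF t(2)]\<close>)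
  with t that show ?thesis by blast
qed

lemma extends_to_Proj_Idn: "P \<in> Obj C \<Longrightarrow> extends_to_Proj (Idn C P)"
  unfolding extends_to_Proj_def by (auto simp: hom_simps intro!: bexI)

lemma perp_biprod: assumes "perp A" "perp B" "direct_sum C [A, B] X" shows "perp X"
proof -
  have "perp_upto n X" if "perp_upto n A" "perp_upto n B" "direct_sum C [A, B] X" for n A B X
    using that
  proof (induction n arbitrary: A B X)
    case 0 then show ?case using biprod_objs by auto
  next
    case (Suc n)
    obtain K i P p where 1: "presentation K i P p A" "extends_to_Proj i" "perp_upto n K" using Suc.prems by auto
    obtain K' i' P' p' where 2: "presentation K' i' P' p' B" "extends_to_Proj i'" "perp_upto n K'" using Suc.prems by auto
    note o = presentationD(10,11)[OF 1(1)] presentationD(10,11)[OF 2(1)]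
    obtain L where L: "direct_sum C [K, K'] L" using o ex_direct_sum by blast
    obtain Q where Q: "direct_sum C [P, P'] Q" using o ex_direct_sum by blast
    obtain j q where "presentation L j Q q X" "extends_to_Proj j"
      using presentation_biprod[OF 1(1) 2(1) L Q Suc.prems(3)] 1(2) 2(2) by metis
    moreover have "perp_upto n L" using Suc.IH 1(3) 2(3) L by blast
    ultimately show ?case by auto
  qed
  then show ?thesis using assms unfolding perp_def by blast
qed

lemma perp_zero: assumes "zero_object C Z" shows "perp Z"
proof -
  have "perp_upto n Z" for n
  proof (induction n)
    case (Suc n)
    have "presentation Z (Idn C Z) Z (Zer C Z Z) Z" using presentation_trivial Proj_zero assms by blast
    moreover have "extends_to_Proj (Idn C Z)" using assms extends_to_Proj_Idn by (auto simp: zero_object_def)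
    ultimately show ?case using Suc by auto
  qed (use assms in \<open>auto simp: zero_object_def\<close>)
  then show ?thesis by (simp add: perp_def)
qed

lemma perp_direct_sum: assumes "direct_sum C Xs X" "\<And>A. A \<in> set Xs \<Longrightarrow> perp A" shows "perp X"
  using assms(1)
proof (induction rule: direct_sum_induct)
  case (add A B X)
  then show ?case using perp_biprod assms(2) by blast
qed (rule perp_zero)

end

context exact_IT_context
begin

lemma syzygy_presentation: assumes "is_syzygy C E M K"
  obtains i P p where "presentation K i P p M" "(i, p) \<in> E"
  using assms E_presentation unfolding is_syzygy_def by blast

lemma Syz_is_syzygy: assumes "M \<in> Obj C" shows "is_syzygy C E M (Syz C E M)"
proof -
  obtain P p i where P: "P \<in> Proj C E" and p: "p \<in> mor C P M" and ip: "(i, p) \<in> E"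
    using enough_projectives assms unfolding enough_projectives_def adm_epic_def by blast
  have "i \<in> mor C (Dom C i) P" using E_arr[OF ip] p by (auto simp: mor_iff)
  then have "is_syzygy C E M (Dom C i)" unfolding is_syzygy_def using P p ip by blast
  then show ?thesis unfolding Syz_def by (rule someI)
qed

lemma Syz_presentation: assumes "M \<in> Obj C"
  obtains i P p where "presentation (Syz C E M) i P p M"
  using syzygy_presentation[OF Syz_is_syzygy[OF assms]] by metis

lemma Syz_Obj: "M \<in> Obj C \<Longrightarrow> Syz C E M \<in> Obj C"
  using Syz_presentation presentationD(10) by metis

lemma stable_retract_refl: "M \<in> Obj C \<Longrightarrow> stable_retract M M"
  using retract_stable_retract[of "Idn C M" M M "Idn C M"] by (simp add: hom_simps)

lemma stable_retract_Obj: "stable_retract X M \<Longrightarrow> X \<in> Obj C"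
  unfolding stable_retract_def using mor_objs by blast

lemma perp_stable_retract: assumes "perp M" "stable_retract X M" shows "perp X"
proof -
  have "perp_upto n X" if "perp_upto n M" "stable_retract X M" for n M X
    using that
  proof (induction n arbitrary: M X)
    case 0
    then show ?case using stable_retract_Obj by simp
  next
    case (Suc n)
    then obtain K i P p where 1: "presentation K i P p M" "extends_to_Proj i" "perp_upto n K" by auto
    obtain j Q q where 2: "presentation (Syz C E X) j Q q X"
      using Syz_presentation stable_retract_Obj Suc.prems(2) by metis
    show ?case using stable_retract_syzygy[OF 1(1) 2 Suc.prems(2)] 1 2 Suc.IH by auto
  qed
  then show ?thesis using assms unfolding perp_def by blast
qed

lemma perp_presentation: assumes "perp M" "presentation K i P p M"
  shows "extends_to_Proj i" "perp K"
proof -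
  have "extends_to_Proj i \<and> perp_upto n K" for n
  proof -
    have "perp_upto (Suc n) M" using assms by (simp only: perp_def)
    then obtain L j Q q where 1: "presentation L j Q q M" "extends_to_Proj j" "perp_upto n L" by auto
    have s: "stable_retract M M" using assms stable_retract_refl perp_Obj by blast
    note st = stable_retract_syzygy[OF 1(1) assms(2) s]
    have "perp_upto n K"
      using 1(3) st(1)
    proof (induction n arbitrary: L K)
      case 0
      then show ?case using stable_retract_Obj by simp
    next
      case (Suc n)
      then obtain K1 i P p where 1: "presentation K1 i P p L" "extends_to_Proj i" "perp_upto n K1" by auto
      obtain j Q q where 2: "presentation (Syz C E K) j Q q K"
        using Syz_presentation stable_retract_Obj Suc.prems(2) by metis
      show ?case using stable_retract_syzygy[OF 1(1) 2 Suc.prems(2)] 1 2 Suc.IH by auto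
    qed
    then show ?thesis using st(2) 1(2) by blast
  qed
  then show "extends_to_Proj i" "perp K" by (auto simp: perp_def)
qed

lemma perp_Syz: "perp M \<Longrightarrow> perp (Syz C E M)"
  using Syz_presentation perp_presentation(2) perp_Obj by metis

lemma resolution_exists: assumes "M \<in> Obj C" shows "\<exists>P d. proj_resolution C E M P d"
proof -
  define K where "K = (\<lambda>n. (Syz C E ^^ n) M)"
  have K: "K n \<in> Obj C" "K (Suc n) = Syz C E (K n)" "K 0 = M" for n
    unfolding K_def using assms by (induction n) (auto intro: Syz_Obj)
  have "\<forall>n. \<exists>P i p. P \<in> Proj C E \<and> (i, p) \<in> E \<and> i \<in> mor C (K (Suc n)) P \<and> p \<in> mor C P (K n)"
    using Syz_is_syzygy K(1) unfolding K(2) is_syzygy_def by blast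
  then obtain P i p where
    "\<And>n. P n \<in> Proj C E \<and> (i n, p n) \<in> E \<and> i n \<in> mor C (K (Suc n)) (P n) \<and> p n \<in> mor C (P n) (K n)"
    by metis
  then have "proj_resolution C E M P (\<lambda>n. i n \<cdot> p (Suc n))"
    unfolding proj_resolution_def using K(3) by blast
  then show ?thesis by blast
qed

text \<open>
  For a resolution spliced from presentations with kernels \<open>K (n + 1)\<close>, a cocycle in degree \<open>n + 1\<close> is a map on
  \<open>K (n + 1)\<close>, and it is a coboundary when that map extends to \<open>P n\<close>.
\<close>

lemma Ext_Suc_trivial_iff:
  assumes "M \<in> Obj C"
  obtains K i P p where "K 0 = M" "\<And>n. presentation (K (Suc n)) (i n) (P n) (p n) (K n)"
    "\<And>n B. B \<in> Obj C \<Longrightarrow> trivial_group (Ext C E (Suc n) M B) \<longleftrightarrow>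
       (\<forall>f \<in> mor C (K (Suc n)) B. \<exists>h \<in> mor C (P n) B. h \<cdot> i n = f)"
proof -
  obtain P d where Pd: "(SOME (P, d). proj_resolution C E M P d) = (P, d)" by fastforce
  have "proj_resolution C E M P d"
    using someI_ex[of "\<lambda>(P, d). proj_resolution C E M P d"] resolution_exists[OF assms] Pd by auto
  then obtain K i p where K0: "K 0 = M" and
    res: "\<And>n. P n \<in> Proj C E \<and> (i n, p n) \<in> E \<and>
             i n \<in> mor C (K (Suc n)) (P n) \<and> p n \<in> mor C (P n) (K n) \<and> d n = i n \<cdot> p (Suc n)"
    unfolding proj_resolution_def by blast
  have pres: "presentation (K (Suc n)) (i n) (P n) (p n) (K n)" for n
    using res E_presentation by blast
  have "trivial_group (Ext C E (Suc n) M B) \<longleftrightarrow>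
       (\<forall>f \<in> mor C (K (Suc n)) B. \<exists>h \<in> mor C (P n) B. h \<cdot> i n = f)" if B: "B \<in> Obj C" for n B
  proof -
    note I0 = presentationD[OF pres[of n]] and I1 = presentationD[OF pres[of "Suc n"]]
      and I2 = presentationD[OF pres[of "Suc (Suc n)"]]
    note r = I0(4-14) I1(4-14) I2(4-14) B hom_simps
    have d: "d n = i n \<cdot> p (Suc n)" "d (Suc n) = i (Suc n) \<cdot> p (Suc (Suc n))" using res by auto
    let ?G = "Hom C (P (Suc n)) B" and ?Z = "cocycles C P d (Suc n) B" and ?N = "coboundaries C P d (Suc n) B"
    have Z: "?Z = {f \<in> mor C (P (Suc n)) B. f \<cdot> d (Suc n) = Zer C (P (Suc (Suc n))) B}"
      by (simp add: cocycles_def kernel_def)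
    have N: "?N = (\<lambda>f. f \<cdot> d n) ` mor C (P n) B" by (simp add: coboundaries_def)
    have Ext: "Ext C E (Suc n) M B = ?G\<lparr>carrier := ?Z\<rparr> Mod ?N" unfolding Ext_def Pd by simp
    interpret G: comm_group ?G by (rule Hom_comm_group) (use I1 B in auto)
    have dd: "d n \<cdot> d (Suc n) = Zer C (P (Suc (Suc n))) (P n)" unfolding d by (simp add: r)
    interpret H0: group_hom "Hom C (P n) B" ?G "\<lambda>f. f \<cdot> d n"
      by (intro group_hom.intro group_hom_axioms.intro Hom_group homI)
        (use I0 I1 B d in \<open>auto simp: r\<close>)
    interpret H1: group_hom ?G "Hom C (P (Suc (Suc n))) B" "\<lambda>f. f \<cdot> d (Suc n)"
      by (intro group_hom.intro group_hom_axioms.intro Hom_group homI)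
        (use I1 I2 B d in \<open>auto simp: r\<close>)
    have subZ: "subgroup ?Z ?G" unfolding cocycles_def by (rule H1.subgroup_kernel)
    have "subgroup ((\<lambda>f. f \<cdot> d n) ` carrier (Hom C (P n) B)) ?G"
      by (rule H0.img_is_subgroup)
    then have subN: "subgroup ?N ?G" by (simp add: N)
    have NZ: "?N \<subseteq> ?Z" unfolding N Z using d dd by (auto simp: r)
    have subNZ: "subgroup ?N (?G\<lparr>carrier := ?Z\<rparr>)" 
      using G.subgroup_incl[OF subN subZ NZ] .
    interpret Zg: comm_group "?G\<lparr>carrier := ?Z\<rparr>"
      by (rule group.group_comm_groupI[OF G.subgroup_imp_group[OF subZ]]) (use subgroup.subset[OF subZ] G.m_comm in auto)
    have grp: "group (?G\<lparr>carrier := ?Z\<rparr> Mod ?N)"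
      using Zg.abelian_FactGroup[OF subNZ] by (simp add: comm_group_def)
    have "trivial_group (Ext C E (Suc n) M B) \<longleftrightarrow> ?Z \<subseteq> ?N"
    proof
      assume "trivial_group (Ext C E (Suc n) M B)"
      then have "carrier (?G\<lparr>carrier := ?Z\<rparr> Mod ?N) = {?N}" unfolding Ext trivial_group_def by simp
      then have c: "?N #>\<^bsub>?G\<lparr>carrier := ?Z\<rparr>\<^esub> z = ?N" if "z \<in> ?Z" for z
        using that unfolding carrier_FactGroup by (auto simp: image_def)
      show "?Z \<subseteq> ?N"
      proof
        fix z assume z: "z \<in> ?Z"
        then have "z \<in> ?N #>\<^bsub>?G\<lparr>carrier := ?Z\<rparr>\<^esub> z" using Zg.rcos_self[OF _ subNZ, of z] by simp
        then show "z \<in> ?N" using c[OF z] by simp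
      qed
    next
      assume "?Z \<subseteq> ?N"
      then have "?N #>\<^bsub>?G\<lparr>carrier := ?Z\<rparr>\<^esub> z = ?N" if "z \<in> ?Z" for z
        using Zg.coset_join2[OF _ subNZ, of z] that by auto
      moreover have "?Z \<noteq> {}" using subgroup.one_closed[OF subZ] by auto
      ultimately have "carrier (?G\<lparr>carrier := ?Z\<rparr> Mod ?N) = {?N}" unfolding carrier_FactGroup by auto
      then show "trivial_group (Ext C E (Suc n) M B)" unfolding Ext trivial_group_def using grp by simp
    qed
    also have "\<dots> \<longleftrightarrow> (\<forall>f \<in> mor C (K (Suc n)) B. \<exists>h \<in> mor C (P n) B. h \<cdot> i n = f)"
    proof
      assume ZN: "?Z \<subseteq> ?N"
      show "\<forall>f \<in> mor C (K (Suc n)) B. \<exists>h \<in> mor C (P n) B. h \<cdot> i n = f"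
      proof
        fix f assume f: "f \<in> mor C (K (Suc n)) B"
        then have "f \<cdot> p (Suc n) \<in> ?Z" unfolding Z d by (auto simp: r)
        then obtain h where h: "h \<in> mor C (P n) B" "f \<cdot> p (Suc n) = h \<cdot> d n" using ZN N by blast
        have "h \<cdot> i n = f" by (rule cokernel_epi[OF I1(3)]) (use h f in \<open>auto simp: r d\<close>)
        then show "\<exists>h \<in> mor C (P n) B. h \<cdot> i n = f" using h by blast
      qed
    next
      assume ex: "\<forall>f \<in> mor C (K (Suc n)) B. \<exists>h \<in> mor C (P n) B. h \<cdot> i n = f"
      show "?Z \<subseteq> ?N"
      proof
        fix z assume "z \<in> ?Z"
        then have z: "z \<in> mor C (P (Suc n)) B" "z \<cdot> i (Suc n) \<cdot> p (Suc (Suc n)) = Zer C (P (Suc (Suc n))) B"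
          unfolding Z d by auto
        have "z \<cdot> i (Suc n) = Zer C (K (Suc (Suc n))) B"
          by (rule cokernel_epi[OF I2(3)]) (use z in \<open>auto simp: r\<close>)
        then obtain f where f: "f \<in> mor C (K (Suc n)) B" "f \<cdot> p (Suc n) = z"
          using cokernel_factor[OF I1(3), of z] z(1) by (auto simp: r)
        obtain h where h: "h \<in> mor C (P n) B" "h \<cdot> i n = f" using ex f(1) by blast
        have "h \<cdot> d n = z" using h(1) by (simp add: d r flip: f(2) h(2))
        then show "z \<in> ?N" using h(1) N by blast
      qed
    qed
    finally show ?thesis .
  qed
  with K0 pres that show ?thesis by blast
qed

lemma left_perp_imp_perp: assumes "M \<in> left_perp C E (Proj C E)" shows "perp M"
proof -
  have M: "M \<in> Obj C" "\<And>B n. B \<in> Proj C E \<Longrightarrow> trivial_group (Ext C E (Suc n) M B)"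
    using assms by (auto simp: left_perp_def)
  obtain K i P p where K: "K 0 = M" "\<And>n. presentation (K (Suc n)) (i n) (P n) (p n) (K n)"
    and ex: "\<And>n B. B \<in> Obj C \<Longrightarrow> trivial_group (Ext C E (Suc n) M B) \<longleftrightarrow>
       (\<forall>f \<in> mor C (K (Suc n)) B. \<exists>h \<in> mor C (P n) B. h \<cdot> i n = f)"
    using Ext_Suc_trivial_iff[OF M(1)] by metis
  have "extends_to_Proj (i n)" for n
    unfolding extends_to_Proj_def using ex M(2) Proj_Obj presentationD(5,6)[OF K(2)[of n]] by simp
  then have "perp_upto n (K m)" for n m
    by (induction n arbitrary: m) (use K(2) presentationD(12) in \<open>auto, blast+\<close>)
  then show ?thesis using K(1) unfolding perp_def by metis
qed

text \<open>
  Finite projective dimension makes some \<open>K (n + 1) \<rightarrow> P n\<close> split, so \<open>K (n + 1)\<close> is projective; then the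
  identity of \<open>K (n + 1)\<close> is a map to a projective, and the vanishing of Ext splits one presentation after
  the other on the way down to \<open>K 0\<close>.
\<close>

lemma perp_finite_pd_imp_Proj: assumes "perp M" "pd C E M < \<infinity>" shows "M \<in> Proj C E"
proof -
  obtain K i P p where K: "K 0 = M" "\<And>n. presentation (K (Suc n)) (i n) (P n) (p n) (K n)"
    and ex: "\<And>n B. B \<in> Obj C \<Longrightarrow> trivial_group (Ext C E (Suc n) M B) \<longleftrightarrow>
       (\<forall>f \<in> mor C (K (Suc n)) B. \<exists>h \<in> mor C (P n) B. h \<cdot> i n = f)"
    using Ext_Suc_trivial_iff[OF perp_Obj[OF assms(1)]] by metis
  have perp: "perp (K n)" for n by (induction n) (use K(1) assms(1) perp_presentation(2)[OF _ K(2)] in auto)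
  have split: "K n \<in> Proj C E" "K (Suc n) \<in> Proj C E" 
    if ext: "\<forall>f \<in> mor C (K (Suc n)) (K (Suc n)). \<exists>h \<in> mor C (P n) (K (Suc n)). h \<cdot> i n = f" for n
  proof -
    have "Idn C (K (Suc n)) \<in> mor C (K (Suc n)) (K (Suc n))" using perp_Obj[OF perp] Idn_in_mor by blast
    then obtain r where "r \<in> mor C (P n) (K (Suc n))" "r \<cdot> i n = Idn C (K (Suc n))" using ext by blast
    then show "K n \<in> Proj C E" "K (Suc n) \<in> Proj C E" using split_presentation_Proj[OF K(2)] by auto
  qed
  have "{enat n | n. \<forall>j > n. \<forall>Z \<in> Obj C. trivial_group (Ext C E j M Z)} \<noteq> {}"
  proof
    assume "{enat n | n. \<forall>j > n. \<forall>Z \<in> Obj C. trivial_group (Ext C E j M Z)} = {}"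
    then show False using assms(2) unfolding pd_def by (simp add: Inf_enat_def)
  qed
  then obtain n where "\<forall>j > n. \<forall>Z \<in> Obj C. trivial_group (Ext C E j M Z)" by blast
  then have "trivial_group (Ext C E (Suc n) M (K (Suc n)))" using perp_Obj[OF perp] by auto
  then have n: "K (Suc n) \<in> Proj C E" using split(2) ex perp_Obj[OF perp] by blast
  have down: "K m \<in> Proj C E" if "K (Suc m) \<in> Proj C E" for m
    using split(1)[of m] that perp_presentation(1)[OF perp K(2), of m] presentationD(5,6)[OF K(2)[of m]]
    unfolding extends_to_Proj_def by simp
  have "K 0 \<in> Proj C E" using n by (induction n) (auto dest: down)
  then show ?thesis using K by simp
qed

lemma Proj_pd: assumes "M \<in> Proj C E" shows "pd C E M = 0"
proof -
  obtain K i P p where K: "K 0 = M" "\<And>n. presentation (K (Suc n)) (i n) (P n) (p n) (K n)"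
    and ex: "\<And>n B. B \<in> Obj C \<Longrightarrow> trivial_group (Ext C E (Suc n) M B) \<longleftrightarrow>
       (\<forall>f \<in> mor C (K (Suc n)) B. \<exists>h \<in> mor C (P n) B. h \<cdot> i n = f)"
    using Ext_Suc_trivial_iff[OF Proj_Obj[OF assms(1)]] by metis
  have PK: "K n \<in> Proj C E" for n
  proof (induction n)
    case (Suc n)
    obtain r where "r \<in> mor C (P n) (K (Suc n))" "r \<cdot> i n = Idn C (K (Suc n))"
      using presentation_of_Proj_splits[OF K(2) Suc] by blast
    then show ?case using split_presentation_Proj(1)[OF K(2)] by blast
  qed (use assms K in simp)
  have "trivial_group (Ext C E (Suc n) M Z)" if Z: "Z \<in> Obj C" for n Z
  proof -
    note I = presentationD[OF K(2)[of n]]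
    obtain r where r: "r \<in> mor C (P n) (K (Suc n))" "r \<cdot> i n = Idn C (K (Suc n))"
      using presentation_of_Proj_splits[OF K(2) PK] by blast
    have "\<exists>h \<in> mor C (P n) Z. h \<cdot> i n = f" if f: "f \<in> mor C (K (Suc n)) Z" for f
      using f r I(4-12) by (intro bexI[of _ "f \<cdot> r"]) (auto simp: hom_simps)
    then show ?thesis using ex Z by blast
  qed
  then have "\<forall>j > 0. \<forall>Z \<in> Obj C. trivial_group (Ext C E j M Z)" by (metis gr0_conv_Suc)
  then have "enat 0 \<in> {enat n | n. \<forall>j > n. \<forall>Z \<in> Obj C. trivial_group (Ext C E j M Z)}" by blast
  then have "pd C E M \<le> enat 0" unfolding pd_def by (rule Inf_lower)
  then show ?thesis by (simp add: zero_enat_def[symmetric])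
qed

lemma perp_add_class: assumes "perp M" "X \<in> add_class C M" shows "perp X"
proof -
  obtain n Y where Y: "direct_sum C (replicate n M) Y" "direct_summand C X Y"
    using assms(2) by (auto simp: add_class_def)
  have "perp Y" using perp_direct_sum[OF Y(1)] assms(1) by auto
  moreover obtain B where "direct_sum C [X, B] Y" using Y by (auto simp: direct_summand_def)
  then have "stable_retract X Y" 
    using retract_stable_retract unfolding direct_sum_pair_iff biprod_maps_def by blast
  ultimately show ?thesis by (rule perp_stable_retract)
qed

lemma perp_fpd_add_class: assumes "perp M" shows "fpd C E (add_class C M) = 0"
proof -
  have "pd C E X = 0" if "X \<in> add_class C M" "pd C E X < \<infinity>" for X
    using that assms perp_add_class perp_finite_pd_imp_Proj Proj_pd by blast
  then have "\<forall>x \<in> {pd C E X | X. X \<in> add_class C M \<and> pd C E X < \<infinity>}. x \<le> 0" by auto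
  then have "fpd C E (add_class C M) \<le> 0" unfolding fpd_def by (meson Sup_least)
  then show ?thesis by simp
qed

end

section \<open>Equality of classes in the Grothendieck group\<close>

context exact_IT_context
begin

abbreviation F where "F \<equiv> free_on_iso_classes C"
abbreviation R where "R \<equiv> K_relations C E"
abbreviation cls where "cls \<equiv> iso_class C"
abbreviation mult_iso (infixl "\<star>" 70) where "x \<star> y \<equiv> x \<otimes>\<^bsub>iso_monoid\<^esub> y"

lemma F_simps: 
  "x \<in> carrier F \<longleftrightarrow> Poly_Mapping.keys x \<subseteq> carrier iso_monoid" "\<one>\<^bsub>F\<^esub> = 0" "x \<otimes>\<^bsub>F\<^esub> y = x + y"
  "x \<in> carrier F \<Longrightarrow> inv\<^bsub>F\<^esub> x = - x"
  by (simp_all add: free_on_iso_classes_def iso_monoid_carrier)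

lemma F_comm_group: "comm_group F"
  unfolding free_on_iso_classes_def by (rule abelian_free_Abelian_group)

lemma frag_of_F: "A \<in> Obj C \<Longrightarrow> frag_of (cls A) \<in> carrier F"
  by (simp add: F_simps iso_class_carrier)

text \<open>The value in the monoid of isomorphism classes of a formal sum with nonnegative coefficients.\<close>

definition val where
  "val u = finprod iso_monoid (\<lambda>c. c [^]\<^bsub>iso_monoid\<^esub> nat (Poly_Mapping.lookup u c)) (Poly_Mapping.keys u)"

definition effective where
  "effective u \<longleftrightarrow> u \<in> carrier F \<and> (\<forall>c. 0 \<le> Poly_Mapping.lookup u c)"

lemma val_superset:
  assumes "finite S" "Poly_Mapping.keys u \<subseteq> S" "S \<subseteq> carrier iso_monoid"
  shows "val u = finprod iso_monoid (\<lambda>c. c [^]\<^bsub>iso_monoid\<^esub> nat (Poly_Mapping.lookup u c)) S"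
proof -
  interpret M: comm_monoid iso_monoid by (rule iso_monoid_comm_monoid)
  show ?thesis unfolding val_def
    by (rule M.finprod_mono_neutral_cong_left) (use assms in \<open>auto simp: in_keys_iff\<close>)
qed

lemma val_closed: assumes "effective u" shows "val u \<in> carrier iso_monoid"
proof -
  interpret M: comm_monoid iso_monoid by (rule iso_monoid_comm_monoid)
  show ?thesis unfolding val_def using assms
    by (intro M.finprod_closed Pi_I M.nat_pow_closed) (auto simp: effective_def F_simps)
qed

lemma effective_add: assumes "effective u" "effective v" shows "effective (u + v)"
proof -
  interpret F: comm_group F by (rule F_comm_group)
  have "u \<otimes>\<^bsub>F\<^esub> v \<in> carrier F" using assms F.m_closed unfolding effective_def by blast
  then show ?thesis using assms by (simp add: F_simps(3) effective_def lookup_add)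
qed

lemma val_add: assumes "effective u" "effective v" shows "val (u + v) = val u \<star> val v"
proof -
  interpret M: comm_monoid iso_monoid by (rule iso_monoid_comm_monoid)
  let ?S = "Poly_Mapping.keys u \<union> Poly_Mapping.keys v"
  have S: "finite ?S" "?S \<subseteq> carrier iso_monoid" using assms by (auto simp: effective_def F_simps)
  have "val (u + v) = finprod iso_monoid (\<lambda>c. c [^]\<^bsub>iso_monoid\<^esub> nat (Poly_Mapping.lookup (u + v) c)) ?S"
    by (rule val_superset[OF S(1) Poly_Mapping.keys_add S(2)])
  also have "\<dots> = finprod iso_monoid (\<lambda>c. c [^]\<^bsub>iso_monoid\<^esub> nat (Poly_Mapping.lookup u c) \<star> 
      c [^]\<^bsub>iso_monoid\<^esub> nat (Poly_Mapping.lookup v c)) ?S"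
    using S(2) assms
    by (intro M.finprod_cong') (auto simp: lookup_add effective_def nat_add_distrib M.nat_pow_mult simp del: pow_nat)
  also have "\<dots> = val u \<star> val v"
    using S val_superset[of ?S u] val_superset[of ?S v] by (subst M.finprod_multf) (auto simp del: pow_nat)
  finally show ?thesis .
qed

lemma effective_frag_of: "A \<in> Obj C \<Longrightarrow> effective (frag_of (cls A))"
  using frag_of_F by (simp add: effective_def lookup_frag_of)

lemma val_frag_of: assumes "A \<in> Obj C" shows "val (frag_of (cls A)) = cls A"
proof -
  interpret M: comm_monoid iso_monoid by (rule iso_monoid_comm_monoid)
  show ?thesis unfolding val_def using iso_class_carrier[OF assms] by (simp add: lookup_frag_of del: pow_nat)
qed

lemma effective_zero: "effective 0"
  by (simp add: effective_def F_simps)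

lemma val_zero: "val 0 = \<one>\<^bsub>iso_monoid\<^esub>"
  using comm_monoid.finprod_empty[OF iso_monoid_comm_monoid] by (simp add: val_def)

text \<open>
  A formal sum is balanced if it is a difference of effective ones whose values agree up to projective
  summands. This condition is closed under addition because the monoid of isomorphism classes is
  commutative, so all relations of the Grothendieck group are balanced.
\<close>

definition balanced where
  "balanced x \<longleftrightarrow> (\<exists>u v. \<exists>P \<in> Proj C E. \<exists>Q \<in> Proj C E. effective u \<and> effective v \<and> x = u - v \<and>
     val u \<star> cls P = val v \<star> cls Q)"

lemma balancedI: assumes "effective u" "effective v" "P \<in> Proj C E" "Q \<in> Proj C E" "val u \<star> cls P = val v \<star> cls Q"
  shows "balanced (u - v)"
  using assms unfolding balanced_def by blast

lemma balanced_uminus: "balanced x \<Longrightarrow> balanced (- x)"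
  unfolding balanced_def by (metis minus_diff_eq)

lemma balanced_add: assumes "balanced x" "balanced y" shows "balanced (x + y)"
proof -
  interpret M: comm_monoid iso_monoid by (rule iso_monoid_comm_monoid)
  obtain u v P Q where 1: "effective u" "effective v" "x = u - v" "val u \<star> cls P = val v \<star> cls Q"
    and P: "P \<in> Proj C E" "Q \<in> Proj C E" using assms(1) unfolding balanced_def by blast
  obtain u' v' P' Q' where 2: "effective u'" "effective v'" "y = u' - v'" "val u' \<star> cls P' = val v' \<star> cls Q'"
    and P': "P' \<in> Proj C E" "Q' \<in> Proj C E" using assms(2) unfolding balanced_def by blast
  obtain X where X: "direct_sum C [P, P'] X" using P P' Proj_Obj ex_direct_sum by blast
  obtain Y where Y: "direct_sum C [Q, Q'] Y" using P P' Proj_Obj ex_direct_sum by blast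
  have c: "val u \<in> carrier iso_monoid" "val v \<in> carrier iso_monoid" "val u' \<in> carrier iso_monoid" "val v' \<in> carrier iso_monoid"
    "cls P \<in> carrier iso_monoid" "cls P' \<in> carrier iso_monoid" "cls Q \<in> carrier iso_monoid" "cls Q' \<in> carrier iso_monoid"
    using 1 2 P P' val_closed iso_class_carrier Proj_Obj by auto
  have "val (u + u') \<star> cls X = (val u \<star> cls P) \<star> (val u' \<star> cls P')"
    using c 1(1,2) 2(1,2) by (simp add: val_add M.m_ac flip: iso_class_biprod[OF X])
  also have "\<dots> = val (v + v') \<star> cls Y"
    unfolding 1(4) 2(4) using c 1(1,2) 2(1,2) by (simp add: val_add M.m_ac flip: iso_class_biprod[OF Y])
  finally have "balanced ((u + u') - (v + v'))"
    by (rule balancedI[OF effective_add[OF 1(1) 2(1)] effective_add[OF 1(2) 2(2)]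
          Proj_biprod[OF P(1) P'(1) X] Proj_biprod[OF P(2) P'(2) Y]])
  moreover have "x + y = (u + u') - (v + v')" unfolding 1(3) 2(3) by simp
  ultimately show ?thesis by simp
qed

definition K_generators where
  "K_generators = {frag_of (cls N) - frag_of (cls S) - frag_of (cls T) | N S T. direct_sum C [S, T] N} \<union>
      {frag_of (cls P) | P. P \<in> Proj C E}"

lemma R_eq: "R = generate F K_generators"
  by (simp add: K_relations_def K_generators_def)

lemma K_generators_F: "K_generators \<subseteq> carrier F"
proof -
  have "frag_of (cls N) - frag_of (cls S) - frag_of (cls T) \<in> carrier F" 
    if "direct_sum C [S, T] N" for N S T
    using biprod_objs[OF that] iso_class_carrier keys_diff[of "frag_of (cls N) - frag_of (cls S)" "frag_of (cls T)"]
      keys_diff[of "frag_of (cls N)" "frag_of (cls S)"] by (auto simp: F_simps)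
  then show ?thesis using frag_of_F Proj_Obj unfolding K_generators_def by auto
qed

lemma K_generators_balanced: assumes "x \<in> K_generators" shows "balanced x"
proof -
  interpret M: comm_monoid iso_monoid by (rule iso_monoid_comm_monoid)
  obtain Z where Z: "zero_object C Z" using ex_zero_object by blast
  then have ZP: "Z \<in> Proj C E" "cls Z = \<one>\<^bsub>iso_monoid\<^esub>" using Proj_zero iso_class_zero by auto
  from assms consider (sum) N S T where "direct_sum C [S, T] N" "x = frag_of (cls N) - (frag_of (cls S) + frag_of (cls T))"
    | (proj) P where "P \<in> Proj C E" "x = frag_of (cls P) - 0"
    unfolding K_generators_def by (auto simp: diff_diff_eq)
  then show ?thesis
  proof cases
    case sum
    note o = biprod_objs[OF sum(1)]
    show ?thesis unfolding sum(2) using o ZP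
      by (intro balancedI[where P = Z and Q = Z])
        (simp_all add: effective_add effective_frag_of val_add val_frag_of iso_class_biprod[OF sum(1)])
  next
    case proj
    show ?thesis unfolding proj(2) using proj(1) ZP Proj_Obj[OF proj(1)]
      by (intro balancedI[where P = Z and Q = P])
        (simp_all add: effective_zero effective_frag_of val_frag_of val_zero iso_class_carrier)
  qed
qed

lemma R_balanced: assumes "x \<in> R" shows "balanced x"
  using assms unfolding R_eq
proof (induction rule: generate.induct)
  case one
  obtain Z where "Z \<in> Proj C E" using ex_zero_object Proj_zero by blast
  then have "balanced (0 - 0)" using effective_zero by (intro balancedI) auto
  then show ?case by (simp add: F_simps)
next
  case (incl h)
  then show ?case by (rule K_generators_balanced)
next
  case (inv h)
  then have "inv\<^bsub>F\<^esub> h = - h" using K_generators_F F_simps(4) by blast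
  then show ?case using balanced_uminus[OF K_generators_balanced[OF inv]] by simp
next
  case (eng h1 h2)
  then show ?case using balanced_add by (simp add: F_simps)
qed

lemma R_subgroup: "subgroup R F"
proof -
  interpret F: comm_group F by (rule F_comm_group)
  show ?thesis unfolding R_eq by (rule F.generate_is_subgroup[OF K_generators_F])
qed

abbreviation K where "K \<equiv> K_group C E"
abbreviation kc where "kc \<equiv> K_class C E"

lemma K_comm_group: "comm_group K"
proof -
  interpret F: comm_group F by (rule F_comm_group)
  show ?thesis unfolding K_group_def by (rule F.abelian_FactGroup[OF R_subgroup])
qed

lemma coset_hom: "(\<lambda>x. R #>\<^bsub>F\<^esub> x) \<in> hom F K"
proof -
  interpret F: comm_group F by (rule F_comm_group)
  interpret N: normal R F using F.normal_iff_subgroup R_subgroup by blast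
  show ?thesis unfolding K_group_def by (rule N.r_coset_hom_Mod)
qed

lemma coset_eq_iff: assumes "x \<in> carrier F" "y \<in> carrier F"
  shows "R #>\<^bsub>F\<^esub> x = R #>\<^bsub>F\<^esub> y \<longleftrightarrow> x - y \<in> R"
proof -
  interpret F: comm_group F by (rule F_comm_group)
  interpret N: normal R F using F.normal_iff_subgroup R_subgroup by blast
  have d: "x - y = x \<otimes>\<^bsub>F\<^esub> inv\<^bsub>F\<^esub> y" using assms by (simp add: F_simps)
  have xy: "x = (x - y) \<otimes>\<^bsub>F\<^esub> y" by (simp add: F_simps)
  have c: "x - y \<in> carrier F" unfolding d using assms by simp
  show ?thesis
  proof
    assume "R #>\<^bsub>F\<^esub> x = R #>\<^bsub>F\<^esub> y"
    then have "x \<in> R #>\<^bsub>F\<^esub> y" using F.rcos_self[OF assms(1) R_subgroup] by simp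
    then show "x - y \<in> R" unfolding r_coset_def by (auto simp: F_simps)
  next
    assume "x - y \<in> R"
    then have "x \<in> R #>\<^bsub>F\<^esub> y" unfolding r_coset_def using xy by blast
    then show "R #>\<^bsub>F\<^esub> x = R #>\<^bsub>F\<^esub> y" using F.repr_independence[OF _ assms(2) R_subgroup] by simp
  qed
qed

lemma kc_eq: "kc A = R #>\<^bsub>F\<^esub> frag_of (cls A)"
  by (simp add: K_class_def)

lemma kc_closed: "A \<in> Obj C \<Longrightarrow> kc A \<in> carrier K"
  unfolding kc_eq using coset_hom frag_of_F by (auto simp: hom_def)

lemma kc_biprod: assumes "direct_sum C [A, B] X" shows "kc X = kc A \<otimes>\<^bsub>K\<^esub> kc B"
proof -
  note o = biprod_objs[OF assms]
  interpret F: comm_group F by (rule F_comm_group)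
  have "frag_of (cls X) - frag_of (cls A) - frag_of (cls B) \<in> R"
    unfolding R_eq K_generators_def using assms by (blast intro: generate.incl)
  then have "frag_of (cls X) - (frag_of (cls A) \<otimes>\<^bsub>F\<^esub> frag_of (cls B)) \<in> R"
    by (simp add: F_simps(3) diff_diff_eq)
  then have "kc X = R #>\<^bsub>F\<^esub> (frag_of (cls A) \<otimes>\<^bsub>F\<^esub> frag_of (cls B))"
    unfolding kc_eq using o frag_of_F by (subst coset_eq_iff) auto
  also have "\<dots> = kc A \<otimes>\<^bsub>K\<^esub> kc B" unfolding kc_eq using o frag_of_F by (intro hom_mult[OF coset_hom]) auto
  finally show ?thesis .
qed

lemma K_one: "\<one>\<^bsub>K\<^esub> = R"
  by (simp add: K_group_def)

lemma kc_Proj: assumes "P \<in> Proj C E" shows "kc P = \<one>\<^bsub>K\<^esub>"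
proof -
  interpret F: comm_group F by (rule F_comm_group)
  have "frag_of (cls P) \<in> R"
    unfolding R_eq K_generators_def using assms by (blast intro: generate.incl)
  then show ?thesis unfolding kc_eq K_one using assms Proj_Obj frag_of_F
    by (intro F.coset_join2[OF _ R_subgroup]) auto
qed

lemma kc_iso: "isomorphic C A B \<Longrightarrow> kc A = kc B"
  unfolding kc_eq using iso_class_eq_iff isomorphic_def by metis

text \<open>
  A relation that equals \<open>[A] - [B]\<close> in the free group only says that \<open>A\<close> and \<open>B\<close> become isomorphic after
  adding projectives and a common object. The Krull-Schmidt property removes the common object.
\<close>

lemma kc_eq_imp:
  assumes "A \<in> Obj C" "B \<in> Obj C" "kc A = kc B"
  obtains P Q where "P \<in> Proj C E" "Q \<in> Proj C E" "cls A \<star> cls P = cls B \<star> cls Q"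
proof -
  interpret M: comm_monoid iso_monoid by (rule iso_monoid_comm_monoid)
  have "frag_of (cls A) - frag_of (cls B) \<in> R"
    using assms frag_of_F coset_eq_iff unfolding kc_eq by blast
  then obtain u v P Q where 1: "effective u" "effective v" "frag_of (cls A) - frag_of (cls B) = u - v"
     "val u \<star> cls P = val v \<star> cls Q" and P: "P \<in> Proj C E" "Q \<in> Proj C E" 
    using R_balanced unfolding balanced_def by blast
  have "frag_of (cls A) + v = frag_of (cls B) + u" using 1(3) by (simp add: algebra_simps)
  then have 2: "cls A \<star> val v = cls B \<star> val u"
    using val_add 1 assms effective_frag_of val_frag_of by metis
  have c: "val u \<in> carrier iso_monoid" "val v \<in> carrier iso_monoid" "cls A \<in> carrier iso_monoid" "cls B \<in> carrier iso_monoid"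
    "cls P \<in> carrier iso_monoid" "cls Q \<in> carrier iso_monoid"
    using 1 P val_closed iso_class_carrier Proj_Obj assms by auto
  have "(cls A \<star> cls P) \<star> val u = cls A \<star> (val u \<star> cls P)" using c by (simp add: M.m_ac)
  also have "\<dots> = (cls A \<star> val v) \<star> cls Q" unfolding 1(4) using c by (simp add: M.m_ac)
  also have "\<dots> = (cls B \<star> cls Q) \<star> val u" unfolding 2 using c by (simp add: M.m_ac)
  finally have "cls A \<star> cls P = cls B \<star> cls Q"
    by (rule iso_monoid_cancel[OF krull_schmidt M.m_closed[OF c(3,5)] M.m_closed[OF c(4,6)] c(1)])
  with P that show ?thesis by blast
qed

text \<open>
  After adding trivial presentations the two syzygies become isomorphic. Both inclusions of the common
  kernel extend along each other by the vanishing of Ext, and the dual of Schanuel's lemma applies.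
\<close>

lemma perp_kc_Syz_inj:
  assumes "perp U" "perp V" "kc (Syz C E U) = kc (Syz C E V)"
  shows "kc U = kc V"
proof -
  interpret G: comm_group K by (rule K_comm_group)
  note o = perp_Obj[OF assms(1)] perp_Obj[OF assms(2)]
  obtain P Q where P: "P \<in> Proj C E" "Q \<in> Proj C E" and e: "cls (Syz C E U) \<star> cls P = cls (Syz C E V) \<star> cls Q"
    using kc_eq_imp[OF Syz_Obj Syz_Obj assms(3)] o by blast
  obtain Z where Z: "zero_object C Z" using ex_zero_object by blast
  have main: "\<exists>X i P1 p. direct_sum C [Syz C E U, P] X \<and> presentation X i P1 p U"
    if UO: "U \<in> Obj C" and PP: "P \<in> Proj C E" for U P
  proof -
    obtain i P0 p where 1: "presentation (Syz C E U) i P0 p U" using Syz_presentation[OF UO] by metis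
    note 2 = presentation_trivial[OF PP Z]
    obtain X where X: "direct_sum C [Syz C E U, P] X" using Syz_Obj UO PP Proj_Obj ex_direct_sum by blast
    obtain P1 where P1: "direct_sum C [P0, P] P1" using presentationD(11)[OF 1] UO PP Proj_Obj ex_direct_sum by blast
    show ?thesis using presentation_biprod[OF 1 2 X P1 biprod_zero[OF Z UO]] X by metis
  qed
  obtain X i P1 p where X: "direct_sum C [Syz C E U, P] X" and 1: "presentation X i P1 p U"
    using main[OF o(1) P(1)] by blast
  obtain Y j' Q1 q where Y: "direct_sum C [Syz C E V, Q] Y" and V2: "presentation Y j' Q1 q V"
    using main[OF o(2) P(2)] by blast
  have "isomorphic C X Y" 
    using e X Y iso_class_biprod biprod_objs(3) iso_class_eq_iff by metis
  then obtain j where 2: "presentation X j Q1 q V" using presentation_cong_kernel[OF V2] by metis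
  note I = presentationD[OF 1] and J = presentationD[OF 2]
  have ij: "j \<in> mor C (Dom C i) Q1" "i \<in> mor C (Dom C j) P1" using I(4-6) J(4-6) by (auto simp: mor_iff)
  obtain f where f: "f \<in> mor C P1 Q1" "f \<cdot> i = j"
    using perp_presentation(1)[OF assms(1) 1] ij(1) I(6) J(1) unfolding extends_to_Proj_def by blast
  obtain g where g: "g \<in> mor C Q1 P1" "g \<cdot> j = i"
    using perp_presentation(1)[OF assms(2) 2] ij(2) J(6) I(1) unfolding extends_to_Proj_def by blast
  obtain S T where S: "direct_sum C [U, Q1] S" and T: "direct_sum C [V, P1] T"
    using ex_direct_sum o I J by meson
  have "kc S = kc T" by (rule kc_iso[OF dual_schanuel[OF 1 2 f g S T]])
  then show ?thesis using kc_biprod[OF S] kc_biprod[OF T] kc_Proj I(1) J(1) kc_closed o by simp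
qed

section \<open>The syzygy endomorphism\<close>

text \<open>By Schanuel's lemma two syzygies of one object agree up to projective summands.\<close>

lemma kc_syzygy_unique:
  assumes "presentation L j Q q X" "presentation L' j' Q' q' X"
  shows "kc L = kc L'"
proof -
  interpret G: comm_group K by (rule K_comm_group)
  note I = presentationD[OF assms(1)] and J = presentationD[OF assms(2)]
  obtain S T where S: "direct_sum C [L, Q'] S" and T: "direct_sum C [L', Q] T"
    using ex_direct_sum I J by meson
  have "kc S = kc T" by (rule kc_iso[OF schanuel[OF assms S T]])
  then show ?thesis using kc_biprod[OF S] kc_biprod[OF T] kc_Proj I(1) J(1) kc_closed I(10) J(10) by simp
qed

lemma kc_Syz_biprod: assumes "direct_sum C [A, B] X"
  shows "kc (Syz C E X) = kc (Syz C E A) \<otimes>\<^bsub>K\<^esub> kc (Syz C E B)"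
proof -
  note o = biprod_objs[OF assms]
  obtain i P p where 1: "presentation (Syz C E A) i P p A" using Syz_presentation[OF o(1)] by metis
  obtain i' P' p' where 2: "presentation (Syz C E B) i' P' p' B" using Syz_presentation[OF o(2)] by metis
  obtain i'' P'' p'' where 3: "presentation (Syz C E X) i'' P'' p'' X" using Syz_presentation[OF o(3)] by metis
  obtain L where L: "direct_sum C [Syz C E A, Syz C E B] L" using ex_direct_sum Syz_Obj o by blast
  obtain Q where Q: "direct_sum C [P, P'] Q" using ex_direct_sum presentationD(11)[OF 1] presentationD(11)[OF 2] by blast
  obtain j q where "presentation L j Q q X" using presentation_biprod[OF 1 2 L Q assms] by metis
  then show ?thesis using kc_syzygy_unique[OF 3] kc_biprod[OF L] by simp
qed

lemma kc_Syz_Proj: assumes "P \<in> Proj C E" shows "kc (Syz C E P) = \<one>\<^bsub>K\<^esub>"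
proof -
  obtain i Q p where 1: "presentation (Syz C E P) i Q p P" using Syz_presentation Proj_Obj assms by metis
  then have "Syz C E P \<in> Proj C E" 
    using presentation_of_Proj_splits[OF 1 assms] split_presentation_Proj(1)[OF 1] by metis
  then show ?thesis by (rule kc_Proj)
qed

lemma kc_Syz_iso: assumes "isomorphic C A B" shows "kc (Syz C E A) = kc (Syz C E B)"
proof -
  interpret G: comm_group K by (rule K_comm_group)
  obtain Z where Z: "zero_object C Z" using ex_zero_object by blast
  have o: "A \<in> Obj C" "B \<in> Obj C" "Z \<in> Obj C" using assms Z by (auto simp: isomorphic_def zero_object_def)
  have "direct_sum C [B, Z] A"
    using biprod_iso[OF biprod_zero[OF Z o(1)] assms isomorphic_refl isomorphic_refl] o by blast
  then show ?thesis using kc_Syz_biprod kc_Syz_Proj[OF Proj_zero[OF Z]] kc_closed Syz_Obj o by simp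
qed

text \<open>
  The map \<open>[M] \<mapsto> [\<Omega> M]\<close> extends to the free group and kills the relations, by Schanuel's lemma in the
  form of \<open>kc_Syz_biprod\<close>.
\<close>

lemma K_syz_exists: "\<exists>L. L \<in> hom K K \<and> (\<forall>M \<in> Obj C. L (kc M) = kc (Syz C E M))"
proof -
  interpret G: comm_group K by (rule K_comm_group)
  interpret F: comm_group F by (rule F_comm_group)
  have repc: "rep (cls A) \<in> Obj C" "isomorphic C (rep (cls A)) A" if "A \<in> Obj C" for A
  proof -
    have "A \<in> cls A" using that isomorphic_refl by (simp add: iso_class_def)
    then have "rep (cls A) \<in> cls A" unfolding rep_def by (rule someI)
    then show i: "isomorphic C (rep (cls A)) A" unfolding iso_class_def by simp
    then show "rep (cls A) \<in> Obj C" by (simp add: isomorphic_def)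
  qed
  have "(\<lambda>c. kc (Syz C E (rep c))) ` (cls ` Obj C) \<subseteq> carrier K"
    using repc kc_closed Syz_Obj by auto
  then obtain h where h: "h \<in> hom F K" "\<And>c. c \<in> cls ` Obj C \<Longrightarrow> h (frag_of c) = kc (Syz C E (rep c))"
    using G.free_Abelian_group_universal unfolding free_on_iso_classes_def by metis
  have hA: "h (frag_of (cls A)) = kc (Syz C E A)" if "A \<in> Obj C" for A
    using h(2) that kc_Syz_iso[OF repc(2)[OF that]] by auto
  interpret h: group_hom F K h using h(1) by (simp add: group_hom_def group_hom_axioms_def F.is_group G.is_group)
  have "K_generators \<subseteq> kernel F K h"
  proof
    fix x assume x: "x \<in> K_generators"
    then have xF: "x \<in> carrier F" using K_generators_F by blast
    from x consider (sum) N S T where "direct_sum C [S, T] N" "x = frag_of (cls N) - frag_of (cls S) - frag_of (cls T)"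
      | (proj) P where "P \<in> Proj C E" "x = frag_of (cls P)"
      unfolding K_generators_def by auto
    then have "h x = \<one>\<^bsub>K\<^esub>"
    proof cases
      case sum
      note o = biprod_objs[OF sum(1)]
      have "frag_of (cls N) = x \<otimes>\<^bsub>F\<^esub> (frag_of (cls S) \<otimes>\<^bsub>F\<^esub> frag_of (cls T))"
        unfolding sum(2) by (simp add: F_simps(3))
      then have "h (frag_of (cls N)) = h x \<otimes>\<^bsub>K\<^esub> (h (frag_of (cls S)) \<otimes>\<^bsub>K\<^esub> h (frag_of (cls T)))"
        using xF frag_of_F o by simp
      then have "kc (Syz C E N) = h x \<otimes>\<^bsub>K\<^esub> kc (Syz C E N)"
        using hA o kc_Syz_biprod[OF sum(1)] by simp
      then show ?thesis using xF kc_closed[OF Syz_Obj[OF o(3)]] by (metis G.r_cancel_one' h.hom_closed)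
    next
      case proj
      then show ?thesis using hA Proj_Obj kc_Syz_Proj by simp
    qed
    then show "x \<in> kernel F K h" using xF by (simp add: kernel_def)
  qed
  then have "R \<subseteq> kernel F K h"
    unfolding R_eq by (rule F.generate_subgroup_incl[OF _ h.subgroup_kernel])
  moreover have "R \<lhd> F" using F.normal_iff_subgroup R_subgroup by blast
  ultimately obtain L where L: "L \<in> hom (F Mod R) K" "\<And>x. x \<in> carrier F \<Longrightarrow> L (R #>\<^bsub>F\<^esub> x) = h x"
    using h.FactGroup_universal_kernel by metis
  have "L (kc M) = kc (Syz C E M)" if "M \<in> Obj C" for M
    using L(2)[OF frag_of_F[OF that]] hA[OF that] by (simp add: kc_eq)
  then show ?thesis using L(1) unfolding K_group_def by blast
qed

lemma K_syz_hom: "K_syz C E \<in> hom K K"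
  and K_syz_kc: "M \<in> Obj C \<Longrightarrow> K_syz C E (kc M) = kc (Syz C E M)"
  using someI_ex[OF K_syz_exists] unfolding K_syz_def by auto

text \<open>
  The subgroup generated by the classes of the perpendicular objects: as these are closed under direct
  sums, every element is a difference of two such classes.
\<close>

definition perp_subgroup where
  "perp_subgroup = {kc A \<otimes>\<^bsub>K\<^esub> inv\<^bsub>K\<^esub> kc B | A B. perp A \<and> perp B}"

lemma perp_subgroup_subgroup: "subgroup perp_subgroup K"
proof -
  interpret G: comm_group K by (rule K_comm_group)
  have m: "x \<otimes>\<^bsub>K\<^esub> inv\<^bsub>K\<^esub> y \<in> perp_subgroup" if xS: "x \<in> perp_subgroup" and yS: "y \<in> perp_subgroup" for x y
  proof -
    obtain A B where x: "x = kc A \<otimes>\<^bsub>K\<^esub> inv\<^bsub>K\<^esub> kc B" "perp A" "perp B" using xS by (auto simp: perp_subgroup_def)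
    obtain A' B' where y: "y = kc A' \<otimes>\<^bsub>K\<^esub> inv\<^bsub>K\<^esub> kc B'" "perp A'" "perp B'" using yS by (auto simp: perp_subgroup_def)
    obtain U where U: "direct_sum C [A, B'] U" using x y perp_Obj ex_direct_sum by blast
    obtain V where V: "direct_sum C [B, A'] V" using x y perp_Obj ex_direct_sum by blast
    have "x \<otimes>\<^bsub>K\<^esub> inv\<^bsub>K\<^esub> y = kc U \<otimes>\<^bsub>K\<^esub> inv\<^bsub>K\<^esub> kc V"
      unfolding kc_biprod[OF U] kc_biprod[OF V] using x y kc_closed perp_Obj by (simp add: G.inv_mult G.m_ac)
    then show ?thesis unfolding perp_subgroup_def using perp_biprod U V x y by blast
  qed
  have s: "perp_subgroup \<subseteq> carrier K" unfolding perp_subgroup_def using perp_Obj kc_closed by auto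
  obtain Z where "perp Z" using ex_zero_object perp_zero by blast
  then have "perp_subgroup \<noteq> {}" unfolding perp_subgroup_def by blast
  then obtain z where z: "z \<in> perp_subgroup" by blast
  have 1: "\<one>\<^bsub>K\<^esub> \<in> perp_subgroup" using m[OF z z] z s by (metis G.r_inv subsetD)
  have i: "inv\<^bsub>K\<^esub> x \<in> perp_subgroup" if "x \<in> perp_subgroup" for x
    using m[OF 1 that] that s by (metis G.inv_closed G.l_one subsetD)
  show ?thesis
  proof (rule G.subgroupI[OF s _ i])
    fix x y assume xy: "x \<in> perp_subgroup" "y \<in> perp_subgroup"
    then show "x \<otimes>\<^bsub>K\<^esub> y \<in> perp_subgroup" using m[OF xy(1) i[OF xy(2)]] s by (metis G.inv_inv subsetD)
  qed (use z in auto)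
qed

lemma kc_perp_subgroup: assumes "perp A" shows "kc A \<in> perp_subgroup"
proof -
  interpret G: comm_group K by (rule K_comm_group)
  obtain Z where Z: "zero_object C Z" using ex_zero_object by blast
  have "kc A = kc A \<otimes>\<^bsub>K\<^esub> inv\<^bsub>K\<^esub> kc Z" using kc_Proj[OF Proj_zero[OF Z]] kc_closed perp_Obj[OF assms] by simp
  then show ?thesis unfolding perp_subgroup_def using assms perp_zero[OF Z] by blast
qed

interpretation K_syz: group_hom K K "K_syz C E"
  using K_comm_group K_syz_hom by (simp add: group_hom_def group_hom_axioms_def comm_group_def)

lemma K_syz_perp: assumes "perp A" "perp B"
  shows "K_syz C E (kc A \<otimes>\<^bsub>K\<^esub> inv\<^bsub>K\<^esub> kc B) = kc (Syz C E A) \<otimes>\<^bsub>K\<^esub> inv\<^bsub>K\<^esub> kc (Syz C E B)"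
  using assms K_syz_kc kc_closed perp_Obj by simp

lemma K_syz_perp_subgroup: "K_syz C E ` perp_subgroup \<subseteq> perp_subgroup"
proof
  fix y assume "y \<in> K_syz C E ` perp_subgroup"
  then obtain A B where "y = K_syz C E (kc A \<otimes>\<^bsub>K\<^esub> inv\<^bsub>K\<^esub> kc B)" "perp A" "perp B"
    unfolding perp_subgroup_def by blast
  then show "y \<in> perp_subgroup" using K_syz_perp perp_Syz unfolding perp_subgroup_def by blast
qed

lemma K_syz_inj_on: "inj_on (K_syz C E) perp_subgroup"
proof (rule inj_onI)
  interpret S: subgroup perp_subgroup K by (rule perp_subgroup_subgroup)
  have div_one: "a = b" if "a \<in> carrier K" "b \<in> carrier K" "a \<otimes>\<^bsub>K\<^esub> inv\<^bsub>K\<^esub> b = \<one>\<^bsub>K\<^esub>" for a b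
  proof -
    have "a = (a \<otimes>\<^bsub>K\<^esub> inv\<^bsub>K\<^esub> b) \<otimes>\<^bsub>K\<^esub> b" using that(1,2) by (simp add: K_syz.G.m_assoc)
    then show ?thesis using that(2,3) by simp
  qed
  fix x y assume xy: "x \<in> perp_subgroup" "y \<in> perp_subgroup" "K_syz C E x = K_syz C E y"
  then have c: "x \<in> carrier K" "y \<in> carrier K" by auto
  have "x \<otimes>\<^bsub>K\<^esub> inv\<^bsub>K\<^esub> y \<in> perp_subgroup" using xy by simp
  then obtain A B where AB: "x \<otimes>\<^bsub>K\<^esub> inv\<^bsub>K\<^esub> y = kc A \<otimes>\<^bsub>K\<^esub> inv\<^bsub>K\<^esub> kc B" "perp A" "perp B"
    by (auto simp: perp_subgroup_def)
  note o = perp_Obj[OF AB(2)] perp_Obj[OF AB(3)]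
  have "K_syz C E (x \<otimes>\<^bsub>K\<^esub> inv\<^bsub>K\<^esub> y) = \<one>\<^bsub>K\<^esub>" using xy(3) c by simp
  then have "kc (Syz C E A) \<otimes>\<^bsub>K\<^esub> inv\<^bsub>K\<^esub> kc (Syz C E B) = \<one>\<^bsub>K\<^esub>" using AB K_syz_perp by simp
  then have "kc (Syz C E A) = kc (Syz C E B)" 
    by (rule div_one[OF kc_closed[OF Syz_Obj[OF o(1)]] kc_closed[OF Syz_Obj[OF o(2)]]])
  then have "kc A = kc B" by (rule perp_kc_Syz_inj[OF AB(2,3)])
  then have "x \<otimes>\<^bsub>K\<^esub> inv\<^bsub>K\<^esub> y = \<one>\<^bsub>K\<^esub>" using AB(1) o kc_closed by simp
  then show "x = y" by (rule div_one[OF c])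
qed

section \<open>Stable summands and the function \<open>\<Phi>\<close>\<close>

text \<open>The zero map factors through a projective, so \<open>f\<close> lies in its own coset.\<close>

lemma stable_class_mem: assumes "f \<in> Arr C" "S = stable_class C E f"
  shows "f \<in> S" "rep S \<in> Arr C" "Dom C (rep S) = Dom C f" "Cod C (rep S) = Cod C f"
proof -
  obtain Z where Z: "Z \<in> Proj C E" "Z \<in> Obj C" using ex_zero_object Proj_zero Proj_Obj by blast
  let ?A = "Dom C f" and ?B = "Cod C f"
  have o: "?A \<in> Obj C" "?B \<in> Obj C" using assms Dom_in_Obj Cod_in_Obj by auto
  have "Zer C ?A ?B = Zer C Z ?B \<cdot> Zer C ?A Z" "Zer C ?A Z \<in> mor C ?A Z" "Zer C Z ?B \<in> mor C Z ?B"
    using o Z by (simp_all add: hom_simps)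
  then have "Zer C ?A ?B \<in> proj_ideal C E ?A ?B" unfolding proj_ideal_def using Z by blast
  moreover have "f = Zer C ?A ?B \<^bold>+ f" using assms by (simp add: Add_Zer)
  ultimately show "f \<in> S" unfolding assms(2) stable_class_def r_coset_def by auto
  then have "rep S \<in> S" unfolding rep_def by (rule someI)
  then obtain h where h: "h \<in> proj_ideal C E ?A ?B" "rep S = h \<^bold>+ f"
    unfolding assms(2) stable_class_def r_coset_def by auto
  then have "h \<in> mor C ?A ?B" unfolding proj_ideal_def by (auto simp: arr_simps)
  then show "rep S \<in> Arr C" "Dom C (rep S) = ?A" "Cod C (rep S) = ?B"
    unfolding h(2) using assms by (simp_all add: arr_simps)
qed

text \<open>
  Representatives of the inclusion and the projection of a stable summand compose to the identity modulo the
  ideal of maps that factor through a projective.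
\<close>

lemma stable_summand_retract:
  assumes "direct_summand (stable_cat C E) X M" shows "stable_retract X M"
proof -
  obtain B where "direct_sum (stable_cat C E) [X, B] M" using assms by (auto simp: direct_summand_def)
  then obtain i p where m: "\<forall>k < length [X, B]. i k \<in> mor (stable_cat C E) ([X, B] ! k) M \<and> p k \<in> mor (stable_cat C E) M ([X, B] ! k)"
    and c: "\<forall>k < length [X, B]. \<forall>l < length [X, B].
           Cmp (stable_cat C E) (p k) (i l) = (if k = l then Idn (stable_cat C E) ([X, B] ! k) else Zer (stable_cat C E) ([X, B] ! l) ([X, B] ! k))"
    and X: "X \<in> Obj C"
    unfolding direct_sum_def by (auto simp: stable_cat_def)
  define f g where "f = rep (i 0)" and "g = rep (p 0)"
  have "i 0 \<in> mor (stable_cat C E) X M" "p 0 \<in> mor (stable_cat C E) M X" using m by auto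
  then have fg: "f \<in> mor C X M" "g \<in> mor C M X"
    using stable_class_mem(2) unfolding f_def g_def by (auto simp: mor_def stable_cat_def)
  have "Cmp (stable_cat C E) (p 0) (i 0) = Idn (stable_cat C E) X" using c by fastforce
  then have e: "stable_class C E (g \<cdot> f) = stable_class C E (Idn C X)" by (simp add: stable_cat_def f_def g_def)
  have "Idn C X \<in> stable_class C E (g \<cdot> f)" unfolding e using stable_class_mem(1) Idn_arr X by blast
  then obtain h where h: "h \<in> proj_ideal C E X X" "Idn C X = h \<^bold>+ g \<cdot> f"
    unfolding stable_class_def r_coset_def using fg by (auto simp: arr_simps)
  then obtain a b P where ab: "P \<in> Proj C E" "a \<in> mor C X P" "b \<in> mor C P X" "h = b \<cdot> a" 
    unfolding proj_ideal_def by blast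
  have "g \<cdot> f \<^bold>+ b \<cdot> a = Idn C X" unfolding h(2) ab(4)[symmetric] 
    using fg ab by (intro Add_comm) (auto simp: arr_simps)
  then show ?thesis unfolding stable_retract_def using fg ab by blast
qed

lemma perp_K_span: assumes "perp M" shows "K_span C E M \<subseteq> perp_subgroup"
proof -
  show ?thesis unfolding K_span_def
    by (rule K_syz.G.generate_subgroup_incl[OF _ perp_subgroup_subgroup])
      (use kc_perp_subgroup perp_stable_retract[OF assms] stable_summand_retract in auto)
qed

text \<open>
  Every iterated image of \<open>\<langle>M\<rangle>\<close> lies in the perpendicular subgroup, where the syzygy endomorphism is
  injective, so it maps each image isomorphically onto the next.
\<close>

lemma perp_Phi: assumes "perp M" shows "Phi C E M = 0"
proof -
  have sub: "(K_syz C E ^^ m) ` K_span C E M \<subseteq> perp_subgroup" for m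
  proof (induction m)
    case (Suc m)
    have "(K_syz C E ^^ Suc m) ` K_span C E M = K_syz C E ` (K_syz C E ^^ m) ` K_span C E M"
      by (simp add: image_comp)
    also have "\<dots> \<subseteq> perp_subgroup" by (rule order_trans[OF image_mono[OF Suc] K_syz_perp_subgroup])
    finally show ?case .
  qed (use perp_K_span[OF assms] in simp)
  have "K_syz C E \<in> iso (K\<lparr>carrier := (K_syz C E ^^ m) ` K_span C E M\<rparr>)
                     (K\<lparr>carrier := (K_syz C E ^^ Suc m) ` K_span C E M\<rparr>)" for m
  proof (rule isoI)
    have "x \<in> carrier K" if "x \<in> (K_syz C E ^^ m) ` K_span C E M" for x
      using that sub subgroup.subset[OF perp_subgroup_subgroup] by blast
    then show "K_syz C E \<in> hom (K\<lparr>carrier := (K_syz C E ^^ m) ` K_span C E M\<rparr>)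
                     (K\<lparr>carrier := (K_syz C E ^^ Suc m) ` K_span C E M\<rparr>)"
      using hom_mult[OF K_syz_hom] by (auto simp: hom_def)
    show "bij_betw (K_syz C E) (carrier (K\<lparr>carrier := (K_syz C E ^^ m) ` K_span C E M\<rparr>))
        (carrier (K\<lparr>carrier := (K_syz C E ^^ Suc m) ` K_span C E M\<rparr>))"
      using inj_on_subset[OF K_syz_inj_on sub] by (simp add: bij_betw_def image_comp)
  qed
  then show ?thesis unfolding Phi_def by (intro Least_eq_0) blast
qed

end

theorem corollary4p2:
  fixes C :: "('o, 'm) cat" and E :: "('m \<times> 'm) set"
  assumes "exact_IT_context C E" and "weakly_idempotent_complete C"
  shows "(\<forall>M \<in> left_perp C E (Proj C E). Phi C E M = 0 \<and> Psi C E M = 0) \<and>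
         (\<forall>M \<in> left_perp C E (Proj C E). M \<notin> Proj C E \<longrightarrow> pd C E M = \<infinity>)"
proof -
  interpret exact_IT_context C E by (rule assms(1))
  have "Phi C E M = 0 \<and> Psi C E M = 0" if "M \<in> left_perp C E (Proj C E)" for M
    using left_perp_imp_perp[OF that] perp_Phi perp_fpd_add_class by (simp add: Psi_def zero_enat_def)
  moreover have "pd C E M = \<infinity>" if "M \<in> left_perp C E (Proj C E)" "M \<notin> Proj C E" for M
    using left_perp_imp_perp[OF that(1)] perp_finite_pd_imp_Proj[of M] that(2) by (cases "pd C E M") auto
  ultimately show ?thesis by blast
qed

end
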